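(* Let $X$ be a real Hilbert space and $A$ a nonnegative self-adjoint operator with dense domain in $X$. Consider $$\tfrac{d}{dt}q=p,\qquad \tfrac{d}{dt}p=-c(q)^2Aq,\qquad c(q)=\frac1{1+\langle q,Aq\rangle}.\tag{K}$$ Let $s>1$. There is a function $C:[0,\infty)\to[0,\infty)$ (depending on $s$) such that every $\mathcal H^\infty$ solution $(q,p)$ to (K) on an open interval $I\ni0$ satisfies, for all $t\in I$, $$\|p(t)\|_{H^{s-1}}\le C\bigl(\|(q(0),p(0))\|_{\mathcal H^s}\bigr),\qquad \|A^{1/2}q(t)\|_{H^{s-1}}\le C\bigl(\|(q(0),p(0))\|_{\mathcal H^s}\bigr)\langle t\rangle,$$ where $\langle t\rangle=(1+t^2)^{1/2}$. Moreover, if $\Omega\subset\mathcal H^\infty$ is bounded and equicontinuous in $\mathcal H^s$, then for every $T>0$ so is $$\Omega_T=\bigl\{(q(t),p(t)) : (q,p)\text{ is an }\mathcal H^\infty\text{ solution to (K) on an open interval }I\ni0\text{ with }(q(0),p(0))\in\Omega,\ t\in I\cap[-T,T]\bigr\}.$$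
   Context: Functions of $A$ are defined by the spectral functional calculus. For $s\in\mathbb R$, $H^s$ is the completion of the domain of $(1+A)^{s/2}$ in the norm $\|\phi\|_{H^s}^2=\langle\phi,(1+A)^s\phi\rangle$. For $s\ge1$, $\mathcal H^s=\{(q,p)\in X\times X: A^{1/2}q\in H^{s-1},\ p\in H^{s-1}\}$ with $\|(q,p)\|_{\mathcal H^s}^2=\|A^{1/2}q\|_{H^{s-1}}^2+\|p\|_{H^{s-1}}^2$, and $\mathcal H^\infty=\bigcap_{s\ge1}\mathcal H^s$. The expression $\langle q,Aq\rangle$ means $\|A^{1/2}q\|^2$. For $s\ge1$ and an open interval $I$, an $\mathcal H^s$ solution on $I$ is a map $t\mapsto(q(t),p(t))\in\mathcal H^s$ such that $A^{1/2}q,p\in C(I;H^{s-1})$, $q\in C^1(I;X)$ with $\frac{d}{dt}q=p$, and $p\in C^1(I;H^{s-2})$ with $\frac{d}{dt}p=-c(q)^2Aq$ in $H^{s-2}$. An $\mathcal H^\infty$ solution is a map that is an $\mathcal H^s$ solution for every $s\ge1$. For $\kappa>0$ let $P_{\ge\kappa}=\chi_{[\kappa^2,\infty)}(A)$. A set that is bounded in $\mathcal H^s$ is equicontinuous in $\mathcal H^s$ if for every $\varepsilon>0$ there is $\kappa>0$ such that $\|(P_{\ge\kappa}q,P_{\ge\kappa}p)\|_{\mathcal H^s}\le\varepsilon$ for all its elements $(q,p)$. *)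

theory Defs
  imports "HOL-Analysis.Analysis"
begin

section \<open>Self-adjoint operators and the spectral functional calculus\<close>

text \<open>
  A real Hilbert space is a type of class \<open>{real_inner, complete_space}\<close>.
  An unbounded operator is a pair of a domain \<open>D\<close> and a function \<open>A\<close>;
  the values of \<open>A\<close> outside \<open>D\<close> play no role.
\<close>

definition linear_operator_on :: "'a::real_inner set \<Rightarrow> ('a \<Rightarrow> 'a) \<Rightarrow> bool" where
  "linear_operator_on D A \<longleftrightarrow>
     subspace D \<and>
     (\<forall>x\<in>D. \<forall>y\<in>D. A (x + y) = A x + A y) \<and>
     (\<forall>r. \<forall>x\<in>D. A (r *\<^sub>R x) = r *\<^sub>R A x)"

text \<open>
  The last clause says that the graph of the adjoint of \<open>A\<close>, i.e. the set of all \<open>(y, z)\<close> with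
  \<open>\<langle>A x, y\<rangle> = \<langle>x, z\<rangle>\<close> for all \<open>x \<in> D\<close>, equals the graph of \<open>A\<close>.
\<close>

definition self_adjoint_operator :: "'a::real_inner set \<Rightarrow> ('a \<Rightarrow> 'a) \<Rightarrow> bool" where
  "self_adjoint_operator D A \<longleftrightarrow>
     linear_operator_on D A \<and> closure D = UNIV \<and>
     (\<forall>y z. (\<forall>x\<in>D. A x \<bullet> y = x \<bullet> z) \<longleftrightarrow> y \<in> D \<and> z = A y)"

definition nonneg_operator :: "'a::real_inner set \<Rightarrow> ('a \<Rightarrow> 'a) \<Rightarrow> bool" where
  "nonneg_operator D A \<longleftrightarrow> (\<forall>x\<in>D. 0 \<le> x \<bullet> A x)"

definition projection_valued_measure :: "(real set \<Rightarrow> 'a::real_inner \<Rightarrow> 'a) \<Rightarrow> bool" where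
  "projection_valued_measure E \<longleftrightarrow>
     (\<forall>S\<in>sets borel. bounded_linear (E S) \<and> (\<forall>x y. E S x \<bullet> y = x \<bullet> E S y)) \<and>
     (\<forall>x. E UNIV x = x) \<and>
     (\<forall>S\<in>sets borel. \<forall>T\<in>sets borel. \<forall>x. E S (E T x) = E (S \<inter> T) x) \<and>
     (\<forall>F::nat \<Rightarrow> real set. range F \<subseteq> sets borel \<longrightarrow> disjoint_family F \<longrightarrow>
        (\<forall>x. (\<lambda>i. E (F i) x) sums E (\<Union>i. F i) x))"

definition pvm_measure :: "(real set \<Rightarrow> 'a::real_inner \<Rightarrow> 'a) \<Rightarrow> 'a \<Rightarrow> real measure" where
  "pvm_measure E x = measure_of UNIV (sets borel) (\<lambda>S. ennreal (E S x \<bullet> x))"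

text \<open>
  \<open>pvm_form E g x y\<close> is \<open>\<integral> g d\<langle>E x, y\<rangle>\<close> for bounded Borel \<open>g\<close>, the signed measure being written
  through finite positive ones by polarization. \<open>pvm_bounded E g\<close> is the operator \<open>\<integral> g dE\<close>
  for bounded \<open>g\<close>. For general Borel \<open>f\<close> the operator \<open>\<integral> f dE\<close> has domain
  \<open>pvm_dom E f\<close> (all \<open>x\<close> with \<open>\<integral> f\<^sup>2 d\<langle>E x, x\<rangle> < \<infinity>\<close>), and its value there is the limit of the
  bounded operators obtained from \<open>f\<close> by cutting it off where \<open>\<bar>f\<bar> > n\<close>.
\<close>

definition pvm_form ::
    "(real set \<Rightarrow> 'a::real_inner \<Rightarrow> 'a) \<Rightarrow> (real \<Rightarrow> real) \<Rightarrow> 'a \<Rightarrow> 'a \<Rightarrow> real" where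
  "pvm_form E g x y =
     (integral\<^sup>L (pvm_measure E (x + y)) g - integral\<^sup>L (pvm_measure E (x - y)) g) / 4"

definition pvm_bounded ::
    "(real set \<Rightarrow> 'a::real_inner \<Rightarrow> 'a) \<Rightarrow> (real \<Rightarrow> real) \<Rightarrow> 'a \<Rightarrow> 'a" where
  "pvm_bounded E g x = (THE z. \<forall>y. z \<bullet> y = pvm_form E g x y)"

definition pvm_dom ::
    "(real set \<Rightarrow> 'a::real_inner \<Rightarrow> 'a) \<Rightarrow> (real \<Rightarrow> real) \<Rightarrow> 'a set" where
  "pvm_dom E f = {x. integrable (pvm_measure E x) (\<lambda>l. (f l)\<^sup>2)}"

definition pvm_fun ::
    "(real set \<Rightarrow> 'a::real_inner \<Rightarrow> 'a) \<Rightarrow> (real \<Rightarrow> real) \<Rightarrow> 'a \<Rightarrow> 'a" where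
  "pvm_fun E f x = lim (\<lambda>n::nat. pvm_bounded E (\<lambda>l. if \<bar>f l\<bar> \<le> real n then f l else 0) x)"

definition is_spectral_measure ::
    "'a::real_inner set \<Rightarrow> ('a \<Rightarrow> 'a) \<Rightarrow> (real set \<Rightarrow> 'a \<Rightarrow> 'a) \<Rightarrow> bool" where
  "is_spectral_measure D A E \<longleftrightarrow>
     projection_valued_measure E \<and>
     D = pvm_dom E (\<lambda>l. l) \<and> (\<forall>x\<in>D. A x = pvm_fun E (\<lambda>l. l) x)"

text \<open>
  By the spectral theorem a self-adjoint operator has a spectral measure, and its values
  on Borel sets are unique; on other sets \<open>E\<close> is unconstrained, hence the choice operator.
  For nonnegative \<open>A\<close> the negative half-line is a null set, so the values there of
  functions such as \<open>sqrt\<close> below are immaterial.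
\<close>

definition spectral_measure ::
    "'a::real_inner set \<Rightarrow> ('a \<Rightarrow> 'a) \<Rightarrow> real set \<Rightarrow> 'a \<Rightarrow> 'a" where
  "spectral_measure D A = (SOME E. is_spectral_measure D A E)"

definition fun_dom :: "'a::real_inner set \<Rightarrow> ('a \<Rightarrow> 'a) \<Rightarrow> (real \<Rightarrow> real) \<Rightarrow> 'a set" where
  "fun_dom D A f = pvm_dom (spectral_measure D A) f"

definition fun_op :: "'a::real_inner set \<Rightarrow> ('a \<Rightarrow> 'a) \<Rightarrow> (real \<Rightarrow> real) \<Rightarrow> 'a \<Rightarrow> 'a" where
  "fun_op D A f = pvm_fun (spectral_measure D A) f"

abbreviation sqrt_dom :: "'a::real_inner set \<Rightarrow> ('a \<Rightarrow> 'a) \<Rightarrow> 'a set" where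
  "sqrt_dom D A \<equiv> fun_dom D A sqrt"

abbreviation sqrt_op :: "'a::real_inner set \<Rightarrow> ('a \<Rightarrow> 'a) \<Rightarrow> 'a \<Rightarrow> 'a" where
  "sqrt_op D A \<equiv> fun_op D A sqrt"

definition proj_ge :: "'a::real_inner set \<Rightarrow> ('a \<Rightarrow> 'a) \<Rightarrow> real \<Rightarrow> 'a \<Rightarrow> 'a" where
  "proj_ge D A \<kappa> = fun_op D A (indicator {\<kappa>\<^sup>2..})"


section \<open>The spaces \<open>H\<^sup>s\<close>\<close>

definition sob_dom :: "'a::real_inner set \<Rightarrow> ('a \<Rightarrow> 'a) \<Rightarrow> real \<Rightarrow> 'a set" where
  "sob_dom D A s = fun_dom D A (\<lambda>l. (1 + l) powr (s / 2))"

text \<open>On this domain \<open>\<langle>\<phi>, (1 + A)\<^sup>s \<phi>\<rangle>\<close> is understood as a form, \<open>\<parallel>(1 + A)\<^bsup>s/2\<^esup> \<phi>\<parallel>\<^sup>2\<close>.\<close>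

definition sob_norm :: "'a::real_inner set \<Rightarrow> ('a \<Rightarrow> 'a) \<Rightarrow> real \<Rightarrow> 'a \<Rightarrow> real" where
  "sob_norm D A s \<phi> = norm (fun_op D A (\<lambda>l. (1 + l) powr (s / 2)) \<phi>)"

text \<open>
  The completion \<open>H\<^sup>s\<close> of \<open>sob_dom D A s\<close>: its elements are represented by Cauchy sequences for
  the \<open>H\<^sup>s\<close> norm, and two sequences represent the same element iff the completed norm \<open>hs_norm\<close> of
  their difference vanishes. A vector of \<open>X\<close> is regarded as an element of \<open>H\<^sup>s\<close> through the constant
  sequence, which is in \<open>hs D A s\<close> iff the vector is in \<open>sob_dom D A s\<close>, and then has
  the same norm. For \<open>s \<ge> 0\<close> the domain is already complete, so that \<open>H\<^sup>s\<close> is \<open>sob_dom D A s\<close>.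
\<close>

definition hs :: "'a::real_inner set \<Rightarrow> ('a \<Rightarrow> 'a) \<Rightarrow> real \<Rightarrow> (nat \<Rightarrow> 'a) set" where
  "hs D A s = {u. (\<forall>n. u n \<in> sob_dom D A s) \<and>
     (\<forall>e>0. \<exists>N. \<forall>m\<ge>N. \<forall>n\<ge>N. sob_norm D A s (u m - u n) < e)}"

definition hs_norm :: "'a::real_inner set \<Rightarrow> ('a \<Rightarrow> 'a) \<Rightarrow> real \<Rightarrow> (nat \<Rightarrow> 'a) \<Rightarrow> real" where
  "hs_norm D A s u = lim (\<lambda>n. sob_norm D A s (u n))"

definition hs_of :: "'a \<Rightarrow> nat \<Rightarrow> 'a" where
  "hs_of x = (\<lambda>n. x)"

definition hs_continuous_on ::
    "'a::real_inner set \<Rightarrow> ('a \<Rightarrow> 'a) \<Rightarrow> real \<Rightarrow> real set \<Rightarrow> (real \<Rightarrow> nat \<Rightarrow> 'a) \<Rightarrow> bool" where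
  "hs_continuous_on D A s I f \<longleftrightarrow>
     (\<forall>t\<in>I. f t \<in> hs D A s) \<and>
     (\<forall>t\<in>I. ((\<lambda>\<tau>. hs_norm D A s (\<lambda>n. f \<tau> n - f t n)) \<longlongrightarrow> 0) (at t within I))"

text \<open>\<open>f \<in> C\<^sup>1(I; H\<^sup>s)\<close> with derivative \<open>g\<close>\<close>

definition hs_C1_deriv_on ::
    "'a::real_inner set \<Rightarrow> ('a \<Rightarrow> 'a) \<Rightarrow> real \<Rightarrow> real set \<Rightarrow>
      (real \<Rightarrow> nat \<Rightarrow> 'a) \<Rightarrow> (real \<Rightarrow> nat \<Rightarrow> 'a) \<Rightarrow> bool" where
  "hs_C1_deriv_on D A s I f g \<longleftrightarrow>
     hs_continuous_on D A s I f \<and> hs_continuous_on D A s I g \<and>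
     (\<forall>t\<in>I. ((\<lambda>\<tau>. hs_norm D A s (\<lambda>n. (f \<tau> n - f t n) /\<^sub>R (\<tau> - t) - g t n)) \<longlongrightarrow> 0)
        (at t within I))"


section \<open>The phase space and equation (K)\<close>

definition cal_h :: "'a::real_inner set \<Rightarrow> ('a \<Rightarrow> 'a) \<Rightarrow> real \<Rightarrow> ('a \<times> 'a) set" where
  "cal_h D A s = {(q, p). q \<in> sqrt_dom D A \<and> sqrt_op D A q \<in> sob_dom D A (s - 1) \<and>
     p \<in> sob_dom D A (s - 1)}"

definition cal_h_norm :: "'a::real_inner set \<Rightarrow> ('a \<Rightarrow> 'a) \<Rightarrow> real \<Rightarrow> 'a \<times> 'a \<Rightarrow> real" where
  "cal_h_norm D A s = (\<lambda>(q, p).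
     sqrt ((sob_norm D A (s - 1) (sqrt_op D A q))\<^sup>2 + (sob_norm D A (s - 1) p)\<^sup>2))"

definition cal_h_inf :: "'a::real_inner set \<Rightarrow> ('a \<Rightarrow> 'a) \<Rightarrow> ('a \<times> 'a) set" where
  "cal_h_inf D A = (\<Inter>s\<in>{1..}. cal_h D A s)"

definition kcoef :: "'a::real_inner set \<Rightarrow> ('a \<Rightarrow> 'a) \<Rightarrow> 'a \<Rightarrow> real" where
  "kcoef D A q = 1 / (1 + (norm (sqrt_op D A q))\<^sup>2)"

text \<open>
  \<open>A q\<close> as an element of \<open>H\<^bsup>s-2\<^esup>\<close> when \<open>A\<^bsup>1/2\<^esup> q \<in> H\<^bsup>s-1\<^esup>\<close>, \<open>s \<ge> 1\<close>; here \<open>q\<close> need not be in \<open>D\<close>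
  if \<open>s < 2\<close>, and \<open>A q\<close> refers to the continuous extension \<open>H\<^bsup>s-1\<^esup> \<rightarrow> H\<^bsup>s-2\<^esup>\<close> of \<open>A\<^bsup>1/2\<^esup>\<close>, applied
  to \<open>A\<^bsup>1/2\<^esup> q\<close>. The spectral truncations \<open>q\<^sub>n\<close> of \<open>q\<close> to \<open>A \<le> n\<close> lie in \<open>D\<close> and satisfy
  \<open>A\<^bsup>1/2\<^esup> q\<^sub>n \<rightarrow> A\<^bsup>1/2\<^esup> q\<close> in \<open>H\<^bsup>s-1\<^esup>\<close>, so the sequence \<open>A q\<^sub>n\<close> represents it (if \<open>q \<in> D\<close>
  and \<open>s \<ge> 2\<close>, the same element as the vector \<open>A q\<close>).
\<close>

definition hs_A :: "'a::real_inner set \<Rightarrow> ('a \<Rightarrow> 'a) \<Rightarrow> 'a \<Rightarrow> nat \<Rightarrow> 'a" where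
  "hs_A D A q = (\<lambda>n. A (fun_op D A (indicator {..real n}) q))"

definition cal_h_solution ::
    "'a::real_inner set \<Rightarrow> ('a \<Rightarrow> 'a) \<Rightarrow> real \<Rightarrow> real set \<Rightarrow> (real \<Rightarrow> 'a) \<Rightarrow> (real \<Rightarrow> 'a) \<Rightarrow> bool" where
  "cal_h_solution D A s I q p \<longleftrightarrow>
     (\<forall>t\<in>I. (q t, p t) \<in> cal_h D A s) \<and>
     hs_continuous_on D A (s - 1) I (\<lambda>t. hs_of (sqrt_op D A (q t))) \<and>
     hs_continuous_on D A (s - 1) I (\<lambda>t. hs_of (p t)) \<and>
     (\<forall>t\<in>I. (q has_vector_derivative p t) (at t within I)) \<and> continuous_on I p \<and>
     hs_C1_deriv_on D A (s - 2) I (\<lambda>t. hs_of (p t))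
       (\<lambda>t n. - (kcoef D A (q t))\<^sup>2 *\<^sub>R hs_A D A (q t) n)"

definition cal_h_inf_solution ::
    "'a::real_inner set \<Rightarrow> ('a \<Rightarrow> 'a) \<Rightarrow> real set \<Rightarrow> (real \<Rightarrow> 'a) \<Rightarrow> (real \<Rightarrow> 'a) \<Rightarrow> bool" where
  "cal_h_inf_solution D A I q p \<longleftrightarrow> (\<forall>s\<ge>1. cal_h_solution D A s I q p)"

definition open_interval :: "real set \<Rightarrow> bool" where
  "open_interval I \<longleftrightarrow> open I \<and> is_interval I"

definition cal_h_bounded ::
    "'a::real_inner set \<Rightarrow> ('a \<Rightarrow> 'a) \<Rightarrow> real \<Rightarrow> ('a \<times> 'a) set \<Rightarrow> bool" where
  "cal_h_bounded D A s \<Omega> \<longleftrightarrow>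
     \<Omega> \<subseteq> cal_h D A s \<and> (\<exists>M. \<forall>w\<in>\<Omega>. cal_h_norm D A s w \<le> M)"

definition cal_h_equicontinuous ::
    "'a::real_inner set \<Rightarrow> ('a \<Rightarrow> 'a) \<Rightarrow> real \<Rightarrow> ('a \<times> 'a) set \<Rightarrow> bool" where
  "cal_h_equicontinuous D A s \<Omega> \<longleftrightarrow>
     (\<forall>\<epsilon>>0. \<exists>\<kappa>>0. \<forall>(q, p)\<in>\<Omega>. cal_h_norm D A s (proj_ge D A \<kappa> q, proj_ge D A \<kappa> p) \<le> \<epsilon>)"

definition evolved_set ::
    "'a::real_inner set \<Rightarrow> ('a \<Rightarrow> 'a) \<Rightarrow> ('a \<times> 'a) set \<Rightarrow> real \<Rightarrow> ('a \<times> 'a) set" where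
  "evolved_set D A \<Omega> T = {(q t, p t) | q p I t.
     open_interval I \<and> 0 \<in> I \<and> cal_h_inf_solution D A I q p \<and> (q 0, p 0) \<in> \<Omega> \<and>
     t \<in> I \<inter> {-T..T}}"

end

theory Submission
  imports Defs "HOL-Probability.Helly_Selection" "HOL-Computational_Algebra.Polynomial"
begin

text \<open>
  For every nondecreasing \<open>f \<ge> 0\<close> the flow of (K) conserves, when the spectrum of \<open>A\<close> is discrete,
  \<open>\<langle>p, f(A)p\<rangle> + c\<langle>q, Af(A)q\<rangle> + 1/2 \<Sum>\<^sub>j\<^sub>k \<lambda>\<^sub>j\<lambda>\<^sub>k (f(\<lambda>\<^sub>j) - f(\<lambda>\<^sub>k))/(\<lambda>\<^sub>j - \<lambda>\<^sub>k) (p\<^sub>jq\<^sub>k - q\<^sub>jp\<^sub>k)\<^sup>2\<close>, a sum of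
  nonnegative terms. For \<open>f(\<lambda>) = (\<lambda>/(\<lambda> + z))\<^sup>N\<close> the last term is a finite sum of products of quadratic
  forms in bounded functions of \<open>A\<close>, which makes sense for any spectrum, and the conservation law bounds
  \<open>\<langle>p, f(A)p\<rangle> + c\<langle>q, Af(A)q\<rangle>\<close> by its value at time 0, up to a constant independent of \<open>z\<close>.
  Summing this over dyadic \<open>z\<close> with weights \<open>z\<^sup>\<beta>\<close>, \<open>\<beta> = s - 1\<close>, gives the bound in \<open>\<H>\<^sup>s\<close>, and summing over
  \<open>z \<ge> 2\<^sup>K\<close> only gives the bound on high frequencies.

  The spectral measure of \<open>A\<close> is obtained from the resolvent \<open>(1 + A)\<^sup>-\<^sup>1\<close>, a positive contraction \<open>T\<close>:
  the numbers \<open>\<langle>T\<^sup>nx, x\<rangle>\<close> are the moments of a measure on \<open>[0, 1]\<close>, a weak limit of the discrete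
  measures with masses \<open>binom(n, k) \<langle>T\<^sup>k(1 - T)\<^sup>n\<^sup>-\<^sup>kx, x\<rangle>\<close> at \<open>k/n\<close>.
\<close>

section \<open>The Riesz representation theorem and the Hausdorff moment problem\<close>

text \<open>With x = l/(l+z) and y = m/(m+z), the quotient l m (x^N - y^N)/(l - m) equals z times
  the sum of x^(a+1) y^(N-a) over a < N; this is why powers of A(A+z)^-1 turn the double sum into
  finitely many products of quadratic forms. The obstacle is the factor c. The conservation law
  controls A^(1/2) q only after multiplication by c(q) = 1/(1 + |A^(1/2) q|^2), and in X it says
  nothing about A^(1/2) q, since c |A^(1/2) q|^2 < 1 always. So 1 + |A^(1/2) q|^2 must separately be
  shown to grow at most like 1 + t^2. For N = 1 and large z the law bounds the part above z by a
  quarter of this quantity, because the data are bounded in a norm stronger than that of the energy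
  space; this is where s > 1 enters. The part below z is a form in q alone, and q moves with bounded
  speed in X. Dividing by c then costs a factor <t> for A^(1/2) q and nothing for p.\<close>

lemma riesz_on_closed_subspace:
  fixes M :: "'a::{real_inner, complete_space} set" and f :: "'a \<Rightarrow> real"
  assumes M: "subspace M" "closed M"
    and add: "\<And>x y. x \<in> M \<Longrightarrow> y \<in> M \<Longrightarrow> f (x + y) = f x + f y"
    and scale: "\<And>c x. x \<in> M \<Longrightarrow> f (c *\<^sub>R x) = c * f x"
    and bound: "\<And>x. x \<in> M \<Longrightarrow> \<bar>f x\<bar> \<le> K * norm x"
  obtains u where "u \<in> M" "\<And>w. w \<in> M \<Longrightarrow> f w = w \<bullet> u"
proof -
  \<comment> \<open>If f is the inner product with u, then J w = |w - u|^2 - |u|^2, so the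
    representing vector is the minimiser of \<open>J\<close> on \<open>M\<close>.\<close>
  define J where "J w = (norm w)\<^sup>2 - 2 * f w" for w
  have J_lower: "- K\<^sup>2 \<le> J w" if "w \<in> M" for w
  proof -
    have "2 * f w \<le> 2 * K * norm w" using bound[OF that] by simp
    moreover have "0 \<le> (norm w - K)\<^sup>2" by simp
    ultimately show ?thesis unfolding J_def by (simp add: power2_eq_square algebra_simps)
  qed
  define d where "d = Inf (J ` M)"
  have ne: "J ` M \<noteq> {}" using subspace_0[OF M(1)] by auto
  have bdd: "bdd_below (J ` M)" using J_lower by (auto intro!: bdd_belowI)
  have d_le: "d \<le> J w" if "w \<in> M" for w
    unfolding d_def using bdd that by (auto intro: cInf_lower)
  have "\<exists>w\<in>M. J w < d + 1 / Suc n" for n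
    using cInf_lessD[OF ne, of "d + 1 / Suc n"] unfolding d_def by auto
  then obtain w where w: "\<And>n. w n \<in> M" "\<And>n. J (w n) < d + 1 / Suc n" by metis
  \<comment> \<open>Parallelogram identity at the midpoint: near-minimisers are close to each other,
    so a minimising sequence is Cauchy.\<close>
  have par: "(norm (x - y))\<^sup>2 \<le> 2 * (J x - d) + 2 * (J y - d)" if "x \<in> M" "y \<in> M" for x y
  proof -
    have "(1/2) *\<^sub>R (x + y) \<in> M" using that M(1) by (simp add: subspace_add subspace_scale)
    then have "d \<le> J ((1/2) *\<^sub>R (x + y))" by (rule d_le)
    also have "\<dots> = (norm (x + y))\<^sup>2 / 4 - (f x + f y)"
      using that scale[of "x + y" "1/2"] add[OF that] M(1)
      by (simp add: J_def subspace_add power2_eq_square)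
    finally have "4 * d \<le> (norm (x + y))\<^sup>2 - 4 * (f x + f y)" by simp
    moreover have "(norm (x - y))\<^sup>2 + (norm (x + y))\<^sup>2 = 2 * (norm x)\<^sup>2 + 2 * (norm y)\<^sup>2"
      by (simp add: power2_norm_eq_inner inner_simps inner_commute)
    ultimately show ?thesis unfolding J_def by simp
  qed
  have "Cauchy w"
  proof (rule metric_CauchyI)
    fix e :: real assume e: "0 < e"
    obtain N where N: "4 / e\<^sup>2 < real N" using reals_Archimedean2 by blast
    have *: "J (w n) - d < e\<^sup>2 / 4" if "N \<le> n" for n
    proof -
      have "4 / e\<^sup>2 < real (Suc n)" using N that by simp
      then have "1 / Suc n < e\<^sup>2 / 4" using e by (simp add: field_simps)
      then show ?thesis using w(2)[of n] by simp
    qed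
    have "dist (w m) (w n) < e" if "N \<le> m" "N \<le> n" for m n
    proof -
      have "(norm (w m - w n))\<^sup>2 < e\<^sup>2"
        using par[OF w(1)[of m] w(1)[of n]] *[OF that(1)] *[OF that(2)] by simp
      then show ?thesis using e by (simp add: dist_norm power_less_imp_less_base)
    qed
    then show "\<exists>N. \<forall>m\<ge>N. \<forall>n\<ge>N. dist (w m) (w n) < e" by blast
  qed
  then obtain u where lim: "w \<longlonglongrightarrow> u" using Cauchy_convergent_iff convergentD by blast
  have uM: "u \<in> M" using M(2) w(1) lim closed_sequentially by blast
  have f_diff: "f x - f y = f (x - y)" if "x \<in> M" "y \<in> M" for x y
    using add[of "x - y" y] that M(1) by (simp add: subspace_diff)
  have "(\<lambda>n. f (w n)) \<longlonglongrightarrow> f u"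
  proof (rule LIM_zero_cancel, rule Lim_null_comparison)
    show "\<forall>\<^sub>F n in sequentially. norm (f (w n) - f u) \<le> K * norm (w n - u)"
      using f_diff[OF w(1) uM] bound M(1) w(1) uM by (simp add: subspace_diff)
    show "(\<lambda>n. K * norm (w n - u)) \<longlonglongrightarrow> 0"
      using tendsto_mult_right_zero[OF tendsto_norm_zero[OF LIM_zero[OF lim]]] by simp
  qed
  then have "(\<lambda>n. J (w n)) \<longlonglongrightarrow> J u" unfolding J_def by (intro tendsto_intros lim)
  moreover have "(\<lambda>n. d + 1 / Suc n) \<longlonglongrightarrow> d + 0"
    by (intro tendsto_intros LIMSEQ_Suc lim_1_over_n)
  ultimately have "J u \<le> d" using w(2) by (intro LIMSEQ_le) (auto intro: less_imp_le)
  then have min: "J u \<le> J x" if "x \<in> M" for x using d_le[OF that] by simp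
  have "f v = v \<bullet> u" if v: "v \<in> M" for v
  proof (cases "v = 0")
    case True then show ?thesis using scale[OF v, of 0] by simp
  next
    case False
    \<comment> \<open>Moving from \<open>u\<close> by t v changes \<open>J\<close> by t^2 |v|^2 - 2
      t a; the chosen \<open>t\<close> makes this - a^2 / |v|^2, which minimality allows only for a
      = 0.\<close>
    define a where "a = f v - v \<bullet> u"
    define t where "t = a / (norm v)\<^sup>2"
    have "u + t *\<^sub>R v \<in> M" using uM v M(1) by (simp add: subspace_add subspace_scale)
    then have "J u \<le> J (u + t *\<^sub>R v)" by (rule min)
    also have "\<dots> = J u + (t\<^sup>2 * (norm v)\<^sup>2 - 2 * t * a)"
      using add[of u "t *\<^sub>R v"] scale[OF v] uM v M(1)
      unfolding J_def a_def power2_norm_eq_inner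
      by (simp add: subspace_scale inner_simps inner_commute power2_eq_square algebra_simps)
    also have "t\<^sup>2 * (norm v)\<^sup>2 - 2 * t * a = - a\<^sup>2 / (norm v)\<^sup>2"
      using False by (simp add: t_def power2_eq_square field_simps)
    finally have "a\<^sup>2 / (norm v)\<^sup>2 \<le> 0" by simp
    then have "a = 0" using False by (auto simp: divide_le_0_iff)
    then show ?thesis by (simp add: a_def)
  qed
  then show ?thesis using that uM by blast
qed

text \<open>The j-th power of k/n with powers replaced by falling factorials. With this replacement
  Bernstein masses reproduce moments exactly: the sum over k of binom(n, k) x^k (1-x)^(n-k) times
  this ratio is x^j.\<close>

definition bernstein_moment :: "nat \<Rightarrow> nat \<Rightarrow> nat \<Rightarrow> real" where
  "bernstein_moment n j k = real (k choose j) / real (n choose j)"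

text \<open>Both quantities are products of j factors in [0, 1], and the factors k/n and (k-i)/(n-i)
  differ by at most j/n; the error of the product is at most the sum of the errors of the
  factors.\<close>

lemma bernstein_moment_close:
  assumes "k \<le> n" "j \<le> n" "0 < n"
  shows "\<bar>(real k / real n) ^ j - bernstein_moment n j k\<bar> \<le> real j * real j / real n"
proof -
  have prod: "bernstein_moment n j k = (\<Prod>i<j. real (k - i) / real (n - i))"
  proof (cases "j \<le> k")
    case True
    have "real (k choose j) = (\<Prod>i<j. real (k - i)) / fact j"
      using True by (simp add: binomial_gbinomial gbinomial_prod_rev of_nat_diff atLeast0LessThan)
    moreover have "real (n choose j) = (\<Prod>i<j. real (n - i)) / fact j"
      using assms by (simp add: binomial_gbinomial gbinomial_prod_rev of_nat_diff atLeast0LessThan)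
    ultimately show ?thesis by (simp add: bernstein_moment_def prod_dividef)
  next
    case False
    \<comment> \<open>For k < j the factor with i = k vanishes.\<close>
    then have "(\<Prod>i<j. real (k - i) / real (n - i)) = 0"
      by (intro prod_zero) (auto intro!: bexI[of _ k])
    moreover have "k choose j = 0" using False by simp
    ultimately show ?thesis unfolding bernstein_moment_def by (simp only: of_nat_0 div_0)
  qed
  have "norm ((\<Prod>i<j. real k / real n) - (\<Prod>i<j. real (k - i) / real (n - i)))
      \<le> (\<Sum>i<j. norm (real k / real n - real (k - i) / real (n - i)))"
    using assms by (intro norm_prod_diff) (auto simp: divide_simps)
  also have "\<dots> \<le> (\<Sum>i<j. real j / real n)"
  proof (rule sum_mono)
    fix i assume "i \<in> {..<j}"
    then have i: "i < j" by simp
    show "norm (real k / real n - real (k - i) / real (n - i)) \<le> real j / real n"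
    proof (cases "i \<le> k")
      case True
      have n: "0 < real n" "0 < real n - real i" using assms i by auto
      have "real k / real n - real (k - i) / real (n - i) = real i * (real n - real k) / (real n * (real n - real i))"
        using True assms i n by (simp add: of_nat_diff field_simps)
      also have "\<dots> = (real i / real n) * ((real n - real k) / (real n - real i))" by simp
      finally have eq: "real k / real n - real (k - i) / real (n - i)
          = (real i / real n) * ((real n - real k) / (real n - real i))" .
      have "(real n - real k) / (real n - real i) \<le> 1" "0 \<le> (real n - real k) / (real n - real i)"
        using True assms i n by (auto simp: divide_simps)
      then have "0 \<le> (real i / real n) * ((real n - real k) / (real n - real i))"
        and "(real i / real n) * ((real n - real k) / (real n - real i)) \<le> real i / real n"
        using mult_left_mono[of "(real n - real k) / (real n - real i)" 1 "real i / real n"]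
        by (simp_all only: zero_le_mult_iff divide_nonneg_nonneg of_nat_0_le_iff mult_1_right simp_thms)
      moreover have "real i / real n \<le> real j / real n" using i n by (simp add: divide_right_mono)
      ultimately show ?thesis unfolding eq real_norm_def by linarith
    next
      case False
      \<comment> \<open>Here k < i, so \<open>k - i\<close> is truncated to 0, and k/n is at most
        j/n.\<close>
      then show ?thesis using i assms by (simp add: divide_right_mono)
    qed
  qed
  finally show ?thesis unfolding prod by simp
qed

text \<open>With m 0 = 1 the discrete measures are probability measures on [0, 1], hence tight, and
  a subsequence converges weakly. Their power moments of order j differ from m j by at most j^2/n,
  so the limit has the prescribed moments.\<close>

lemma hausdorff_moment_prob:
  fixes c :: "nat \<Rightarrow> nat \<Rightarrow> real" and m :: "nat \<Rightarrow> real"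
  assumes nonneg: "\<And>n k. k \<le> n \<Longrightarrow> 0 \<le> c n k"
    and moment: "\<And>n j. j \<le> n \<Longrightarrow> (\<Sum>k\<le>n. c n k * bernstein_moment n j k) = m j"
    and m0: "m 0 = 1"
  shows "\<exists>M. real_distribution M \<and> (AE t in M. t \<in> {0..1}) \<and> (\<forall>j. (\<integral>t. t ^ j \<partial>M) = m j)"
proof -
  \<comment> \<open>The index is \<open>Suc n\<close> so that no node involves division by
    zero.\<close>
  define D where "D n = distr (point_measure {..Suc n} (c (Suc n))) borel (\<lambda>k. real k / real (Suc n))" for n
  have int_D: "(\<integral>t. g t \<partial>D n) = (\<Sum>k\<le>Suc n. c (Suc n) k * g (real k / real (Suc n)))"
    if [measurable]: "g \<in> borel_measurable borel" for g :: "real \<Rightarrow> real" and n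
  proof -
    have "(\<integral>t. g t \<partial>D n) = (\<integral>k. g (real k / real (Suc n)) \<partial>point_measure {..Suc n} (\<lambda>k. ennreal (c (Suc n) k)))"
      unfolding D_def by (subst integral_distr) (auto simp: measurable_point_measure_eq1)
    also have "\<dots> = (\<Sum>k\<in>{..Suc n}. c (Suc n) k *\<^sub>R g (real k / real (Suc n)))"
      by (rule lebesgue_integral_point_measure_finite) (auto intro: nonneg)
    finally show ?thesis by (simp only: real_scaleR_def)
  qed
  have em_D: "emeasure (D n) S = (\<Sum>k\<in>{k\<in>{..Suc n}. real k / real (Suc n) \<in> S}. ennreal (c (Suc n) k))"
    if "S \<in> sets borel" for n S
    unfolding D_def using that
    by (subst emeasure_distr)
      (auto simp: measurable_point_measure_eq1 space_point_measure emeasure_point_measure_finite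
        intro!: sum.cong)
  have tot: "(\<Sum>k\<le>n. c n k) = 1" for n
    using moment[of 0 n] m0 by (simp add: bernstein_moment_def)
  have D_full: "emeasure (D n) S = 1" if "S \<in> sets borel" "{0..1} \<subseteq> S" for n S
  proof -
    have "{k\<in>{..Suc n}. real k / real (Suc n) \<in> S} = {..Suc n}"
      using that(2) by (auto simp: subset_eq)
    then have "emeasure (D n) S = (\<Sum>k\<le>Suc n. ennreal (c (Suc n) k))" by (simp only: em_D[OF that(1)])
    also have "\<dots> = ennreal (\<Sum>k\<le>Suc n. c (Suc n) k)" by (intro sum_ennreal) (use nonneg in auto)
    finally show ?thesis by (simp only: tot ennreal_1)
  qed
  have sp: "space (D n) = UNIV" "sets (D n) = sets borel" for n by (auto simp: D_def)
  have rd: "real_distribution (D n)" for n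
    unfolding real_distribution_def real_distribution_axioms_def
    using D_full[of UNIV n] sp by (auto intro!: prob_spaceI simp: real_distribution_axioms_def)
  have "tight D"
    unfolding tight_def
  proof (intro conjI allI impI rd)
    fix e :: real assume "0 < e"
    \<comment> \<open>Tightness is stated with half-open intervals, so the left end lies strictly
      below 0.\<close>
    have "1 - e < measure (D n) {-1<..1}" for n
    proof -
      have "emeasure (D n) {-1<..1} = 1" by (rule D_full) auto
      then show ?thesis using \<open>0 < e\<close> by (simp add: measure_def)
    qed
    then show "\<exists>a b. a < b \<and> (\<forall>n. 1 - e < measure (D n) {a<..b})"
      by (intro exI[of _ "-1"] exI[of _ 1]) auto
  qed
  then obtain r M where r: "strict_mono (r::nat\<Rightarrow>nat)" and M: "real_distribution M"
    and weak: "weak_conv_m (D \<circ> id \<circ> r) M"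
    using tight_imp_convergent_subsubsequence[of D id] strict_mono_id by blast
  interpret M: real_distribution M by (rule M)
  have conv: "(\<lambda>n. \<integral>t. g t \<partial>D (r n)) \<longlonglongrightarrow> (\<integral>t. g t \<partial>M)"
    if "\<And>x. isCont g x" "\<And>x. norm (g x) \<le> B" for g :: "real \<Rightarrow> real" and B
    using weak_conv_imp_integral_bdd_continuous_conv[of "D \<circ> id \<circ> r" M, OF _ M weak that] rd by simp
  \<comment> \<open>Weak convergence tests bounded continuous functions only; \<open>clamp\<close>
    makes the monomials bounded without changing them on [0, 1].\<close>
  define clamp where "clamp t = max 0 (min 1 t)" for t :: real
  have clamp_cont: "isCont clamp t" for t unfolding clamp_def by (intro continuous_intros)
  have clamp_meas [measurable]: "clamp \<in> borel_measurable borel" unfolding clamp_def by measurable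
  have clamp01: "0 \<le> clamp t" "clamp t \<le> 1" for t by (auto simp: clamp_def)
  \<comment> \<open>A bounded continuous function that vanishes exactly on [0, 1]; its integral
    against the limit is zero, which confines the limit to [0, 1].\<close>
  define g where "g t = min 1 \<bar>t - clamp t\<bar>" for t
  have g_meas [measurable]: "g \<in> borel_measurable borel" unfolding g_def by measurable
  have g01: "0 \<le> g t" "g t \<le> 1" for t by (auto simp: g_def)
  have "(\<lambda>n. \<integral>t. g t \<partial>D (r n)) \<longlonglongrightarrow> (\<integral>t. g t \<partial>M)"
    by (rule conv[of _ 1]) (auto simp: g01 g_def[abs_def] intro!: continuous_intros clamp_cont)
  moreover have "(\<integral>t. g t \<partial>D n) = 0" for n
    by (simp only: int_D[OF g_meas], rule sum.neutral) (auto simp: g_def clamp_def divide_simps)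
  ultimately have "(\<lambda>n::nat. 0) \<longlonglongrightarrow> (\<integral>t. g t \<partial>M)" by (simp only:)
  then have int_g: "(\<integral>t. g t \<partial>M) = 0" using LIMSEQ_unique[OF _ tendsto_const] by blast
  have g_int: "integrable M g"
    by (rule M.integrable_const_bound[of _ 1]) (auto simp: g01)
  have "AE t in M. g t = 0"
    using int_g integral_nonneg_eq_0_iff_AE[OF g_int] g01 by simp
  then have AE: "AE t in M. t \<in> {0..1}"
    by eventually_elim (auto simp: g_def clamp_def split: if_splits)
  have "(\<integral>t. t ^ j \<partial>M) = m j" for j
  proof -
    have eq: "(\<integral>t. t ^ j \<partial>M) = (\<integral>t. clamp t ^ j \<partial>M)"
    proof (rule integral_cong_AE)
      show "AE t in M. t ^ j = clamp t ^ j" using AE by eventually_elim (simp add: clamp_def)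
    qed simp_all
    have c1: "(\<lambda>n. \<integral>t. clamp t ^ j \<partial>D (r n)) \<longlonglongrightarrow> (\<integral>t. clamp t ^ j \<partial>M)"
      by (rule conv[of _ 1]) (auto intro!: continuous_intros clamp_cont power_le_one simp: clamp01)
    have bd: "\<bar>(\<integral>t. clamp t ^ j \<partial>D n) - m j\<bar> \<le> real j * real j / real (Suc n)" if "j \<le> Suc n" for n
    proof -
      have "(\<integral>t. clamp t ^ j \<partial>D n) = (\<Sum>k\<le>Suc n. c (Suc n) k * (real k / real (Suc n)) ^ j)"
        by (subst int_D) (auto intro!: sum.cong simp: clamp_def divide_simps)
      then have "\<bar>(\<integral>t. clamp t ^ j \<partial>D n) - m j\<bar>
          = \<bar>\<Sum>k\<le>Suc n. c (Suc n) k * ((real k / real (Suc n)) ^ j - bernstein_moment (Suc n) j k)\<bar>"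
        using moment[OF that] by (simp add: right_diff_distrib sum_subtractf)
      also have "\<dots> \<le> (\<Sum>k\<le>Suc n. \<bar>c (Suc n) k * ((real k / real (Suc n)) ^ j - bernstein_moment (Suc n) j k)\<bar>)"
        by (rule sum_abs)
      also have "\<dots> \<le> (\<Sum>k\<le>Suc n. c (Suc n) k * (real j * real j / real (Suc n)))"
        unfolding abs_mult using nonneg that
        by (intro sum_mono mult_mono) (auto intro!: bernstein_moment_close simp del: of_nat_Suc)
      also have "\<dots> = real j * real j / real (Suc n)"
        by (simp only: sum_distrib_right[symmetric] tot mult_1_left)
      finally show ?thesis .
    qed
    have "(\<lambda>n. (\<integral>t. clamp t ^ j \<partial>D n) - m j) \<longlonglongrightarrow> 0"
    proof (rule Lim_null_comparison)
      show "\<forall>\<^sub>F n in sequentially. norm ((\<integral>t. clamp t ^ j \<partial>D n) - m j) \<le> real j * real j / real (Suc n)"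
        using eventually_ge_at_top[of j] by eventually_elim (simp only: real_norm_def, rule bd, simp)
      show "(\<lambda>n. real j * real j / real (Suc n)) \<longlonglongrightarrow> 0"
        using LIMSEQ_Suc[OF lim_const_over_n[of "real j * real j"]] by simp
    qed
    then have "(\<lambda>n. \<integral>t. clamp t ^ j \<partial>D n) \<longlonglongrightarrow> m j" by (rule LIM_zero_cancel)
    from LIMSEQ_subseq_LIMSEQ[OF this r] c1 show ?thesis unfolding eq comp_def
      by (rule LIMSEQ_unique[rotated])
  qed
  then show ?thesis using M AE by blast
qed

text \<open>Normalisation by m 0. If m 0 = 0, nonnegativity forces every coefficient and so every
  moment to vanish, and the null measure serves.\<close>

lemma hausdorff_moment:
  fixes c :: "nat \<Rightarrow> nat \<Rightarrow> real" and m :: "nat \<Rightarrow> real"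
  assumes nonneg: "\<And>n k. k \<le> n \<Longrightarrow> 0 \<le> c n k"
    and moment: "\<And>n j. j \<le> n \<Longrightarrow> (\<Sum>k\<le>n. c n k * bernstein_moment n j k) = m j"
  shows "\<exists>M. finite_measure M \<and> sets M = sets borel \<and> (AE t in M. t \<in> {0..1}) \<and> (\<forall>j. (\<integral>t. t ^ j \<partial>M) = m j)"
proof (cases "m 0 = 0")
  case True
  have "c n k = 0" if "k \<le> n" for n k
  proof -
    have "(\<Sum>k\<le>n. c n k) = 0" using moment[of 0 n] True by (simp add: bernstein_moment_def)
    then show ?thesis using nonneg that by (subst (asm) sum_nonneg_eq_0_iff) auto
  qed
  then have m_zero: "m j = 0" for j using moment[of j j] by simp
  have "AE t in null_measure borel. t \<in> {0..1::real}"
    by (rule AE_I[where N = "UNIV - {0..1}"]) auto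
  moreover have "finite_measure (null_measure borel)" by (rule finite_measureI) simp
  ultimately show ?thesis using m_zero
    by (intro exI[of _ "null_measure borel"]) simp
next
  case False
  have m0: "m 0 = (\<Sum>k\<le>0. c 0 k)" using moment[of 0 0] by (simp add: bernstein_moment_def)
  then have pos: "0 < m 0" using nonneg[of 0 0] False by simp
  have "\<exists>M. real_distribution M \<and> (AE t in M. t \<in> {0..1}) \<and> (\<forall>j. (\<integral>t. t ^ j \<partial>M) = m j / m 0)"
  proof (rule hausdorff_moment_prob[where c = "\<lambda>n k. c n k / m 0"])
    show "(\<Sum>k\<le>n. c n k / m 0 * bernstein_moment n j k) = m j / m 0" if "j \<le> n" for n j
      using moment[OF that] by (simp add: sum_divide_distrib[symmetric])
  qed (use nonneg pos in auto)
  then obtain M where M: "real_distribution M" "AE t in M. t \<in> {0..1}" "\<And>j. (\<integral>t. t ^ j \<partial>M) = m j / m 0"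
    by blast
  interpret real_distribution M by fact
  let ?M = "density M (\<lambda>_. ennreal (m 0))"
  have "finite_measure ?M"
    using emeasure_space_1
    by (intro finite_measureI) (simp add: emeasure_density nn_integral_cmult space_density)
  moreover have "(\<integral>t. t ^ j \<partial>?M) = m j" for j
    using M(3)[of j] pos by (simp add: integral_density field_simps)
  moreover have "AE t in ?M. t \<in> {0..1}"
    using M(2) by (simp add: AE_density)
  ultimately show ?thesis by (intro exI[of _ ?M]) simp
qed

section \<open>Determinacy of measures on [0, 1] by their moments\<close>

lemma borel_measurable_if_sets_borel:
  "f \<in> borel_measurable borel \<Longrightarrow> sets M = sets borel \<Longrightarrow> f \<in> borel_measurable M"
  by (simp cong: measurable_cong_sets)

text \<open>
  Signed measures are handled as finite lists of pairs of a density and a positive measure.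
\<close>

definition signed_integral :: "((real \<Rightarrow> real) \<times> real measure) list \<Rightarrow> (real \<Rightarrow> real) \<Rightarrow> real" where
  "signed_integral xs g = (\<Sum>(w, M)\<leftarrow>xs. \<integral>t. g t * w t \<partial>M)"

lemma integrable_bounded_mult:
  fixes g w :: "real \<Rightarrow> real"
  assumes "integrable M w" "g \<in> borel_measurable M" "AE t in M. \<bar>g t\<bar> \<le> C"
  shows "integrable M (\<lambda>t. g t * w t)"
proof (rule Bochner_Integration.integrable_bound)
  show "integrable M (\<lambda>t. C * w t)" using assms by simp
  show "AE t in M. norm (g t * w t) \<le> norm (C * w t)"
    using assms(3) by eventually_elim (auto simp: abs_mult intro!: mult_right_mono)
qed (use assms in measurable)

lemma signed_integral_dominated:
  assumes xs: "\<And>w M. (w, M) \<in> set xs \<Longrightarrow> integrable M w \<and> sets M = sets borel"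
    and g: "\<And>n. g n \<in> borel_measurable borel" "h \<in> borel_measurable borel"
    and bound: "\<And>n t. \<bar>g n t\<bar> \<le> C"
    and lim: "\<And>w M. (w, M) \<in> set xs \<Longrightarrow> AE t in M. (\<lambda>n. g n t) \<longlonglongrightarrow> h t"
  shows "(\<lambda>n. signed_integral xs (g n)) \<longlonglongrightarrow> signed_integral xs h"
  using xs lim unfolding signed_integral_def
proof (induction xs)
  case (Cons a xs)
  obtain w M where a: "a = (w, M)" by force
  have w: "integrable M w" and [simp]: "sets M = sets borel" using Cons.prems(1)[of w M] by (auto simp: a)
  have meas: "u \<in> borel_measurable M" if "u \<in> borel_measurable borel" for u :: "real \<Rightarrow> real"
    using that by (rule borel_measurable_if_sets_borel) simp
  have "(\<lambda>n. \<integral>t. g n t * w t \<partial>M) \<longlonglongrightarrow> (\<integral>t. h t * w t \<partial>M)"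
  proof (rule integral_dominated_convergence[where w = "\<lambda>t. C * \<bar>w t\<bar>"])
    show "AE t in M. (\<lambda>n. g n t * w t) \<longlonglongrightarrow> h t * w t"
      using Cons.prems(2)[of w M] unfolding a by (auto elim!: eventually_mono intro: tendsto_intros)
    show "integrable M (\<lambda>t. C * \<bar>w t\<bar>)" using w by simp
    show "AE t in M. norm (g n t * w t) \<le> C * \<bar>w t\<bar>" for n
      using bound by (auto simp: abs_mult intro!: mult_right_mono)
  qed (use w meas[OF g(1)] meas[OF g(2)] in measurable)
  moreover have "(\<lambda>n. \<Sum>(w, M)\<leftarrow>xs. \<integral>t. g n t * w t \<partial>M) \<longlonglongrightarrow> (\<Sum>(w, M)\<leftarrow>xs. \<integral>t. h t * w t \<partial>M)"
  proof (rule Cons.IH)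
    show "integrable M w \<and> sets M = sets borel" if "(w, M) \<in> set xs" for w M
      using Cons.prems(1)[of w M] that by simp
    show "AE t in M. (\<lambda>n. g n t) \<longlonglongrightarrow> h t" if "(w, M) \<in> set xs" for w M
      using Cons.prems(2)[of w M] that by simp
  qed
  ultimately show ?case by (auto simp: a intro: tendsto_add)
qed simp

text \<open>The vanishing extends from polynomials to continuous functions by Weierstrass, to
  half-lines by piecewise linear approximation, and to Borel sets by the pi-lambda theorem. It is
  the device that turns identities between the forms of T^n, valid for every n, into identities
  between spectral measures.\<close>

lemma signed_integral_zero_if_moments_zero:
  assumes xs: "\<And>w M. (w, M) \<in> set xs \<Longrightarrow> integrable M w \<and> sets M = sets borel \<and> (AE t in M. t \<in> {0..1})"
    and moments: "\<And>n. signed_integral xs (\<lambda>t. t ^ n) = 0"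
    and S: "S \<in> sets borel"
  shows "signed_integral xs (indicator S) = 0"
proof -
  have xs': "\<And>w M. (w, M) \<in> set xs \<Longrightarrow> integrable M w \<and> sets M = sets borel" using xs by blast
  define clamp where "clamp t = max 0 (min 1 t)" for t :: real
  have clamp_meas [measurable]: "clamp \<in> borel_measurable borel" unfolding clamp_def by measurable
  have clamp01: "clamp t \<in> {0..1}" for t by (auto simp: clamp_def)
  have cong: "signed_integral ys f = signed_integral ys g"
    if "\<And>w M. (w, M) \<in> set ys \<Longrightarrow> sets M = sets borel \<and> integrable M w \<and> (AE t in M. f t = g t)"
      and [measurable]: "f \<in> borel_measurable borel" "g \<in> borel_measurable borel" for ys f g
    unfolding signed_integral_def
  proof (intro arg_cong[where f=sum_list] map_cong refl, clarsimp)
    fix w M assume "(w, M) \<in> set ys"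
    note * = that(1)[OF this]
    then have [measurable_cong]: "sets M = sets borel" and [measurable]: "w \<in> borel_measurable M" by auto
    have "AE t in M. f t = g t" using * by blast
    then show "(\<integral>t. f t * w t \<partial>M) = (\<integral>t. g t * w t \<partial>M)"
      by (intro integral_cong_AE) (auto elim!: eventually_mono)
  qed
  have clamp_AE: "AE t in M. clamp t = t" if "(w, M) \<in> set xs" for w M
  proof -
    have "AE t in M. t \<in> {0..1}" using xs[OF that] by blast
    then show ?thesis by eventually_elim (simp add: clamp_def)
  qed
  have poly: "signed_integral xs (\<lambda>t. \<Sum>i\<le>n. a i * clamp t ^ i) = 0" for n and a :: "nat \<Rightarrow> real"
  proof -
    have clamp_int: "integrable M (\<lambda>t. clamp t ^ i * w t)" if "(w, M) \<in> set xs" for w M i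
    proof (rule integrable_bounded_mult[where C=1])
      show "(\<lambda>t. clamp t ^ i) \<in> borel_measurable M"
        by (rule borel_measurable_if_sets_borel) (use xs'[OF that] in auto)
      show "AE t in M. \<bar>clamp t ^ i\<bar> \<le> 1" using clamp01 by (simp add: power_le_one)
    qed (use xs'[OF that] in blast)
    have lin: "(\<integral>t. (\<Sum>i\<le>n. a i * clamp t ^ i) * w t \<partial>M) = (\<Sum>i\<le>n. a i * (\<integral>t. clamp t ^ i * w t \<partial>M))"
      if "(w, M) \<in> set xs" for w M
      by (simp add: sum_distrib_right mult.assoc clamp_int[OF that])
    have "signed_integral xs (\<lambda>t. \<Sum>i\<le>n. a i * clamp t ^ i)
        = (\<Sum>(w, M)\<leftarrow>xs. \<Sum>i\<le>n. a i * (\<integral>t. clamp t ^ i * w t \<partial>M))"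
      unfolding signed_integral_def
      by (intro arg_cong[where f=sum_list] map_cong refl) (auto simp: lin)
    also have "\<dots> = (\<Sum>i\<le>n. a i * signed_integral xs (\<lambda>t. clamp t ^ i))"
      unfolding signed_integral_def
      by (induction xs) (auto simp: sum.distrib distrib_left)
    also have "\<dots> = (\<Sum>i\<le>n. a i * signed_integral xs (\<lambda>t. t ^ i))"
    proof (intro sum.cong refl arg_cong2[where f="(*)"] cong)
      fix i w M assume "(w, M) \<in> set xs"
      then show "sets M = sets borel \<and> integrable M w \<and> (AE t in M. clamp t ^ i = t ^ i)"
        using xs'[of w M] clamp_AE[of w M] by (auto elim!: eventually_mono)
    qed auto
    finally show ?thesis using moments by simp
  qed
  have cont: "signed_integral xs (\<lambda>t. h (clamp t)) = 0" if h: "continuous_on UNIV h" for h :: "real \<Rightarrow> real"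
  proof -
    have hm [measurable]: "h \<in> borel_measurable borel" using h by (rule borel_measurable_continuous_onI)
    have "\<exists>a n. \<forall>x\<in>{0..1}. \<bar>h x - (\<Sum>i\<le>n::nat. a i * x ^ i)\<bar> < 1 / Suc k" for k
    proof -
      obtain g where "real_polynomial_function g" "\<And>x. x \<in> {0..1} \<Longrightarrow> \<bar>h x - g x\<bar> < 1 / Suc k"
        using Stone_Weierstrass_real_polynomial_function[of "{0..1}" h "1 / Suc k"]
          continuous_on_subset[OF h] by auto
      then show ?thesis by (metis real_polynomial_function_iff_sum)
    qed
    then obtain a n where approx: "\<And>k x. x \<in> {0..1} \<Longrightarrow> \<bar>h x - (\<Sum>i\<le>n k::nat. a k i * x ^ i)\<bar> < 1 / Suc k"
      by metis
    define p where "p k x = (\<Sum>i\<le>n k. a k i * x ^ i)" for k x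
    have p: "\<bar>h x - p k x\<bar> < 1 / Suc k" if "x \<in> {0..1}" for k x using approx[OF that] by (simp add: p_def)
    have pm [measurable]: "p k \<in> borel_measurable borel" for k unfolding p_def by measurable
    have "bounded (h ` {0..1})"
      by (intro compact_imp_bounded compact_continuous_image continuous_on_subset[OF h]) auto
    then have "\<exists>B. \<forall>x\<in>{0..1}. \<bar>h x\<bar> \<le> B" by (simp add: bounded_iff)
    then obtain B where B: "\<And>x. x \<in> {0..1} \<Longrightarrow> \<bar>h x\<bar> \<le> B" by blast
    have "(\<lambda>k. signed_integral xs (\<lambda>t. p k (clamp t))) \<longlonglongrightarrow> signed_integral xs (\<lambda>t. h (clamp t))"
    proof (rule signed_integral_dominated[OF xs', where C = "B + 1"])
      show "\<bar>p k (clamp t)\<bar> \<le> B + 1" for k t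
      proof -
        have "1 / real (Suc k) \<le> 1" by simp
        then show ?thesis using p[OF clamp01, where k=k and t1=t] B[OF clamp01, of t] by linarith
      qed
      have "(\<lambda>k. p k x) \<longlonglongrightarrow> h x" if "x \<in> {0..1}" for x
      proof (rule LIM_zero_cancel, rule Lim_null_comparison)
        show "\<forall>\<^sub>F k in sequentially. norm (p k x - h x) \<le> 1 / Suc k"
          using p[OF that] by (intro always_eventually allI) (simp only: real_norm_def abs_minus_commute less_imp_le)
        show "(\<lambda>k. 1 / real (Suc k)) \<longlonglongrightarrow> 0" by (rule LIMSEQ_Suc[OF lim_1_over_n])
      qed
      then show "AE t in M. (\<lambda>k. p k (clamp t)) \<longlonglongrightarrow> h (clamp t)" for M using clamp01 by auto
    qed (auto simp: measurable_compose[OF clamp_meas])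
    moreover have "signed_integral xs (\<lambda>t. p k (clamp t)) = 0" for k unfolding p_def by (rule poly)
    ultimately have "(\<lambda>k::nat. 0) \<longlonglongrightarrow> signed_integral xs (\<lambda>t. h (clamp t))" by (simp only:)
    then show ?thesis using LIMSEQ_unique[OF _ tendsto_const] by blast
  qed
  have ind_clamp: "signed_integral xs (\<lambda>t. f (clamp t)) = signed_integral xs f"
    if "f \<in> borel_measurable borel" for f
  proof (rule cong)
    fix w M assume "(w, M) \<in> set xs"
    then show "sets M = sets borel \<and> integrable M w \<and> (AE t in M. f (clamp t) = f t)"
      using xs'[of w M] clamp_AE[of w M] by (auto elim!: eventually_mono)
  qed (use that in \<open>auto intro: measurable_compose[OF clamp_meas]\<close>)
  have half_line: "signed_integral xs (indicator {..a}) = 0" for a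
  proof -
    \<comment> \<open>Ramps equal to 1 on \<open>{..a}\<close> that fall with slope -n to the right
      of \<open>a\<close>; they are continuous, bounded by 1 and tend pointwise to the
      indicator.\<close>
    define h where "h n t = max 0 (min 1 (1 - real n * (t - a)))" for n t
    have [measurable]: "h n \<in> borel_measurable borel" for n unfolding h_def by measurable
    have "(\<lambda>n. signed_integral xs (h n)) \<longlonglongrightarrow> signed_integral xs (indicator {..a})"
    proof (rule signed_integral_dominated[OF xs', where C=1])
      have "(\<lambda>n. h n t) \<longlonglongrightarrow> indicator {..a} t" for t
      proof (cases "t \<le> a")
        case True
        then have "h n t = 1" for n using mult_nonneg_nonpos[of "real n" "t - a"] by (simp add: h_def)
        then show ?thesis using True by simp
      next
        case False
        obtain N where N: "1 / (t - a) < real N" using reals_Archimedean2 by blast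
        have "h n t = 0" if "N \<le> n" for n
        proof -
          have "1 / (t - a) < real n" using N that by simp
          then have "1 < real n * (t - a)" using False by (simp add: field_simps)
          then show ?thesis by (simp add: h_def)
        qed
        then show ?thesis using False
          by (intro tendsto_eventually) (auto simp: eventually_sequentially)
      qed
      then show "AE t in M. (\<lambda>n. h n t) \<longlonglongrightarrow> indicator {..a} t" for M by simp
    qed (auto simp: h_def)
    moreover have "signed_integral xs (h n) = 0" for n
      using cont[of "h n"] ind_clamp[of "h n"]
      by (simp add: h_def[abs_def] continuous_intros)
    ultimately have "(\<lambda>k::nat. 0) \<longlonglongrightarrow> signed_integral xs (indicator {..a})" by (simp only:)
    then show ?thesis using LIMSEQ_unique[OF _ tendsto_const] by blast
  qed
  have whole: "signed_integral xs (\<lambda>_. 1) = 0" using moments[of 0] by simp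
  have sigma: "S \<in> sigma_sets UNIV (range (\<lambda>a. {..a}))"
    using S by (simp add: borel_eq_atMost)
  have "Int_stable (range (\<lambda>a::real. {..a}))"
    by (auto simp: Int_stable_def min_def intro: rev_image_eqI)
  moreover have "range (\<lambda>a::real. {..a}) \<subseteq> Pow UNIV" by simp
  ultimately show ?thesis using sigma
  proof (induction S rule: sigma_sets_induct_disjoint)
    case (basic A)
    then show ?case using half_line by auto
  next
    case empty
    show ?case by (simp add: signed_integral_def comp_def case_prod_unfold)
  next
    case (compl A)
    then have A: "A \<in> sets borel" by (simp add: borel_eq_atMost)
    have "signed_integral ys (indicator (UNIV - A)) = signed_integral ys (\<lambda>_. 1) - signed_integral ys (indicator A)"
      if "\<And>w M. (w, M) \<in> set ys \<Longrightarrow> integrable M w \<and> sets M = sets borel" for ys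
      using that
    proof (induction ys)
      case (Cons a ys)
      obtain w M where a: "a = (w, M)" by force
      then have *: "integrable M w" "sets M = sets borel" using Cons.prems by auto
      then have "integrable M (\<lambda>t. indicator A t * w t)"
        using A by (intro integrable_bounded_mult[where C=1]) (auto simp: indicator_def intro: borel_measurable_if_sets_borel[OF borel_measurable_indicator])
      then have "(\<integral>t. indicator (UNIV - A) t * w t \<partial>M) = (\<integral>t. w t \<partial>M) - (\<integral>t. indicator A t * w t \<partial>M)"
        using * Bochner_Integration.integral_diff[of M w "\<lambda>t. indicator A t * w t"]
        by (simp add: indicator_diff left_diff_distrib)
      moreover have "signed_integral ys (indicator (UNIV - A))
          = signed_integral ys (\<lambda>_. 1) - signed_integral ys (indicator A)"
        by (rule Cons.IH, rule Cons.prems, rule list.set_intros(2))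
      ultimately show ?case by (simp add: signed_integral_def a)
    qed (simp add: signed_integral_def)
    from this[OF xs'] show ?case using compl whole by simp
  next
    case (union F)
    then have F: "F i \<in> sets borel" for i by (auto simp: borel_eq_atMost)
    have "(\<lambda>n. signed_integral xs (\<lambda>t. \<Sum>i<n. indicator (F i) t)) \<longlonglongrightarrow> signed_integral xs (indicator (\<Union>i. F i))"
    proof (rule signed_integral_dominated[OF xs', where C=1])
      have sums: "(\<lambda>n. \<Sum>i<n. indicator (F i) t :: real) \<longlonglongrightarrow> indicator (\<Union>i. F i) t" for t
        using indicator_sums[of F t] union(1) unfolding sums_def disjoint_family_on_def by blast
      then show "AE t in M. (\<lambda>n. \<Sum>i<n. indicator (F i) t) \<longlonglongrightarrow> (indicator (\<Union>i. F i) t::real)" for M by simp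
      show "\<bar>\<Sum>i<n. indicator (F i) t :: real\<bar> \<le> 1" for n t
      proof -
        have "(\<Sum>i<n. indicator (F i) t :: real) = indicator (\<Union>i<n. F i) t"
          using union(1) by (subst indicator_UN_disjoint) (auto simp: disjoint_family_on_def)
        then show ?thesis by (simp add: indicator_def)
      qed
    qed (use F in \<open>auto intro!: borel_measurable_sum\<close>)
    moreover have "signed_integral xs (\<lambda>t. \<Sum>i<n. indicator (F i) t) = 0" for n
    proof -
      have "signed_integral ys (\<lambda>t. \<Sum>i<n. indicator (F i) t) = (\<Sum>i<n. signed_integral ys (indicator (F i)))"
        if "\<And>w M. (w, M) \<in> set ys \<Longrightarrow> integrable M w \<and> sets M = sets borel" for ys
        using that
      proof (induction ys)
        case (Cons a ys)
        obtain w M where a: "a = (w, M)" by force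
        then have *: "integrable M w" "sets M = sets borel" using Cons.prems by auto
        then have "integrable M (\<lambda>t. indicator (F i) t * w t)" for i
          using F by (intro integrable_bounded_mult[where C=1]) (auto simp: indicator_def intro: borel_measurable_if_sets_borel[OF borel_measurable_indicator])
        then have "(\<integral>t. (\<Sum>i<n. indicator (F i) t) * w t \<partial>M) = (\<Sum>i<n. \<integral>t. indicator (F i) t * w t \<partial>M)"
          unfolding sum_distrib_right by (intro Bochner_Integration.integral_sum)
        moreover have "signed_integral ys (\<lambda>t. \<Sum>i<n. indicator (F i) t) = (\<Sum>i<n. signed_integral ys (indicator (F i)))"
          by (rule Cons.IH, rule Cons.prems, rule list.set_intros(2))
        ultimately show ?case by (simp add: signed_integral_def a sum.distrib)
      qed (simp add: signed_integral_def)
      from this[OF xs'] show ?thesis using union by simp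
    qed
    ultimately have "(\<lambda>k::nat. 0) \<longlonglongrightarrow> signed_integral xs (indicator (\<Union>i. F i))" by (simp only:)
    then show ?case using LIMSEQ_unique[OF _ tendsto_const] by blast
  qed
qed

section \<open>The spectral theorem for positive contractions\<close>

text \<open>On unit vectors the bound reads a + b, so by homogeneity f is bounded with constant a +
  b. The hypothesis has the form that polarization delivers: a form evaluated at x + y and x - y is
  bounded by squares of norms.\<close>

lemma riesz_if_quadratic_bound:
  fixes f :: "'a::{real_inner, complete_space} \<Rightarrow> real"
  assumes add: "\<And>x y. f (x + y) = f x + f y" and scale: "\<And>c x. f (c *\<^sub>R x) = c * f x"
    and bound: "\<And>x. \<bar>f x\<bar> \<le> a + b * (norm x)\<^sup>2"
  shows "\<exists>!z. \<forall>y. z \<bullet> y = f y"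
proof -
  have "\<bar>f x\<bar> \<le> (a + b) * norm x" for x
  proof (cases "x = 0")
    case True
    then show ?thesis using scale[of 0 x] by simp
  next
    case False
    have "f x = norm x * f (x /\<^sub>R norm x)" using scale[of "norm x" "x /\<^sub>R norm x"] False by simp
    moreover have "\<bar>f (x /\<^sub>R norm x)\<bar> \<le> a + b" using bound[of "x /\<^sub>R norm x"] False by simp
    ultimately show ?thesis by (simp add: abs_mult mult.commute mult_left_mono)
  qed
  then obtain u where "\<And>w. f w = w \<bullet> u"
    using riesz_on_closed_subspace[of UNIV f "a + b"] add scale by auto
  then have "\<forall>y. u \<bullet> y = f y" by (simp add: inner_commute)
  moreover have "z = u" if "\<forall>y. z \<bullet> y = f y" for z
    using that \<open>\<forall>y. u \<bullet> y = f y\<close> vector_eq_rdot[of z u] by simp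
  ultimately show ?thesis by blast
qed

section \<open>Scalar measures of a projection-valued measure\<close>

context
  fixes E :: "real set \<Rightarrow> 'a::real_inner \<Rightarrow> 'a"
  assumes E: "projection_valued_measure E"
begin

lemma pvm_bounded_linear: "S \<in> sets borel \<Longrightarrow> bounded_linear (E S)"
  and pvm_symmetric: "S \<in> sets borel \<Longrightarrow> E S x \<bullet> y = x \<bullet> E S y"
  and pvm_UNIV: "E UNIV x = x"
  and pvm_mult: "S \<in> sets borel \<Longrightarrow> T \<in> sets borel \<Longrightarrow> E S (E T x) = E (S \<inter> T) x"
  and pvm_sums: "range F \<subseteq> sets borel \<Longrightarrow> disjoint_family F \<Longrightarrow> (\<lambda>i. E (F i) x) sums E (\<Union>i::nat. F i) x"
  using E unfolding projection_valued_measure_def by blast+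

lemma pvm_inner_self: "S \<in> sets borel \<Longrightarrow> E S x \<bullet> x = (norm (E S x))\<^sup>2"
  using pvm_mult[of S S x] pvm_symmetric[of S "E S x" x] by (simp add: power2_norm_eq_inner inner_commute)

lemma space_pvm_measure [simp]: "space (pvm_measure E x) = UNIV"
  and sets_pvm_measure [simp, measurable_cong]: "sets (pvm_measure E x) = sets borel"
proof -
  have "sigma_algebra UNIV (sets borel)" using sets.sigma_algebra_axioms[of borel] by simp
  then show "space (pvm_measure E x) = UNIV" "sets (pvm_measure E x) = sets borel"
    unfolding pvm_measure_def
    using sets.sigma_sets_eq[of "borel :: real measure"] by (simp_all add: space_measure_of sets_measure_of)
qed

lemma emeasure_pvm_measure:
  assumes S: "S \<in> sets borel"
  shows "emeasure (pvm_measure E x) S = ennreal (E S x \<bullet> x)"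
  unfolding pvm_measure_def
proof (rule emeasure_measure_of_sigma)
  show "sigma_algebra UNIV (sets borel :: real set set)" using sets.sigma_algebra_axioms[of borel] by simp
  have nonneg: "0 \<le> E S x \<bullet> x" if "S \<in> sets borel" for S using pvm_inner_self[OF that] by simp
  \<comment> \<open>The value at the empty set follows from countable additivity: a constant series
    converges only if its terms are 0.\<close>
  have "(\<lambda>i::nat. E {} x) sums E (\<Union>i::nat. {}) x"
    by (rule pvm_sums) (auto simp: disjoint_family_on_def)
  then have "(\<lambda>i::nat. E {} x) \<longlonglongrightarrow> 0" by (intro summable_LIMSEQ_zero) (auto simp: sums_iff)
  then have "E {} x = 0" by (simp add: LIMSEQ_const_iff)
  then show "positive (sets borel) (\<lambda>S. ennreal (E S x \<bullet> x))" by (simp add: positive_def)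
  show "countably_additive (sets borel) (\<lambda>S. ennreal (E S x \<bullet> x))"
  proof (rule countably_additiveI)
    fix F :: "nat \<Rightarrow> real set"
    assume F: "range F \<subseteq> sets borel" "disjoint_family F"
    have "(\<lambda>i. E (F i) x \<bullet> x) sums (E (\<Union>i. F i) x \<bullet> x)"
      using bounded_linear.sums[OF bounded_linear_inner_left pvm_sums[OF F]] .
    then show "(\<Sum>i. ennreal (E (F i) x \<bullet> x)) = ennreal (E (\<Union>i. F i) x \<bullet> x)"
      using F by (intro suminf_ennreal_eq) (auto intro!: nonneg)
  qed
qed (rule S)

lemma finite_measure_pvm: "finite_measure (pvm_measure E x)"
  by (rule finite_measureI) (simp add: emeasure_pvm_measure)

lemma measure_pvm_measure: "S \<in> sets borel \<Longrightarrow> measure (pvm_measure E x) S = E S x \<bullet> x"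
  using pvm_inner_self[of S x] by (simp add: measure_def emeasure_pvm_measure)

end

section \<open>Polynomials of a positive contraction and its moment measures\<close>

definition poly_op :: "('a::real_vector \<Rightarrow> 'a) \<Rightarrow> real poly \<Rightarrow> 'a \<Rightarrow> 'a" where
  "poly_op T p = fold_coeffs (\<lambda>a f x. a *\<^sub>R x + T (f x)) p (\<lambda>_. 0)"

text \<open>The bounds 0 \<le> T \<le> 1 are stated for quadratic forms, as the positivity of
  Bernstein polynomials of T uses them.\<close>

locale positive_contraction =
  fixes T :: "'a::{real_inner, complete_space} \<Rightarrow> 'a"
  assumes lin: "bounded_linear T"
    and sym: "T x \<bullet> y = x \<bullet> T y"
    and pos: "0 \<le> T x \<bullet> x"
    and contraction: "T x \<bullet> x \<le> x \<bullet> x"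
begin

lemma T_simps [simp]:
  "T 0 = 0" "T (- x) = - T x" "T (x + y) = T x + T y" "T (x - y) = T x - T y" "T (c *\<^sub>R x) = c *\<^sub>R T x"
  using lin by (simp_all add: linear_simps)

lemma poly_op_0 [simp]: "poly_op T 0 x = 0"
  by (simp add: poly_op_def)

lemma poly_op_pCons [simp]: "poly_op T (pCons a p) x = a *\<^sub>R x + T (poly_op T p x)"
  by (cases "p = 0"; cases "a = 0")
    (simp_all add: poly_op_def)

lemma poly_op_add [simp]: "poly_op T (p + q) x = poly_op T p x + poly_op T q x"
  by (induction p q rule: poly_induct2) (simp_all add: algebra_simps)

lemma poly_op_smult [simp]: "poly_op T (smult c p) x = c *\<^sub>R poly_op T p x"
  by (induction p) (simp_all add: algebra_simps)

lemma poly_op_mult [simp]: "poly_op T (p * q) x = poly_op T p (poly_op T q x)"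
  by (induction p) simp_all

lemma poly_op_sum: "poly_op T (sum f J) x = (\<Sum>j\<in>J. poly_op T (f j) x)"
  by (induction J rule: infinite_finite_induct) simp_all

lemma poly_op_linear [simp]:
  "poly_op T p (x + y) = poly_op T p x + poly_op T p y" "poly_op T p (c *\<^sub>R x) = c *\<^sub>R poly_op T p x"
  by (induction p) (simp_all add: algebra_simps)

lemma poly_op_T: "poly_op T p (T x) = T (poly_op T p x)"
  by (induction p) simp_all

lemma poly_op_sym: "poly_op T p x \<bullet> y = x \<bullet> poly_op T p y"
  by (induction p arbitrary: x y) (simp_all add: inner_simps sym poly_op_T[symmetric])

lemma poly_op_X_power: "poly_op T ([:0, 1:] ^ n) x = (T ^^ n) x"
  by (induction n) (simp_all add: one_pCons)

lemma funpow_linear [simp]: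
  "(T ^^ n) (x + y) = (T ^^ n) x + (T ^^ n) y" "(T ^^ n) (c *\<^sub>R x) = c *\<^sub>R (T ^^ n) x"
  "(T ^^ n) (x - y) = (T ^^ n) x - (T ^^ n) y" "(T ^^ n) 0 = 0"
  by (induction n) simp_all

lemma funpow_sym: "(T ^^ n) x \<bullet> y = x \<bullet> (T ^^ n) y"
  using poly_op_sym[of "[:0, 1:] ^ n"] by (simp add: poly_op_X_power)

text \<open>A square factor is absorbed into the vector, so positivity need only be checked for the
  remaining factor.\<close>

lemma poly_op_square: "poly_op T (p * p * q) x \<bullet> x = poly_op T q (poly_op T p x) \<bullet> poly_op T p x"
proof -
  have "p * p * q = p * (q * p)" by (simp only: mult_ac)
  then show ?thesis by (simp only: poly_op_mult poly_op_sym[of p _ x])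
qed

text \<open>Even powers are absorbed into the vector, leaving the forms of 1, T, 1 - T and T(1 - T).
  All but the last are nonnegative by assumption, and the last is a sum of absorbed squares times T
  and 1 - T.\<close>

lemma bernstein_form_nonneg: "0 \<le> poly_op T ([:0, 1:] ^ k * [:1, -1:] ^ m) x \<bullet> x"
proof -
  have split: "\<exists>u e. p ^ n = u * u * (if e then p else 1)" for p :: "real poly" and n
  proof (cases "even n")
    case True
    then obtain j where "n = j + j" by (metis evenE mult_2)
    then show ?thesis by (intro exI[of _ "p ^ j"] exI[of _ False]) (simp add: power_add)
  next
    case False
    then obtain j where "n = j + j + 1" by (metis oddE mult_2)
    then show ?thesis by (intro exI[of _ "p ^ j"] exI[of _ True]) (simp add: power_add)
  qed
  obtain u e where u: "[:0, 1::real:] ^ k = u * u * (if e then [:0, 1:] else 1)" using split by blast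
  obtain v f where v: "[:1, -1::real:] ^ m = v * v * (if f then [:1, -1:] else 1)" using split by blast
  define w where "w = (if e then [:0, 1:] else 1) * (if f then [:1, -1::real:] else 1)"
  have "[:0, 1:] ^ k * [:1, -1::real:] ^ m = (u * v) * (u * v) * w"
    unfolding u v w_def by (simp only: mult_ac)
  moreover have "0 \<le> poly_op T w y \<bullet> y" for y
  proof -
    have 1: "0 \<le> poly_op T [:0, 1:] y \<bullet> y" for y using pos[of y] by simp
    have 2: "0 \<le> poly_op T [:1, -1:] y \<bullet> y" for y
      using contraction[of y] by (simp add: inner_simps)
    have 3: "0 \<le> poly_op T ([:0, 1:] * [:1, -1:]) y \<bullet> y" for y
    proof -
      let ?X = "[:0, 1:] :: real poly" and ?Y = "[:1, -1:] :: real poly"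
      \<comment> \<open>As X + Y = 1, the product XY equals XY(X + Y).\<close>
      have eq: "?X * ?Y = ?Y * ?Y * ?X + ?X * ?X * ?Y" by simp
      show ?thesis
        by (subst eq) (simp only: poly_op_add inner_add_left poly_op_square add_nonneg_nonneg 1 2)
    qed
    show ?thesis unfolding w_def using 1 2 3
      by (cases e; cases f) (simp_all only: if_True if_False mult_1 mult_1_right, simp add: one_pCons)
  qed
  ultimately show ?thesis by (simp only: poly_op_square)
qed

text \<open>The exact moment condition is the binomial theorem: since binom(n,k) binom(k,j) =
  binom(n,j) binom(n-j,k-j), the weighted Bernstein sum equals X^j (X + (1 - X))^(n-j) = X^j as a
  polynomial, hence also at T.\<close>

lemma spectral_moments:
  "\<exists>M. finite_measure M \<and> sets M = sets borel \<and> (AE t in M. t \<in> {0..1}) \<and> (\<forall>j. (\<integral>t. t ^ j \<partial>M) = (T ^^ j) x \<bullet> x)"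
proof (rule hausdorff_moment)
  let ?X = "[:0, 1:] :: real poly" and ?Y = "[:1, -1:] :: real poly"
  show "0 \<le> real (n choose k) * (poly_op T (?X ^ k * ?Y ^ (n - k)) x \<bullet> x)" for n k
    using bernstein_form_nonneg by simp
  fix n j :: nat assume j: "j \<le> n"
  have "(\<Sum>k\<le>n. smult (real (n choose k) * bernstein_moment n j k) (?X ^ k * ?Y ^ (n - k)))
      = (\<Sum>k=j..n. smult (real ((n - j) choose (k - j))) (?X ^ k * ?Y ^ (n - k)))"
  proof (rule sum.mono_neutral_cong_right)
    show "smult (real (n choose k) * bernstein_moment n j k) (?X ^ k * ?Y ^ (n - k))
        = smult (real ((n - j) choose (k - j))) (?X ^ k * ?Y ^ (n - k))" if "k \<in> {j..n}" for k
    proof -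
      have "real (n choose k) * real (k choose j) = real (n choose j) * real ((n - j) choose (k - j))"
        using choose_mult[of j k n] that by (simp flip: of_nat_mult)
      moreover have "0 < real (n choose j)" using j by simp
      ultimately have "real (n choose k) * bernstein_moment n j k = real ((n - j) choose (k - j))"
        unfolding bernstein_moment_def by (simp add: field_simps)
      then show ?thesis by (simp only:)
    qed
  qed (auto simp: bernstein_moment_def)
  also have "\<dots> = (\<Sum>i\<le>n - j. smult (real ((n - j) choose i)) (?X ^ (i + j) * ?Y ^ (n - j - i)))"
    using j by (intro sum.reindex_bij_witness[of _ "\<lambda>i. i + j" "\<lambda>k. k - j"]) auto
  also have "\<dots> = ?X ^ j * (\<Sum>i\<le>n - j. of_nat ((n - j) choose i) * ?X ^ i * ?Y ^ (n - j - i))"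
    unfolding sum_distrib_left
    by (intro sum.cong refl) (simp only: power_add of_nat_mult_conv_smult mult_smult_left mult_smult_right mult_ac diff_diff_left)
  also have "\<dots> = ?X ^ j * (?X + ?Y) ^ (n - j)" by (simp only: binomial_ring)
  also have "?X + ?Y = 1" by (simp add: one_pCons)
  finally have id: "(\<Sum>k\<le>n. smult (real (n choose k) * bernstein_moment n j k) (?X ^ k * ?Y ^ (n - k))) = ?X ^ j"
    by simp
  have "(T ^^ j) x \<bullet> x = poly_op T (?X ^ j) x \<bullet> x" by (simp only: poly_op_X_power)
  also have "\<dots> = (\<Sum>k\<le>n. (real (n choose k) * bernstein_moment n j k) * (poly_op T (?X ^ k * ?Y ^ (n - k)) x \<bullet> x))"
    unfolding id[symmetric] poly_op_sum poly_op_smult inner_sum_left inner_scaleR_left ..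
  finally show "(\<Sum>k\<le>n. real (n choose k) * (poly_op T (?X ^ k * ?Y ^ (n - k)) x \<bullet> x) * bernstein_moment n j k)
      = (T ^^ j) x \<bullet> x"
    by (simp only: mult_ac)
qed

end

section \<open>Spectral projections of a positive contraction\<close>

context positive_contraction
begin

text \<open>The choice is immaterial, as moments determine a measure on [0, 1].\<close>

definition \<mu> :: "'a \<Rightarrow> real measure" where
  "\<mu> x = (SOME M. finite_measure M \<and> sets M = sets borel \<and> (AE t in M. t \<in> {0..1}) \<and>
     (\<forall>j. (\<integral>t. t ^ j \<partial>M) = (T ^^ j) x \<bullet> x))"

lemma finite_measure_\<mu>: "finite_measure (\<mu> x)"
  and sets_\<mu> [simp, measurable_cong]: "sets (\<mu> x) = sets borel"
  and AE_\<mu>: "AE t in \<mu> x. t \<in> {0..1}"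
  and moment_\<mu>: "(\<integral>t. t ^ j \<partial>\<mu> x) = (T ^^ j) x \<bullet> x"
  using someI_ex[OF spectral_moments[of x]] unfolding \<mu>_def[symmetric] by blast+

lemma space_\<mu> [simp]: "space (\<mu> x) = UNIV"
  using sets_eq_imp_space_eq[OF sets_\<mu>] by simp

lemma integrable_power_\<mu>: "integrable (\<mu> x) (\<lambda>t. t ^ k)"
proof -
  interpret finite_measure "\<mu> x" by (rule finite_measure_\<mu>)
  show ?thesis
  proof (rule integrable_const_bound[of _ 1])
    show "AE t in \<mu> x. norm (t ^ k) \<le> 1"
      using AE_\<mu>[of x] by eventually_elim (simp add: power_le_one)
  qed simp
qed

lemma integrable_indicator_power_\<mu>: "S \<in> sets borel \<Longrightarrow> integrable (\<mu> x) (\<lambda>t. indicator S t * t ^ k)"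
  by (rule integrable_bounded_mult[OF integrable_power_\<mu>, where C=1]) (auto simp: indicator_def)

lemma measure_\<mu>: "S \<in> sets borel \<Longrightarrow> (\<integral>t. indicator S t \<partial>\<mu> x) = measure (\<mu> x) S"
  by simp

lemma measure_\<mu>_le: "measure (\<mu> x) S \<le> (norm x)\<^sup>2"
proof -
  interpret finite_measure "\<mu> x" by (rule finite_measure_\<mu>)
  show ?thesis using bounded_measure[of S] moment_\<mu>[of x 0] by (simp add: power2_norm_eq_inner)
qed

text \<open>A pair (c, v) in the list stands for c times the quadratic form at v. The algebraic
  properties of \<open>\<beta>\<close> below are instances: the identity is checked for every power
  of T, where it is bilinear algebra, and read off for every Borel set.\<close>

lemma \<mu>_combination_zero:
  assumes "\<And>n. (\<Sum>(c, v)\<leftarrow>cs. c * ((T ^^ n) v \<bullet> v)) = 0" and S: "S \<in> sets borel"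
  shows "(\<Sum>(c, v)\<leftarrow>cs. c * measure (\<mu> v) S) = 0"
proof -
  let ?xs = "map (\<lambda>(c, v). (\<lambda>_::real. c, \<mu> v)) cs"
  have eq: "signed_integral (map (\<lambda>(c, v). (\<lambda>_. c, \<mu> v)) ds) g = (\<Sum>(c, v)\<leftarrow>ds. c * (\<integral>t. g t \<partial>\<mu> v))" for ds g
    unfolding signed_integral_def by (induction ds) (auto simp: mult.commute)
  have "signed_integral ?xs (indicator S) = 0"
  proof (rule signed_integral_zero_if_moments_zero)
    show "integrable M w \<and> sets M = sets borel \<and> (AE t in M. t \<in> {0..1})" if xs: "(w, M) \<in> set ?xs" for w M
    proof -
      obtain c v where w: "w = (\<lambda>_. c)" and M: "M = \<mu> v" using xs by auto
      show ?thesis unfolding w M using AE_\<mu>[of v] finite_measure.integrable_const[OF finite_measure_\<mu>] by simp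
    qed
    show "signed_integral ?xs (\<lambda>t. t ^ n) = 0" for n
      using assms(1)[of n] by (simp only: eq moment_\<mu>)
  qed (rule S)
  then show ?thesis using S by (simp only: eq measure_\<mu>)
qed

text \<open>The form that is to become <E(S) x, y>. It is assembled by polarization because the
  moment problem yields measures for quadratic forms only.\<close>

definition \<beta> :: "real set \<Rightarrow> 'a \<Rightarrow> 'a \<Rightarrow> real" where
  "\<beta> S x y = (measure (\<mu> (x + y)) S - measure (\<mu> (x - y)) S) / 4"

lemma quad_polarize:
  "(T ^^ n) (x + y) \<bullet> (x + y) = (T ^^ n) x \<bullet> x + 2 * ((T ^^ n) x \<bullet> y) + (T ^^ n) y \<bullet> y"
  "(T ^^ n) (x - y) \<bullet> (x - y) = (T ^^ n) x \<bullet> x - 2 * ((T ^^ n) x \<bullet> y) + (T ^^ n) y \<bullet> y"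
  using funpow_sym[of n x y] by (simp_all add: inner_simps inner_commute)

lemma \<beta>_add: "S \<in> sets borel \<Longrightarrow> \<beta> S x (y + z) = \<beta> S x y + \<beta> S x z"
  using \<mu>_combination_zero[of "[(1, x + (y + z)), (-1, x - (y + z)), (-1, x + y), (1, x - y), (-1, x + z), (1, x - z)]" S]
  by (simp only: list.map sum_list.Cons sum_list.Nil prod.case quad_polarize)
    (simp add: \<beta>_def inner_simps field_simps)

lemma \<beta>_scale: "S \<in> sets borel \<Longrightarrow> \<beta> S x (c *\<^sub>R y) = c * \<beta> S x y"
  using \<mu>_combination_zero[of "[(1, x + c *\<^sub>R y), (-1, x - c *\<^sub>R y), (-c, x + y), (c, x - y)]" S]
  by (simp only: list.map sum_list.Cons sum_list.Nil prod.case quad_polarize)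
    (simp add: \<beta>_def inner_simps field_simps)

lemma \<beta>_sym: "S \<in> sets borel \<Longrightarrow> \<beta> S x y = \<beta> S y x"
  using \<mu>_combination_zero[of "[(1, x + y), (-1, x - y), (-1, y + x), (1, y - x)]" S] funpow_sym[of _ x y]
  by (simp only: list.map sum_list.Cons sum_list.Nil prod.case quad_polarize)
    (simp add: \<beta>_def inner_simps inner_commute field_simps)

lemma \<beta>_self: "S \<in> sets borel \<Longrightarrow> \<beta> S x x = measure (\<mu> x) S"
  using \<mu>_combination_zero[of "[(1, x + x), (-1, x - x), (-4, x)]" S]
  by (simp only: list.map sum_list.Cons sum_list.Nil prod.case quad_polarize)
    (simp add: \<beta>_def inner_simps field_simps)

lemma \<beta>_bound: "\<bar>\<beta> S x y\<bar> \<le> (norm x)\<^sup>2 / 2 + (1 / 2) * (norm y)\<^sup>2"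
proof -
  have "(norm (x + y))\<^sup>2 + (norm (x - y))\<^sup>2 = 2 * (norm x)\<^sup>2 + 2 * (norm y)\<^sup>2"
    by (simp add: power2_norm_eq_inner inner_simps inner_commute)
  moreover have "\<bar>(a - b) / 4\<bar> \<le> (A + B) / 4" if "0 \<le> a" "a \<le> A" "0 \<le> b" "b \<le> B" for a b A B :: real
    using that by (simp add: abs_if field_simps)
  then have "\<bar>\<beta> S x y\<bar> \<le> ((norm (x + y))\<^sup>2 + (norm (x - y))\<^sup>2) / 4"
    unfolding \<beta>_def by (simp only: measure_nonneg measure_\<mu>_le)
  ultimately show ?thesis by simp
qed

definition spectral_proj :: "real set \<Rightarrow> 'a \<Rightarrow> 'a" where
  "spectral_proj S x = (THE z. \<forall>y. z \<bullet> y = \<beta> S x y)"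

lemma spectral_proj_inner:
  assumes "S \<in> sets borel"
  shows "spectral_proj S x \<bullet> y = \<beta> S x y"
proof -
  have "\<exists>!z. \<forall>y. z \<bullet> y = \<beta> S x y"
    by (rule riesz_if_quadratic_bound[OF \<beta>_add[OF assms] \<beta>_scale[OF assms] \<beta>_bound])
  then show ?thesis unfolding spectral_proj_def by (rule theI'[THEN spec])
qed

lemma spectral_proj_sym: "S \<in> sets borel \<Longrightarrow> spectral_proj S x \<bullet> y = x \<bullet> spectral_proj S y"
  using \<beta>_sym by (simp add: spectral_proj_inner inner_commute[of x])

lemma spectral_proj_linear:
  assumes S: "S \<in> sets borel"
  shows "linear (spectral_proj S)"
proof (rule linearI)
  show "spectral_proj S (x + y) = spectral_proj S x + spectral_proj S y" for x y
    using S by (subst vector_eq_rdot[symmetric]) (simp add: spectral_proj_sym[of S] inner_simps)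
  show "spectral_proj S (c *\<^sub>R x) = c *\<^sub>R spectral_proj S x" for c x
    using S by (subst vector_eq_rdot[symmetric]) (simp add: spectral_proj_sym[of S] inner_simps)
qed

text \<open>The polarised measure of (T^k x, y) and t^k times that of (x, y) have the same moments,
  multiples of <T^(n+k) x, y>, so they agree on S.\<close>

lemma spectral_proj_power:
  assumes S: "S \<in> sets borel"
  shows "4 * (spectral_proj S ((T ^^ k) x) \<bullet> y)
    = (\<integral>t. indicator S t * t ^ k \<partial>\<mu> (x + y)) - (\<integral>t. indicator S t * t ^ k \<partial>\<mu> (x - y))"
proof -
  let ?xs = "[(\<lambda>_::real. 1::real, \<mu> ((T ^^ k) x + y)), (\<lambda>_::real. -1::real, \<mu> ((T ^^ k) x - y)),
    (\<lambda>t::real. - (t ^ k), \<mu> (x + y)), (\<lambda>t::real. t ^ k, \<mu> (x - y))]"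
  have "signed_integral ?xs (indicator S) = 0"
  proof (rule signed_integral_zero_if_moments_zero)
    show "integrable M w \<and> sets M = sets borel \<and> (AE t in M. t \<in> {0..1})" if "(w, M) \<in> set ?xs" for w M
      using that AE_\<mu> finite_measure.integrable_const[OF finite_measure_\<mu>] integrable_power_\<mu> by auto
    show "signed_integral ?xs (\<lambda>t. t ^ n) = 0" for n
      by (simp add: signed_integral_def power_add[symmetric] moment_\<mu> del: funpow_linear,
          simp only: quad_polarize, simp add: funpow_add)
  qed (rule S)
  then show ?thesis using S
    by (simp add: signed_integral_def spectral_proj_inner \<beta>_def)
qed

text \<open>Write P for \<open>spectral_proj\<close>, fix S and y, and compare two signed measures:
  that of (x, P(S) y) and the indicator of S times that of (x, y). Their moments agree because <T^n
  x, P(S) y> = <P(S) T^n x, y>; evaluating both on R gives the product rule.\<close>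

lemma spectral_proj_mult:
  assumes S: "S \<in> sets borel" and R: "R \<in> sets borel"
  shows "spectral_proj S (spectral_proj R x) = spectral_proj (S \<inter> R) x"
proof -
  have SR: "S \<inter> R \<in> sets borel" using S R by blast
  have "spectral_proj R x \<bullet> spectral_proj S y = spectral_proj (S \<inter> R) x \<bullet> y" for y
  proof -
    let ?xs = "[(\<lambda>_::real. 1::real, \<mu> (x + spectral_proj S y)), (\<lambda>_::real. -1::real, \<mu> (x - spectral_proj S y)),
      (\<lambda>t. - indicator S t :: real, \<mu> (x + y)), (indicator S :: real \<Rightarrow> real, \<mu> (x - y))]"
    have ind: "integrable (\<mu> v) (indicator S :: real \<Rightarrow> real)" for v
      using integrable_indicator_power_\<mu>[OF S, of v 0] by simp
    have "signed_integral ?xs (indicator R) = 0"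
    proof (rule signed_integral_zero_if_moments_zero)
      show "integrable M w \<and> sets M = sets borel \<and> (AE t in M. t \<in> {0..1})" if "(w, M) \<in> set ?xs" for w M
        using that AE_\<mu> finite_measure.integrable_const[OF finite_measure_\<mu>] ind by auto
      have "signed_integral ?xs (\<lambda>t. t ^ n) = 4 * ((T ^^ n) x \<bullet> spectral_proj S y) - 4 * (spectral_proj S ((T ^^ n) x) \<bullet> y)" for n
      proof -
        have "(T ^^ n) (x + v) \<bullet> (x + v) - (T ^^ n) (x - v) \<bullet> (x - v) = 4 * ((T ^^ n) x \<bullet> v)" for v
          by (simp only: quad_polarize)
        from this[of "spectral_proj S y"] show ?thesis
          unfolding spectral_proj_power[OF S]
          by (simp add: signed_integral_def moment_\<mu> mult.commute del: funpow_linear)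
      qed
      then show "signed_integral ?xs (\<lambda>t. t ^ n) = 0" for n by (simp add: spectral_proj_sym[OF S])
    qed (rule R)
    then have "4 * \<beta> R x (spectral_proj S y) = 4 * \<beta> (S \<inter> R) x y"
      using S R SR by (simp add: signed_integral_def \<beta>_def indicator_inter_arith[symmetric] Int_commute)
    then show ?thesis using R SR by (simp add: spectral_proj_inner)
  qed
  then show ?thesis using spectral_proj_sym[OF S] by (metis vector_eq_rdot)
qed

lemma spectral_proj_inner_nested:
  assumes "S \<in> sets borel" "R \<in> sets borel" "S \<subseteq> R"
  shows "spectral_proj S x \<bullet> spectral_proj R x = measure (\<mu> x) S"
proof -
  have "spectral_proj S x \<bullet> spectral_proj R x = spectral_proj R (spectral_proj S x) \<bullet> x"
    using assms by (simp only: spectral_proj_sym)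
  also have "\<dots> = spectral_proj (R \<inter> S) x \<bullet> x" using assms by (simp only: spectral_proj_mult)
  also have "R \<inter> S = S" using assms(3) by blast
  finally show ?thesis using assms(1) by (simp only: spectral_proj_inner \<beta>_self)
qed

lemma spectral_proj_norm: "S \<in> sets borel \<Longrightarrow> (norm (spectral_proj S x))\<^sup>2 = measure (\<mu> x) S"
  using spectral_proj_inner_nested[of S S x] by (simp add: power2_norm_eq_inner)

text \<open>The squared distance between the projections for a finite and for the full union is the
  \<open>\<mu> x\<close>-measure of the remainder, so additivity of the scalar measure gives
  convergence in norm.\<close>

lemma spectral_proj_sums:
  assumes F: "range F \<subseteq> sets borel" "disjoint_family F"
  shows "(\<lambda>i. spectral_proj (F i) x) sums spectral_proj (\<Union>i::nat. F i) x"
proof -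
  have Fi: "F i \<in> sets borel" for i using F by blast
  have U: "(\<Union>i. F i) \<in> sets borel" "(\<Union>i<n. F i) \<in> sets borel" for n using Fi by auto
  interpret finite_measure "\<mu> v" for v by (rule finite_measure_\<mu>)
  have part: "(\<Sum>i<n. spectral_proj (F i) x) = spectral_proj (\<Union>i<n. F i) x" for n
  proof -
    have "(\<Sum>i<n. measure (\<mu> v) (F i)) = measure (\<mu> v) (\<Union>i<n. F i)" for v
      using Fi F(2) by (subst finite_measure_finite_Union) (auto simp: disjoint_family_on_def)
    then have "(\<Sum>i<n. \<beta> (F i) x y) = \<beta> (\<Union>i<n. F i) x y" for y
      by (simp add: \<beta>_def sum_divide_distrib[symmetric] sum_subtractf)
    then have "(\<Sum>i<n. spectral_proj (F i) x) \<bullet> y = spectral_proj (\<Union>i<n. F i) x \<bullet> y" for y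
      using Fi U by (simp add: inner_sum_left spectral_proj_inner)
    then show ?thesis by (metis vector_eq_rdot)
  qed
  have diff: "(norm (spectral_proj (\<Union>i<n. F i) x - spectral_proj (\<Union>i. F i) x))\<^sup>2
      = measure (\<mu> x) (\<Union>i. F i) - measure (\<mu> x) (\<Union>i<n. F i)" for n
  proof -
    have "spectral_proj (\<Union>i<n. F i) x \<bullet> spectral_proj (\<Union>i. F i) x = measure (\<mu> x) (\<Union>i<n. F i)"
      using U by (intro spectral_proj_inner_nested) auto
    moreover have "spectral_proj S x \<bullet> spectral_proj S x = measure (\<mu> x) S" if "S \<in> sets borel" for S
      using spectral_proj_norm[OF that] by (simp add: power2_norm_eq_inner)
    ultimately show ?thesis using U
      by (simp add: power2_norm_eq_inner inner_simps inner_commute)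
  qed
  have "(\<lambda>n. \<Sum>i<n. measure (\<mu> x) (F i)) \<longlonglongrightarrow> measure (\<mu> x) (\<Union>i. F i)"
    using finite_measure_UNION[of F x] F unfolding sums_def by simp
  then have "(\<lambda>n. measure (\<mu> x) (\<Union>i<n. F i)) \<longlonglongrightarrow> measure (\<mu> x) (\<Union>i. F i)"
    using Fi F(2) by (subst (asm) finite_measure_finite_Union[symmetric]) (auto simp: disjoint_family_on_def)
  then have "(\<lambda>n. measure (\<mu> x) (\<Union>i. F i) - measure (\<mu> x) (\<Union>i<n. F i)) \<longlonglongrightarrow> 0"
    by (auto intro!: tendsto_eq_intros)
  then have "(\<lambda>n. (norm (spectral_proj (\<Union>i<n. F i) x - spectral_proj (\<Union>i. F i) x))\<^sup>2) \<longlonglongrightarrow> 0"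
    unfolding diff .
  from tendsto_real_sqrt[OF this]
  have "(\<lambda>n. norm (spectral_proj (\<Union>i<n. F i) x - spectral_proj (\<Union>i. F i) x)) \<longlonglongrightarrow> 0" by simp
  then show ?thesis unfolding sums_def part by (rule LIM_zero_cancel[OF tendsto_norm_zero_cancel])
qed

theorem projection_valued_measure_spectral_proj: "projection_valued_measure spectral_proj"
  unfolding projection_valued_measure_def
proof (intro conjI ballI allI impI)
  fix S assume S: "S \<in> sets (borel :: real measure)"
  show "bounded_linear (spectral_proj S)"
  proof (rule bounded_linear_intro[of _ 1])
    show "norm (spectral_proj S x) \<le> norm x * 1" for x
      using spectral_proj_norm[OF S, of x] measure_\<mu>_le[of x S] by (simp add: power2_le_imp_le)
  qed (simp_all add: linear_add[OF spectral_proj_linear[OF S]] linear_scale[OF spectral_proj_linear[OF S]])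
next
  have "\<beta> UNIV x y = x \<bullet> y" for x y
    using moment_\<mu>[of "x + y" 0] moment_\<mu>[of "x - y" 0] by (simp add: \<beta>_def inner_simps inner_commute)
  then show "spectral_proj UNIV x = x" for x
    by (subst vector_eq_rdot[symmetric]) (simp add: spectral_proj_inner)
qed (auto simp: spectral_proj_sym spectral_proj_mult spectral_proj_sums)

lemma pvm_measure_spectral_proj: "pvm_measure spectral_proj x = \<mu> x"
proof (rule measure_eqI)
  fix S assume "S \<in> sets (pvm_measure spectral_proj x)"
  then have S: "S \<in> sets borel" by (simp add: projection_valued_measure_spectral_proj)
  interpret finite_measure "\<mu> x" by (rule finite_measure_\<mu>)
  show "emeasure (pvm_measure spectral_proj x) S = emeasure (\<mu> x) S"
    using S by (simp add: emeasure_pvm_measure[OF projection_valued_measure_spectral_proj]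
        spectral_proj_inner \<beta>_self emeasure_eq_measure)
qed (simp add: projection_valued_measure_spectral_proj)

end

text \<open>Only the first moment is recorded: a symmetric operator is determined by its quadratic
  form, and that suffices to recognise the resolvent as an integral against the measure.\<close>

theorem spectral_theorem_positive_contraction:
  assumes "positive_contraction T"
  shows "\<exists>E. projection_valued_measure E \<and> (\<forall>x. AE t in pvm_measure E x. t \<in> {0..1}) \<and>
    (\<forall>x. (\<integral>t. t \<partial>pvm_measure E x) = T x \<bullet> x)"
proof -
  interpret positive_contraction T by fact
  show ?thesis
    by (intro exI[of _ spectral_proj] conjI allI projection_valued_measure_spectral_proj)
      (use AE_\<mu> moment_\<mu>[where j=1, unfolded power_one_right] in \<open>simp_all only: pvm_measure_spectral_proj power_one_right funpow.simps One_nat_def comp_id\<close>)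
qed

section \<open>Functional calculus of a projection-valued measure\<close>

definition bounded_borel :: "(real \<Rightarrow> real) \<Rightarrow> bool" where
  "bounded_borel g \<longleftrightarrow> g \<in> borel_measurable borel \<and> (\<exists>C. \<forall>t. \<bar>g t\<bar> \<le> C)"

lemma bounded_borelI: "g \<in> borel_measurable borel \<Longrightarrow> (\<And>t. \<bar>g t\<bar> \<le> C) \<Longrightarrow> bounded_borel g"
  unfolding bounded_borel_def by blast

lemma bounded_borel_measurable [measurable_dest]: "bounded_borel g \<Longrightarrow> g \<in> borel_measurable borel"
  unfolding bounded_borel_def by blast

lemma bounded_borel_indicator [intro]: "S \<in> sets borel \<Longrightarrow> bounded_borel (indicator S)"
  by (rule bounded_borelI[where C=1]) (auto simp: indicator_def)

lemma bounded_borel_add [intro]: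
  assumes "bounded_borel f" "bounded_borel g"
  shows "bounded_borel (\<lambda>t. f t + g t)"
proof -
  obtain C K where *: "\<And>t. \<bar>f t\<bar> \<le> C" "\<And>t. \<bar>g t\<bar> \<le> K" using assms unfolding bounded_borel_def by blast
  show ?thesis
  proof (rule bounded_borelI)
    show "\<bar>f t + g t\<bar> \<le> C + K" for t using *(1)[of t] *(2)[of t] by linarith
  qed (use assms in measurable)
qed

lemma bounded_borel_mult [intro]:
  assumes "bounded_borel f" "bounded_borel g"
  shows "bounded_borel (\<lambda>t. f t * g t)"
proof -
  obtain C K where *: "\<And>t. \<bar>f t\<bar> \<le> C" "\<And>t. \<bar>g t\<bar> \<le> K" using assms unfolding bounded_borel_def by blast
  show ?thesis
  proof (rule bounded_borelI)
    have "0 \<le> C" using *(1)[of 0] by linarith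
    then show "\<bar>f t * g t\<bar> \<le> C * K" for t
      unfolding abs_mult using *(1)[of t] *(2)[of t] by (intro mult_mono) auto
  qed (use assms in measurable)
qed

lemma bounded_borel_const [intro, simp]: "bounded_borel (\<lambda>_. c)"
  by (rule bounded_borelI[where C="\<bar>c\<bar>"]) auto

lemma bounded_borel_scale [intro]: "bounded_borel f \<Longrightarrow> bounded_borel (\<lambda>t. c * f t)"
  by (intro bounded_borel_mult bounded_borel_const)

lemma bounded_borel_diff [intro]: "bounded_borel f \<Longrightarrow> bounded_borel g \<Longrightarrow> bounded_borel (\<lambda>t. f t - g t)"
  using bounded_borel_add[of f "\<lambda>t. -1 * g t"] bounded_borel_scale[of g "-1"] by simp

lemma bounded_borel_power [intro]: "bounded_borel f \<Longrightarrow> bounded_borel (\<lambda>t. f t ^ n)"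
  by (induction n) auto

text \<open>A monotone class principle with bounded pointwise limits. It carries identities of the
  bounded calculus from indicators, where they are properties of the projections, to all bounded
  Borel functions.\<close>

lemma bounded_borel_induct [consumes 1, case_names indicator add scale lim]:
  assumes g: "bounded_borel g"
    and ind: "\<And>S. S \<in> sets borel \<Longrightarrow> P (indicator S)"
    and add: "\<And>f g. bounded_borel f \<Longrightarrow> bounded_borel g \<Longrightarrow> P f \<Longrightarrow> P g \<Longrightarrow> P (\<lambda>t. f t + g t)"
    and scale: "\<And>c f. bounded_borel f \<Longrightarrow> P f \<Longrightarrow> P (\<lambda>t. c * f t)"
    and lim: "\<And>G g C. (\<And>n. bounded_borel (G n)) \<Longrightarrow> bounded_borel g \<Longrightarrow> (\<And>n t. \<bar>G n t\<bar> \<le> C) \<Longrightarrow>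
      (\<And>t. (\<lambda>n. G n t) \<longlonglongrightarrow> g t) \<Longrightarrow> (\<And>n::nat. P (G n)) \<Longrightarrow> P g"
  shows "P g"
proof -
  \<comment> \<open>Boundedness is kept as a premise inside the induction because each case has to
    bound its constituents anew: nonnegative summands and approximants are dominated by the function
    they build.\<close>
  have nonneg: "(\<exists>C. \<forall>t. \<bar>u t\<bar> \<le> C) \<longrightarrow> P u" if u_meas: "u \<in> borel_measurable borel" and "\<And>t. 0 \<le> u t" for u
    using that
  proof (induction u rule: borel_measurable_induct_real)
    case (set A)
    then show ?case using ind by simp
  next
    case (mult u c)
    show ?case
    proof (cases "c = 0")
      case True
      then show ?thesis using scale[OF bounded_borel_indicator ind, of "{}" 0] by simp
    next
      case False
      show ?thesis
      proof
        assume "\<exists>C. \<forall>t. \<bar>c * u t\<bar> \<le> C"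
        then obtain C where "\<And>t. \<bar>c * u t\<bar> \<le> C" by blast
        then have "\<bar>u t\<bar> \<le> C / c" for t using False mult(1) by (simp add: abs_mult field_simps)
        then show "P (\<lambda>t. c * u t)" using mult scale by (meson bounded_borelI)
      qed
    qed
  next
    case (add u v)
    show ?case
    proof
      assume "\<exists>C. \<forall>t. \<bar>v t + u t\<bar> \<le> C"
      then obtain C where C: "\<And>t. \<bar>v t + u t\<bar> \<le> C" by blast
      have bd: "\<bar>u t\<bar> \<le> C" "\<bar>v t\<bar> \<le> C" for t
        using add(2)[of t] add(4)[of t] order_trans[OF abs_ge_self C[of t]] by simp_all
      have "P u" "P v" using add bd by blast+
      then show "P (\<lambda>t. v t + u t)"
        using assms(3)[of v u] bounded_borelI[OF add(1) bd(1)] bounded_borelI[OF add(3) bd(2)] by blast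
    qed
  next
    case (seq U)
    show ?case
    proof
      assume "\<exists>C. \<forall>t. \<bar>u t\<bar> \<le> C"
      then obtain C where C: "\<And>t. \<bar>u t\<bar> \<le> C" by blast
      have "U n t \<le> u t" for n t
        using incseq_le[of "\<lambda>n. U n t" "u t" n] seq(3,4) by (auto simp: incseq_def le_fun_def)
      then have UC: "\<bar>U n t\<bar> \<le> C" for n t using seq(2)[of n t] C[of t] by (simp add: abs_le_iff) (meson order_trans)
      show "P u"
      proof (rule lim)
        show "bounded_borel (U n)" for n using seq(1) UC by (rule bounded_borelI)
        show "bounded_borel u" using u_meas C by (rule bounded_borelI)
        show "(\<lambda>n. U n t) \<longlonglongrightarrow> u t" for t using seq(4) by simp
        show "P (U n)" for n using seq(5) UC by blast
      qed (rule UC)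
    qed
  qed
  obtain C where C: "\<And>t. \<bar>g t\<bar> \<le> C" using g unfolding bounded_borel_def by blast
  have [measurable]: "g \<in> borel_measurable borel" using g by measurable
  have b: "bounded_borel (\<lambda>t. max 0 (g t))" "bounded_borel (\<lambda>t. max 0 (- g t))"
  proof -
    have "\<bar>max 0 (g t)\<bar> \<le> C" "\<bar>max 0 (- g t)\<bar> \<le> C" for t using C[of t] by (simp_all add: max_def abs_le_iff)
    then show "bounded_borel (\<lambda>t. max 0 (g t))" "bounded_borel (\<lambda>t. max 0 (- g t))"
      by (auto intro!: bounded_borelI[where C=C])
  qed
  then have "P (\<lambda>t. max 0 (g t))" "P (\<lambda>t. max 0 (- g t))"
    using nonneg[of "\<lambda>t. max 0 (g t)"] nonneg[of "\<lambda>t. max 0 (- g t)"] by (auto simp: bounded_borel_def)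
  then have "P (\<lambda>t. max 0 (g t) + (-1) * max 0 (- g t))" using b by (intro add scale bounded_borel_scale)
  moreover have "(\<lambda>t. max 0 (g t) + (-1) * max 0 (- g t)) = g" by (auto simp: max_def)
  ultimately show ?thesis by simp
qed

lemma integrable_bounded_borel:
  assumes fin: "finite_measure M" and M: "sets M = sets borel" and g: "bounded_borel g"
  shows "integrable M g"
proof -
  interpret finite_measure M by (rule fin)
  obtain C where "\<And>t. \<bar>g t\<bar> \<le> C" using g unfolding bounded_borel_def by blast
  then show ?thesis using g M
    by (intro integrable_const_bound[of _ C]) (auto intro: borel_measurable_if_sets_borel bounded_borel_measurable)
qed

lemma bounded_convergence:
  assumes fin: "finite_measure M" and M: "sets M = sets borel"
    and G: "\<And>n. G n \<in> borel_measurable borel" "g \<in> borel_measurable borel"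
    and C: "\<And>n t. \<bar>G n t\<bar> \<le> C" and lim: "\<And>t. (\<lambda>n. G n t) \<longlonglongrightarrow> (g t :: real)"
  shows "(\<lambda>n. integral\<^sup>L M (G n)) \<longlonglongrightarrow> integral\<^sup>L M g"
  by (rule integral_dominated_convergence[where w = "\<lambda>_. C"])
    (use assms borel_measurable_if_sets_borel finite_measure.integrable_const[OF fin] in auto)

section \<open>Integrals of bounded functions against a projection-valued measure\<close>

context
  fixes E :: "real set \<Rightarrow> 'a::{real_inner, complete_space} \<Rightarrow> 'a"
  assumes E: "projection_valued_measure E"
begin

interpretation finite_measure "pvm_measure E x" for x
  by (rule finite_measure_pvm[OF E])

lemmas [simp, measurable_cong] = sets_pvm_measure[OF E]
lemmas [simp] = space_pvm_measure[OF E]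

lemma pvm_integrable: "bounded_borel g \<Longrightarrow> integrable (pvm_measure E x) g"
  by (rule integrable_bounded_borel[OF finite_measure_pvm[OF E] sets_pvm_measure[OF E]])

lemma pvm_measure_total: "measure (pvm_measure E x) UNIV = (norm x)\<^sup>2"
  by (simp add: measure_pvm_measure[OF E] pvm_UNIV[OF E] power2_norm_eq_inner)

lemma pvm_form_indicator:
  assumes S: "S \<in> sets borel"
  shows "pvm_form E (indicator S) x y = E S x \<bullet> y"
proof -
  have "linear (E S)" using pvm_bounded_linear[OF E S] by (simp add: bounded_linear.linear)
  then show ?thesis
    using S pvm_symmetric[OF E S, of x y]
    by (simp add: pvm_form_def measure_pvm_measure[OF E] linear_add linear_diff inner_simps inner_commute)
qed

lemma pvm_form_add: "bounded_borel f \<Longrightarrow> bounded_borel g \<Longrightarrow>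
    pvm_form E (\<lambda>t. f t + g t) x y = pvm_form E f x y + pvm_form E g x y"
  by (simp add: pvm_form_def pvm_integrable field_simps)

lemma pvm_form_scale: "pvm_form E (\<lambda>t. c * f t) x y = c * pvm_form E f x y"
  by (simp add: pvm_form_def right_diff_distrib)

lemma pvm_form_lim:
  assumes "\<And>n. bounded_borel (G n)" "bounded_borel g" "\<And>n t. \<bar>G n t\<bar> \<le> C" "\<And>t. (\<lambda>n. G n t) \<longlonglongrightarrow> g t"
  shows "(\<lambda>n. pvm_form E (G n) x y) \<longlonglongrightarrow> pvm_form E g x y"
  unfolding pvm_form_def
  by (intro tendsto_intros bounded_convergence[where C=C, OF finite_measure_pvm[OF E] sets_pvm_measure[OF E]]) (use assms bounded_borel_measurable in auto)

text \<open>Bilinearity is invisible in the definition, which mixes the measures at x + y and x - y.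
  It holds for indicators because \<open>E S\<close> is linear and symmetric, and it passes to
  linear combinations and bounded limits.\<close>

lemma pvm_form_bilinear:
  assumes "bounded_borel g"
  shows "pvm_form E g (x + x') y = pvm_form E g x y + pvm_form E g x' y"
    and "pvm_form E g (c *\<^sub>R x) y = c * pvm_form E g x y"
    and "pvm_form E g x y = pvm_form E g y x"
    and "pvm_form E g x x = integral\<^sup>L (pvm_measure E x) g"
proof -
  have "pvm_form E g (x + x') y = pvm_form E g x y + pvm_form E g x' y \<and>
    pvm_form E g (c *\<^sub>R x) y = c * pvm_form E g x y \<and> pvm_form E g x y = pvm_form E g y x \<and>
    pvm_form E g x x = integral\<^sup>L (pvm_measure E x) g"
    using assms
  proof (induction g rule: bounded_borel_induct)
    case (indicator S)
    have "linear (E S)" using pvm_bounded_linear[OF E indicator] by (simp add: bounded_linear.linear)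
    then show ?case
      using indicator pvm_symmetric[OF E indicator, of x y]
      by (simp add: pvm_form_indicator measure_pvm_measure[OF E] linear_add linear_scale inner_simps inner_commute)
  next
    case (lim G g C)
    note L = pvm_form_lim[OF lim(1-4)]
    have "(\<lambda>n. integral\<^sup>L (pvm_measure E x) (G n)) \<longlonglongrightarrow> integral\<^sup>L (pvm_measure E x) g"
      by (rule bounded_convergence[where C=C, OF finite_measure_pvm[OF E] sets_pvm_measure[OF E]]) (use lim bounded_borel_measurable in auto)
    moreover have "(\<lambda>n. pvm_form E (G n) x y + pvm_form E (G n) x' y) \<longlonglongrightarrow> pvm_form E g x y + pvm_form E g x' y"
      "(\<lambda>n. c * pvm_form E (G n) x y) \<longlonglongrightarrow> c * pvm_form E g x y"
      by (intro tendsto_intros L)+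
    ultimately show ?case
      using L[of "x + x'" y] L[of "c *\<^sub>R x" y] L[of x y] L[of y x] L[of x x] lim(5)
      by (auto intro: LIMSEQ_unique)
  qed (auto simp: pvm_form_add pvm_form_scale pvm_integrable algebra_simps)
  then show "pvm_form E g (x + x') y = pvm_form E g x y + pvm_form E g x' y"
    and "pvm_form E g (c *\<^sub>R x) y = c * pvm_form E g x y"
    and "pvm_form E g x y = pvm_form E g y x"
    and "pvm_form E g x x = integral\<^sup>L (pvm_measure E x) g" by blast+
qed

lemma pvm_integral_bound:
  assumes g: "bounded_borel g" and C: "\<And>t. \<bar>g t\<bar> \<le> C"
  shows "\<bar>integral\<^sup>L (pvm_measure E x) g\<bar> \<le> C * (norm x)\<^sup>2"
proof -
  have "\<bar>integral\<^sup>L (pvm_measure E x) g\<bar> \<le> (\<integral>t. \<bar>g t\<bar> \<partial>pvm_measure E x)"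
    by (rule integral_abs_bound)
  also have "\<dots> \<le> (\<integral>t. C \<partial>pvm_measure E x)"
    using pvm_integrable[OF g] C by (intro integral_mono) auto
  finally show ?thesis by (simp add: pvm_measure_total mult.commute)
qed

text \<open>The definite description in \<open>pvm_bounded\<close> is met by the Riesz theorem; the
  parallelogram identity bounds the form.\<close>

lemma pvm_bounded_inner:
  assumes g: "bounded_borel g"
  shows "pvm_bounded E g x \<bullet> y = pvm_form E g x y"
proof -
  obtain C where C: "\<And>t. \<bar>g t\<bar> \<le> C" using g unfolding bounded_borel_def by blast
  have "\<exists>!z. \<forall>y. z \<bullet> y = pvm_form E g x y"
  proof (rule riesz_if_quadratic_bound)
    show "pvm_form E g x (y + z) = pvm_form E g x y + pvm_form E g x z" for y z
      using pvm_form_bilinear(1,3)[OF g] by simp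
    show "pvm_form E g x (c *\<^sub>R y) = c * pvm_form E g x y" for c y
      using pvm_form_bilinear(2,3)[OF g] by metis
    show "\<bar>pvm_form E g x y\<bar> \<le> C * (norm x)\<^sup>2 / 2 + C / 2 * (norm y)\<^sup>2" for y
    proof -
      have "(norm (x + y))\<^sup>2 + (norm (x - y))\<^sup>2 = 2 * (norm x)\<^sup>2 + 2 * (norm y)\<^sup>2"
        by (simp add: power2_norm_eq_inner inner_simps inner_commute)
      then have "C * (norm (x + y))\<^sup>2 + C * (norm (x - y))\<^sup>2 = C * (2 * (norm x)\<^sup>2 + 2 * (norm y)\<^sup>2)"
        by (simp only: distrib_left[symmetric])
      then show ?thesis
        using pvm_integral_bound[OF g C, of "x + y"] pvm_integral_bound[OF g C, of "x - y"]
        unfolding pvm_form_def by (simp add: algebra_simps)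
    qed
  qed
  then show ?thesis unfolding pvm_bounded_def by (rule theI'[THEN spec])
qed

lemma pvm_bounded_sym: "bounded_borel g \<Longrightarrow> pvm_bounded E g x \<bullet> y = x \<bullet> pvm_bounded E g y"
  using pvm_form_bilinear(3)[of g x y] by (simp add: pvm_bounded_inner inner_commute[of x])

lemma pvm_bounded_linear_in_vector:
  assumes g: "bounded_borel g"
  shows "linear (pvm_bounded E g)"
proof (rule linearI)
  show "pvm_bounded E g (x + y) = pvm_bounded E g x + pvm_bounded E g y" for x y
    using g by (subst vector_eq_rdot[symmetric]) (simp add: pvm_bounded_sym inner_simps)
  show "pvm_bounded E g (c *\<^sub>R x) = c *\<^sub>R pvm_bounded E g x" for c x
    using g by (subst vector_eq_rdot[symmetric]) (simp add: pvm_bounded_sym inner_simps)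
qed

lemma pvm_bounded_add: "bounded_borel f \<Longrightarrow> bounded_borel g \<Longrightarrow>
    pvm_bounded E (\<lambda>t. f t + g t) x = pvm_bounded E f x + pvm_bounded E g x"
  by (subst vector_eq_rdot[symmetric]) (simp add: pvm_bounded_inner pvm_form_add inner_simps bounded_borel_add)

lemma pvm_bounded_scale: "bounded_borel f \<Longrightarrow> pvm_bounded E (\<lambda>t. c * f t) x = c *\<^sub>R pvm_bounded E f x"
  by (subst vector_eq_rdot[symmetric]) (simp add: pvm_bounded_inner pvm_form_scale bounded_borel_scale)

lemma pvm_bounded_diff: "bounded_borel f \<Longrightarrow> bounded_borel g \<Longrightarrow>
    pvm_bounded E (\<lambda>t. f t - g t) x = pvm_bounded E f x - pvm_bounded E g x"
  using pvm_bounded_add[of f "\<lambda>t. -1 * g t" x] pvm_bounded_scale[of g "-1" x] bounded_borel_scale[of g "-1"]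
  by simp

lemma pvm_bounded_indicator: "S \<in> sets borel \<Longrightarrow> pvm_bounded E (indicator S) x = E S x"
  by (subst vector_eq_rdot[symmetric]) (simp add: pvm_bounded_inner pvm_form_indicator bounded_borel_indicator)

text \<open>Multiplicativity in weak form, extended from indicators in two stages: first in g with h
  an indicator, where it starts from E(S) E(R) = E(S \<inter> R), then in h with g fixed.\<close>

lemma pvm_bounded_inner_both:
  assumes g: "bounded_borel g" and h: "bounded_borel h"
  shows "pvm_bounded E g x \<bullet> pvm_bounded E h y = pvm_form E (\<lambda>t. g t * h t) x y"
proof -
  have indicator_right: "pvm_bounded E g x \<bullet> E S y = pvm_form E (\<lambda>t. g t * indicator S t) x y"
    if S: "S \<in> sets borel" and "bounded_borel g" for S g x y
    using that(2)
  proof (induction g rule: bounded_borel_induct)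
    case (indicator R)
    then have "pvm_bounded E (indicator R) x \<bullet> E S y = E (S \<inter> R) x \<bullet> y"
      by (simp add: pvm_bounded_indicator pvm_symmetric[OF E S, symmetric] pvm_mult[OF E S])
    also have "\<dots> = pvm_form E (indicator (S \<inter> R)) x y" using S indicator by (simp add: pvm_form_indicator)
    also have "indicator (S \<inter> R) = (\<lambda>t. indicator R t * indicator S t :: real)"
      by (auto simp: indicator_def)
    finally show ?case .
  next
    case (add f g)
    then show ?case using S
      by (simp add: pvm_bounded_add inner_simps distrib_right pvm_form_add bounded_borel_mult bounded_borel_indicator)
  next
    case (scale c f)
    then show ?case using S
      by (simp add: pvm_bounded_scale mult.assoc pvm_form_scale)
  next
    case (lim G g C)
    have "(\<lambda>n. pvm_bounded E (G n) x \<bullet> E S y) \<longlonglongrightarrow> pvm_bounded E g x \<bullet> E S y"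
      using pvm_form_lim[OF lim(1-4), of x "E S y"] lim(1,2) by (simp add: pvm_bounded_inner)
    moreover have "(\<lambda>n. pvm_form E (\<lambda>t. G n t * indicator S t) x y) \<longlonglongrightarrow> pvm_form E (\<lambda>t. g t * indicator S t) x y"
    proof (rule pvm_form_lim[where C=C])
      show "\<bar>G n t * indicator S t\<bar> \<le> C" for n t
        using lim(3)[of n t] by (auto simp: indicator_def intro: order_trans[OF abs_ge_zero])
    qed (use lim S in \<open>auto intro!: tendsto_intros\<close>)
    ultimately show ?case using lim(5) by (auto intro: LIMSEQ_unique)
  qed
  show ?thesis using h
  proof (induction h rule: bounded_borel_induct)
    case (indicator S)
    then show ?case using indicator_right[OF indicator g] by (simp add: pvm_bounded_indicator)
  next
    case (add f h)
    then show ?case using g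
      by (simp add: pvm_bounded_add inner_simps distrib_left pvm_form_add bounded_borel_mult)
  next
    case (scale c f)
    then show ?case by (simp add: pvm_bounded_scale mult.left_commute pvm_form_scale)
  next
    case (lim G h C)
    obtain K where K: "\<And>t. \<bar>g t\<bar> \<le> K" using g unfolding bounded_borel_def by blast
    have "(\<lambda>n. pvm_bounded E (G n) y \<bullet> pvm_bounded E g x) \<longlonglongrightarrow> pvm_bounded E h y \<bullet> pvm_bounded E g x"
      using pvm_form_lim[OF lim(1-4), of y "pvm_bounded E g x"] lim(1,2) by (simp add: pvm_bounded_inner)
    moreover have "(\<lambda>n. pvm_form E (\<lambda>t. g t * G n t) x y) \<longlonglongrightarrow> pvm_form E (\<lambda>t. g t * h t) x y"
    proof (rule pvm_form_lim[where C="K * C"])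
      have "0 \<le> K" using K[of 0] by linarith
      then show "\<bar>g t * G n t\<bar> \<le> K * C" for n t
        unfolding abs_mult using K[of t] lim(3)[of n t] by (intro mult_mono) auto
    qed (use lim g in \<open>auto intro!: tendsto_intros\<close>)
    ultimately show ?case using lim(5) by (auto simp: inner_commute intro: LIMSEQ_unique)
  qed
qed

lemma pvm_bounded_mult:
  assumes "bounded_borel g" "bounded_borel h"
  shows "pvm_bounded E g (pvm_bounded E h x) = pvm_bounded E (\<lambda>t. g t * h t) x"
proof -
  have "pvm_bounded E g (pvm_bounded E h x) \<bullet> y = pvm_bounded E (\<lambda>t. g t * h t) x \<bullet> y" for y
  proof -
    have "pvm_bounded E g (pvm_bounded E h x) \<bullet> y = pvm_bounded E h x \<bullet> pvm_bounded E g y"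
      by (rule pvm_bounded_sym[OF assms(1)])
    also have "\<dots> = pvm_form E (\<lambda>t. h t * g t) x y" by (rule pvm_bounded_inner_both[OF assms(2,1)])
    also have "\<dots> = pvm_bounded E (\<lambda>t. g t * h t) x \<bullet> y"
      using bounded_borel_mult[OF assms] by (simp only: pvm_bounded_inner mult.commute)
    finally show ?thesis .
  qed
  then show ?thesis by (metis vector_eq_rdot)
qed

lemma pvm_bounded_inner_integral:
  assumes "bounded_borel g" "bounded_borel h"
  shows "pvm_bounded E g x \<bullet> pvm_bounded E h x = (\<integral>t. g t * h t \<partial>pvm_measure E x)"
  using assms by (simp add: pvm_bounded_inner_both pvm_form_bilinear(4) bounded_borel_mult)

lemma pvm_bounded_norm: "bounded_borel g \<Longrightarrow> (norm (pvm_bounded E g x))\<^sup>2 = (\<integral>t. (g t)\<^sup>2 \<partial>pvm_measure E x)"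
  by (simp only: power2_norm_eq_inner pvm_bounded_inner_integral) (simp only: power2_eq_square)

lemma pvm_bounded_bounded_linear:
  assumes g: "bounded_borel g"
  shows "bounded_linear (pvm_bounded E g)"
proof -
  obtain C where C: "\<And>t. \<bar>g t\<bar> \<le> C" using g unfolding bounded_borel_def by blast
  have "0 \<le> C" using C[of 0] by linarith
  have "(g t)\<^sup>2 \<le> C\<^sup>2" for t using C[of t] by (simp add: abs_le_square_iff[symmetric])
  then have "\<bar>\<integral>t. (g t)\<^sup>2 \<partial>pvm_measure E x\<bar> \<le> C\<^sup>2 * (norm x)\<^sup>2" for x
    using g by (intro pvm_integral_bound bounded_borel_power) auto
  then have "(norm (pvm_bounded E g x))\<^sup>2 \<le> (norm x * C)\<^sup>2" for x
    by (simp add: pvm_bounded_norm[OF g] power_mult_distrib mult.commute)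
  then have "norm (pvm_bounded E g x) \<le> norm x * C" for x
    using \<open>0 \<le> C\<close> by (meson power2_le_imp_le mult_nonneg_nonneg norm_ge_zero)
  with pvm_bounded_linear_in_vector[OF g] show ?thesis
    by (intro bounded_linear_intro) (auto simp: linear_add linear_scale)
qed

text \<open>By the isometry \<open>pvm_bounded_norm\<close>, convergence of the operators at x is
  convergence in L^2 of the scalar measure at x.\<close>

lemma pvm_bounded_lim:
  assumes "\<And>n. bounded_borel (G n)" "bounded_borel g" "\<And>n t. \<bar>G n t\<bar> \<le> C" "\<And>t. (\<lambda>n. G n t) \<longlonglongrightarrow> g t"
  shows "(\<lambda>n. pvm_bounded E (G n) x) \<longlonglongrightarrow> pvm_bounded E g x"
proof -
  have gC: "\<bar>g t\<bar> \<le> C" for t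
    by (rule LIMSEQ_le_const2[OF tendsto_rabs[OF assms(4)]]) (use assms(3) in blast)
  have "(\<lambda>n. \<integral>t. (G n t - g t)\<^sup>2 \<partial>pvm_measure E x) \<longlonglongrightarrow> (\<integral>t. 0 \<partial>pvm_measure E x)"
  proof (rule bounded_convergence[where C="(2 * C)\<^sup>2", OF finite_measure_pvm[OF E] sets_pvm_measure[OF E]])
    show "\<bar>(G n t - g t)\<^sup>2\<bar> \<le> (2 * C)\<^sup>2" for n t
    proof -
      have "\<bar>G n t - g t\<bar> \<le> \<bar>2 * C\<bar>" using assms(3)[of n t] gC[of t] by linarith
      then show ?thesis by (simp only: abs_le_square_iff abs_power2)
    qed
    show "(\<lambda>n. (G n t - g t)\<^sup>2) \<longlonglongrightarrow> 0" for t
      using tendsto_power[OF LIM_zero[OF assms(4)[of t]], of 2] by simp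
  qed (use assms(1,2) bounded_borel_measurable in \<open>auto intro!: borel_measurable_power borel_measurable_diff\<close>)
  then have "(\<lambda>n. (norm (pvm_bounded E (G n) x - pvm_bounded E g x))\<^sup>2) \<longlonglongrightarrow> 0"
    using assms by (simp add: pvm_bounded_diff[symmetric] pvm_bounded_norm bounded_borel_diff)
  from tendsto_real_sqrt[OF this]
  have "(\<lambda>n. norm (pvm_bounded E (G n) x - pvm_bounded E g x)) \<longlonglongrightarrow> 0" by simp
  then show ?thesis by (rule LIM_zero_cancel[OF tendsto_norm_zero_cancel])
qed

lemma pvm_bounded_cong_AE:
  assumes g: "bounded_borel g" and h: "bounded_borel h" and ae: "AE t in pvm_measure E x. g t = h t"
  shows "pvm_bounded E g x = pvm_bounded E h x"
proof -
  have "(norm (pvm_bounded E g x - pvm_bounded E h x))\<^sup>2 = (\<integral>t. (g t - h t)\<^sup>2 \<partial>pvm_measure E x)"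
    using g h by (simp add: pvm_bounded_diff[symmetric] pvm_bounded_norm bounded_borel_diff)
  also have "\<dots> = (\<integral>t. 0 \<partial>pvm_measure E x)"
    using ae g h by (intro integral_cong_AE) (auto elim: eventually_mono intro!: borel_measurable_if_sets_borel[of _ "pvm_measure E x"] borel_measurable_power borel_measurable_diff bounded_borel_measurable)
  finally show ?thesis by simp
qed

end

definition trunc :: "(real \<Rightarrow> real) \<Rightarrow> nat \<Rightarrow> real \<Rightarrow> real" where
  "trunc f n = (\<lambda>l. if \<bar>f l\<bar> \<le> real n then f l else 0)"

lemma bounded_borel_trunc: "f \<in> borel_measurable borel \<Longrightarrow> bounded_borel (trunc f n)"
  by (rule bounded_borelI[where C="real n"]) (auto simp: trunc_def)

lemma trunc_le: "\<bar>trunc f n t\<bar> \<le> \<bar>f t\<bar>"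
  by (simp add: trunc_def)

lemma trunc_LIMSEQ: "(\<lambda>n. trunc f n t) \<longlonglongrightarrow> f t"
proof (rule tendsto_eventually)
  obtain N where "\<bar>f t\<bar> \<le> real N" using real_arch_simple by blast
  then show "\<forall>\<^sub>F n in sequentially. trunc f n t = f t"
    by (intro eventually_sequentiallyI[of N]) (simp add: trunc_def)
qed

section \<open>Integrals of unbounded functions against a projection-valued measure\<close>

context
  fixes E :: "real set \<Rightarrow> 'a::{real_inner, complete_space} \<Rightarrow> 'a"
  assumes E: "projection_valued_measure E"
begin

interpretation finite_measure "pvm_measure E x" for x
  by (rule finite_measure_pvm[OF E])

lemmas [simp, measurable_cong] = sets_pvm_measure[OF E]
lemmas [simp] = space_pvm_measure[OF E]

lemma pvm_fun_eq_lim: "pvm_fun E f x = lim (\<lambda>n. pvm_bounded E (trunc f n) x)"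
  by (simp add: pvm_fun_def trunc_def)

lemma pvm_truncation_error:
  assumes f: "f \<in> borel_measurable borel" and x: "x \<in> pvm_dom E f"
  shows "(\<lambda>n. \<integral>t. (trunc f n t - f t)\<^sup>2 \<partial>pvm_measure E x) \<longlonglongrightarrow> 0"
proof -
  have "(\<lambda>n. \<integral>t. (trunc f n t - f t)\<^sup>2 \<partial>pvm_measure E x) \<longlonglongrightarrow> (\<integral>t. 0 \<partial>pvm_measure E x)"
  proof (rule integral_dominated_convergence[where w = "\<lambda>t. (f t)\<^sup>2"])
    show "AE t in pvm_measure E x. (\<lambda>n. (trunc f n t - f t)\<^sup>2) \<longlonglongrightarrow> 0"
      using tendsto_power[OF LIM_zero[OF trunc_LIMSEQ], of f _ 2] by simp
    show "AE t in pvm_measure E x. norm ((trunc f n t - f t)\<^sup>2) \<le> (f t)\<^sup>2" for n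
      by (simp add: trunc_def)
  qed (use x f bounded_borel_trunc[OF f] in \<open>auto simp: pvm_dom_def intro!: borel_measurable_if_sets_borel[of _ "pvm_measure E x"] borel_measurable_power borel_measurable_diff bounded_borel_measurable\<close>)
  then show ?thesis by simp
qed

text \<open>\<open>pvm_fun\<close> is a bare \<open>lim\<close>, so convergence has to be proved: by
  the isometry the cut-off operators are Cauchy as soon as the cut-offs converge to f in L^2 of the
  spectral measure of x.\<close>

lemma pvm_fun_LIMSEQ:
  assumes f: "f \<in> borel_measurable borel" and x: "x \<in> pvm_dom E f"
  shows "(\<lambda>n. pvm_bounded E (trunc f n) x) \<longlonglongrightarrow> pvm_fun E f x"
proof -
  note bf = bounded_borel_trunc[OF f]
  note [measurable] = f bounded_borel_measurable[OF bf]
  define a where "a n = (\<integral>t. (trunc f n t - f t)\<^sup>2 \<partial>pvm_measure E x)" for n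
  have sq: "integrable (pvm_measure E x) (\<lambda>t. (trunc f n t - f t)\<^sup>2)" for n
    by (rule Bochner_Integration.integrable_bound[of _ "\<lambda>t. (f t)\<^sup>2"])
      (use x in \<open>auto simp: pvm_dom_def trunc_def\<close>)
  have dist: "(norm (pvm_bounded E (trunc f m) x - pvm_bounded E (trunc f n) x))\<^sup>2 \<le> 2 * a m + 2 * a n" for m n
  proof -
    have "(norm (pvm_bounded E (trunc f m) x - pvm_bounded E (trunc f n) x))\<^sup>2
        = (\<integral>t. (trunc f m t - trunc f n t)\<^sup>2 \<partial>pvm_measure E x)"
      using bf by (simp add: pvm_bounded_diff[OF E, symmetric] pvm_bounded_norm[OF E] bounded_borel_diff)
    also have "\<dots> \<le> (\<integral>t. 2 * (trunc f m t - f t)\<^sup>2 + 2 * (trunc f n t - f t)\<^sup>2 \<partial>pvm_measure E x)"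
    proof (rule integral_mono)
      show "integrable (pvm_measure E x) (\<lambda>t. (trunc f m t - trunc f n t)\<^sup>2)"
        using bf by (intro pvm_integrable[OF E] bounded_borel_power bounded_borel_diff)
      show "(trunc f m t - trunc f n t)\<^sup>2 \<le> 2 * (trunc f m t - f t)\<^sup>2 + 2 * (trunc f n t - f t)\<^sup>2" for t
        using zero_le_power2[of "trunc f m t + trunc f n t - 2 * f t"]
        by (simp add: power2_eq_square algebra_simps)
    qed (use sq in simp)
    also have "\<dots> = 2 * a m + 2 * a n" using sq by (simp add: a_def)
    finally show ?thesis .
  qed
  have a0: "a \<longlonglongrightarrow> 0" unfolding a_def by (rule pvm_truncation_error[OF f x])
  have "Cauchy (\<lambda>n. pvm_bounded E (trunc f n) x)"
  proof (rule metric_CauchyI)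
    fix e :: real assume e: "0 < e"
    then have "\<forall>\<^sub>F n in sequentially. a n < e\<^sup>2 / 4" using a0 by (intro order_tendstoD) auto
    then obtain N where N: "\<And>n. N \<le> n \<Longrightarrow> a n < e\<^sup>2 / 4" by (auto simp: eventually_sequentially)
    have "dist (pvm_bounded E (trunc f m) x) (pvm_bounded E (trunc f n) x) < e" if "N \<le> m" "N \<le> n" for m n
    proof -
      have "(norm (pvm_bounded E (trunc f m) x - pvm_bounded E (trunc f n) x))\<^sup>2 < e\<^sup>2"
        using dist[of m n] N[OF that(1)] N[OF that(2)] by simp
      then show ?thesis using e by (simp add: dist_norm power_less_imp_less_base)
    qed
    then show "\<exists>N. \<forall>m\<ge>N. \<forall>n\<ge>N. dist (pvm_bounded E (trunc f m) x) (pvm_bounded E (trunc f n) x) < e"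
      by blast
  qed
  then show ?thesis
    unfolding pvm_fun_eq_lim using Cauchy_convergent_iff convergent_LIMSEQ_iff by blast
qed

lemma pvm_fun_bounded:
  assumes g: "bounded_borel g"
  shows "pvm_fun E g x = pvm_bounded E g x"
proof -
  obtain C where C: "\<And>t. \<bar>g t\<bar> \<le> C" using g unfolding bounded_borel_def by blast
  obtain N where N: "C \<le> real N" using real_arch_simple by blast
  have "trunc g n = g" if "N \<le> n" for n
    using C N that by (auto simp: trunc_def fun_eq_iff) (meson of_nat_le_iff order_trans)
  then have "(\<lambda>n. pvm_bounded E (trunc g n) x) \<longlonglongrightarrow> pvm_bounded E g x"
    by (intro tendsto_eventually eventually_sequentiallyI[of N]) simp
  then show ?thesis unfolding pvm_fun_eq_lim by (rule limI)
qed

lemma pvm_dom_bounded: "bounded_borel g \<Longrightarrow> x \<in> pvm_dom E g"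
  using pvm_integrable[OF E bounded_borel_power[of g 2]] by (simp add: pvm_dom_def)

lemma pvm_dom_iff:
  assumes f: "f \<in> borel_measurable borel"
  shows "x \<in> pvm_dom E f \<longleftrightarrow> (\<integral>\<^sup>+t. ennreal ((f t)\<^sup>2) \<partial>pvm_measure E x) < \<infinity>"
  using f borel_measurable_if_sets_borel[of "\<lambda>t. (f t)\<^sup>2" "pvm_measure E x"]
  by (simp add: pvm_dom_def integrable_iff_bounded)

lemma pvm_fun_inner:
  assumes f: "f \<in> borel_measurable borel" and x: "x \<in> pvm_dom E f" and g: "bounded_borel g"
  shows "integrable (pvm_measure E x) (\<lambda>t. f t * g t)"
    and "pvm_fun E f x \<bullet> pvm_bounded E g x = (\<integral>t. f t * g t \<partial>pvm_measure E x)"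
proof -
  note bf = bounded_borel_trunc[OF f]
  note [measurable] = f bounded_borel_measurable[OF bf] bounded_borel_measurable[OF g]
  obtain C where C: "\<And>t. \<bar>g t\<bar> \<le> C" using g unfolding bounded_borel_def by blast
  have "integrable (pvm_measure E x) (\<lambda>t. (f t)\<^sup>2)" using x by (simp add: pvm_dom_def)
  then have "integrable (pvm_measure E x) (\<lambda>t. 1 + (f t)\<^sup>2)" by simp
  then have f1: "integrable (pvm_measure E x) f"
  proof (rule Bochner_Integration.integrable_bound)
    have "\<bar>f t\<bar> \<le> 1 + (f t)\<^sup>2" for t
      using zero_le_power2[of "\<bar>f t\<bar> - 1"] by (simp add: power2_diff)
    then show "AE t in pvm_measure E x. norm (f t) \<le> norm (1 + (f t)\<^sup>2)" by auto
  qed measurable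
  show int: "integrable (pvm_measure E x) (\<lambda>t. f t * g t)"
    using integrable_bounded_mult[OF f1, of g C] C by (simp add: mult.commute)
  have "(\<lambda>n. \<integral>t. trunc f n t * g t \<partial>pvm_measure E x) \<longlonglongrightarrow> (\<integral>t. f t * g t \<partial>pvm_measure E x)"
  proof (rule integral_dominated_convergence[where w = "\<lambda>t. \<bar>f t * g t\<bar>"])
    show "AE t in pvm_measure E x. (\<lambda>n. trunc f n t * g t) \<longlonglongrightarrow> f t * g t"
      by (intro AE_I2 tendsto_intros trunc_LIMSEQ)
    show "AE t in pvm_measure E x. norm (trunc f n t * g t) \<le> \<bar>f t * g t\<bar>" for n
      by (intro AE_I2) (simp add: abs_mult mult_right_mono trunc_le)
  qed (use int in auto)
  moreover have "(\<lambda>n. pvm_bounded E (trunc f n) x \<bullet> pvm_bounded E g x) \<longlonglongrightarrow> pvm_fun E f x \<bullet> pvm_bounded E g x"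
    by (intro tendsto_intros pvm_fun_LIMSEQ f x)
  ultimately show "pvm_fun E f x \<bullet> pvm_bounded E g x = (\<integral>t. f t * g t \<partial>pvm_measure E x)"
    using bf g by (simp add: pvm_bounded_inner_integral[OF E] LIMSEQ_unique)
qed

text \<open>The dictionary between vectors and measures: it reduces norms and domains of composite
  functions of A to integrals against the spectral measure of one vector.\<close>

lemma pvm_measure_pvm_fun:
  assumes f: "f \<in> borel_measurable borel" and x: "x \<in> pvm_dom E f"
  shows "pvm_measure E (pvm_fun E f x) = density (pvm_measure E x) (\<lambda>t. ennreal ((f t)\<^sup>2))"
proof (rule measure_eqI)
  note bf = bounded_borel_trunc[OF f]
  note [measurable] = f bounded_borel_measurable[OF bf]
  fix S assume "S \<in> sets (pvm_measure E (pvm_fun E f x))"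
  then have S [measurable]: "S \<in> sets borel" by simp
  have f2: "integrable (pvm_measure E x) (\<lambda>t. (f t)\<^sup>2)" using x by (simp add: pvm_dom_def)
  have int: "integrable (pvm_measure E x) (\<lambda>t. indicator S t * (f t)\<^sup>2)"
    by (rule integrable_bounded_mult[OF f2, where C=1]) (auto simp: indicator_def)
  have "E S (pvm_bounded E (trunc f n) x) \<bullet> pvm_bounded E (trunc f n) x
      = (\<integral>t. indicator S t * (trunc f n t)\<^sup>2 \<partial>pvm_measure E x)" for n
    using bf[of n] S
    by (simp add: pvm_bounded_indicator[OF E, symmetric] pvm_bounded_mult[OF E] bounded_borel_indicator
        bounded_borel_mult pvm_bounded_inner_integral[OF E] power2_eq_square mult.assoc)
  moreover have "(\<lambda>n. \<integral>t. indicator S t * (trunc f n t)\<^sup>2 \<partial>pvm_measure E x)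
      \<longlonglongrightarrow> (\<integral>t. indicator S t * (f t)\<^sup>2 \<partial>pvm_measure E x)"
  proof (rule integral_dominated_convergence[where w = "\<lambda>t. (f t)\<^sup>2"])
    show "AE t in pvm_measure E x. (\<lambda>n. indicator S t * (trunc f n t)\<^sup>2) \<longlonglongrightarrow> indicator S t * (f t)\<^sup>2"
      by (intro AE_I2 tendsto_intros trunc_LIMSEQ)
    show "AE t in pvm_measure E x. norm (indicator S t * (trunc f n t)\<^sup>2) \<le> (f t)\<^sup>2" for n
      by (intro AE_I2) (auto simp: indicator_def trunc_def)
  qed (use f2 in auto)
  moreover have "(\<lambda>n. E S (pvm_bounded E (trunc f n) x) \<bullet> pvm_bounded E (trunc f n) x)
      \<longlonglongrightarrow> E S (pvm_fun E f x) \<bullet> pvm_fun E f x"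
    by (intro tendsto_inner bounded_linear.tendsto[OF pvm_bounded_linear[OF E S]] pvm_fun_LIMSEQ f x)
  ultimately have "E S (pvm_fun E f x) \<bullet> pvm_fun E f x = (\<integral>t. indicator S t * (f t)\<^sup>2 \<partial>pvm_measure E x)"
    by (simp add: LIMSEQ_unique)
  then have "emeasure (pvm_measure E (pvm_fun E f x)) S = ennreal (\<integral>t. indicator S t * (f t)\<^sup>2 \<partial>pvm_measure E x)"
    by (simp add: emeasure_pvm_measure[OF E S])
  also have "\<dots> = (\<integral>\<^sup>+t. ennreal (indicator S t * (f t)\<^sup>2) \<partial>pvm_measure E x)"
    by (rule nn_integral_eq_integral[symmetric, OF int]) (auto simp: indicator_def)
  also have "\<dots> = emeasure (density (pvm_measure E x) (\<lambda>t. ennreal ((f t)\<^sup>2))) S"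
    by (subst emeasure_density) (auto intro!: nn_integral_cong simp: indicator_def)
  finally show "emeasure (pvm_measure E (pvm_fun E f x)) S = emeasure (density (pvm_measure E x) (\<lambda>t. ennreal ((f t)\<^sup>2))) S" .
qed simp

lemma nn_integral_pvm_fun:
  assumes "f \<in> borel_measurable borel" "x \<in> pvm_dom E f" "h \<in> borel_measurable borel"
  shows "(\<integral>\<^sup>+t. h t \<partial>pvm_measure E (pvm_fun E f x)) = (\<integral>\<^sup>+t. ennreal ((f t)\<^sup>2) * h t \<partial>pvm_measure E x)"
  unfolding pvm_measure_pvm_fun[OF assms(1,2)]
  using assms by (intro nn_integral_density) (auto simp: borel_measurable_if_sets_borel)

lemma pvm_fun_norm:
  assumes "f \<in> borel_measurable borel" "x \<in> pvm_dom E f"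
  shows "ennreal ((norm (pvm_fun E f x))\<^sup>2) = (\<integral>\<^sup>+t. ennreal ((f t)\<^sup>2) \<partial>pvm_measure E x)"
  using nn_integral_pvm_fun[OF assms, of "\<lambda>_. 1"] pvm_measure_total[OF E, of "pvm_fun E f x"]
  by (simp add: emeasure_eq_measure)

text \<open>The spectral measure of a sum is not the sum of the measures, so membership in the
  domain comes from Fatou: the truncated operators converge at x + y, which keeps the integrals of
  the truncated squares bounded.\<close>

lemma pvm_dom_add:
  assumes f: "f \<in> borel_measurable borel" and x: "x \<in> pvm_dom E f" and y: "y \<in> pvm_dom E f"
  shows "x + y \<in> pvm_dom E f" "pvm_fun E f (x + y) = pvm_fun E f x + pvm_fun E f y"
proof -
  note bf = bounded_borel_trunc[OF f]
  note [measurable] = f bounded_borel_measurable[OF bf]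
  have lin: "pvm_bounded E (trunc f n) (x + y) = pvm_bounded E (trunc f n) x + pvm_bounded E (trunc f n) y" for n
    using pvm_bounded_linear_in_vector[OF E bf] by (rule linear_add)
  have conv: "(\<lambda>n. pvm_bounded E (trunc f n) (x + y)) \<longlonglongrightarrow> pvm_fun E f x + pvm_fun E f y"
    unfolding lin by (intro tendsto_intros pvm_fun_LIMSEQ f x y)
  have "(\<integral>\<^sup>+t. ennreal ((f t)\<^sup>2) \<partial>pvm_measure E (x + y))
      = (\<integral>\<^sup>+t. liminf (\<lambda>n. ennreal ((trunc f n t)\<^sup>2)) \<partial>pvm_measure E (x + y))"
  proof (rule nn_integral_cong)
    fix t
    have "(\<lambda>n. ennreal ((trunc f n t)\<^sup>2)) \<longlonglongrightarrow> ennreal ((f t)\<^sup>2)"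
      by (intro tendsto_ennrealI tendsto_intros trunc_LIMSEQ)
    then show "ennreal ((f t)\<^sup>2) = liminf (\<lambda>n. ennreal ((trunc f n t)\<^sup>2))"
      by (rule lim_imp_Liminf[OF trivial_limit_sequentially, symmetric])
  qed
  also have "\<dots> \<le> liminf (\<lambda>n. \<integral>\<^sup>+t. ennreal ((trunc f n t)\<^sup>2) \<partial>pvm_measure E (x + y))"
    by (rule nn_integral_liminf) measurable
  also have "(\<lambda>n. \<integral>\<^sup>+t. ennreal ((trunc f n t)\<^sup>2) \<partial>pvm_measure E (x + y))
      = (\<lambda>n. ennreal ((norm (pvm_bounded E (trunc f n) (x + y)))\<^sup>2))"
    using pvm_fun_norm[OF _ pvm_dom_bounded[OF bf]] bf
    by (simp add: pvm_fun_bounded bounded_borel_measurable)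
  also have "liminf \<dots> = ennreal ((norm (pvm_fun E f x + pvm_fun E f y))\<^sup>2)"
    by (intro lim_imp_Liminf tendsto_ennrealI tendsto_intros conv) simp
  finally show "x + y \<in> pvm_dom E f" unfolding pvm_dom_iff[OF f]
    by (rule le_less_trans) simp
  from pvm_fun_LIMSEQ[OF f this] conv show "pvm_fun E f (x + y) = pvm_fun E f x + pvm_fun E f y"
    by (rule LIMSEQ_unique)
qed

lemma pvm_dom_scale:
  assumes f: "f \<in> borel_measurable borel" and x: "x \<in> pvm_dom E f"
  shows "c *\<^sub>R x \<in> pvm_dom E f" "pvm_fun E f (c *\<^sub>R x) = c *\<^sub>R pvm_fun E f x"
proof -
  \<comment> \<open>Scaling by c is the operator of a constant function, so the spectral measure of
    \<open>c *\<^sub>R x\<close> is c^2 times that of x.\<close>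
  have bb: "bounded_borel (\<lambda>_. c)" by simp
  have cx: "pvm_bounded E (\<lambda>_. c) x = c *\<^sub>R x"
    using pvm_bounded_scale[OF E, of "indicator UNIV" c x] pvm_bounded_indicator[OF E, of UNIV x] pvm_UNIV[OF E, of x]
    by (simp add: bounded_borel_indicator)
  have "(\<integral>\<^sup>+t. ennreal ((f t)\<^sup>2) \<partial>pvm_measure E (c *\<^sub>R x)) = ennreal (c\<^sup>2) * (\<integral>\<^sup>+t. ennreal ((f t)\<^sup>2) \<partial>pvm_measure E x)"
    using nn_integral_pvm_fun[OF _ pvm_dom_bounded[OF bb], of "\<lambda>t. ennreal ((f t)\<^sup>2)" x] f
    by (simp add: pvm_fun_bounded[OF bb] cx nn_integral_cmult borel_measurable_if_sets_borel)
  then show *: "c *\<^sub>R x \<in> pvm_dom E f"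
    using x f by (simp add: pvm_dom_iff ennreal_mult_less_top)
  have "(\<lambda>n. pvm_bounded E (trunc f n) (c *\<^sub>R x)) \<longlonglongrightarrow> c *\<^sub>R pvm_fun E f x"
    unfolding linear_scale[OF pvm_bounded_linear_in_vector[OF E bounded_borel_trunc[OF f]]]
    by (intro tendsto_intros pvm_fun_LIMSEQ f x)
  with pvm_fun_LIMSEQ[OF f *] show "pvm_fun E f (c *\<^sub>R x) = c *\<^sub>R pvm_fun E f x" by (rule LIMSEQ_unique)
qed

lemma pvm_dom_diff:
  assumes "f \<in> borel_measurable borel" "x \<in> pvm_dom E f" "y \<in> pvm_dom E f"
  shows "x - y \<in> pvm_dom E f" "pvm_fun E f (x - y) = pvm_fun E f x - pvm_fun E f y"
  using pvm_dom_add[OF assms(1,2), of "-1 *\<^sub>R y"] pvm_dom_scale[OF assms(1,3), of "-1"] by simp_all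

lemma pvm_dom_pvm_bounded:
  assumes f: "f \<in> borel_measurable borel" and g: "bounded_borel g"
    and fg: "x \<in> pvm_dom E (\<lambda>t. f t * g t)"
  shows "pvm_bounded E g x \<in> pvm_dom E f"
  using fg f g nn_integral_pvm_fun[OF bounded_borel_measurable[OF g] pvm_dom_bounded[OF g], of "\<lambda>t. ennreal ((f t)\<^sup>2)" x]
  by (simp add: pvm_dom_iff bounded_borel_measurable pvm_fun_bounded[OF g] power_mult_distrib ennreal_mult'' mult.commute)

text \<open>f may be unbounded provided the product is bounded, as when A is composed with its
  resolvent.\<close>

lemma pvm_fun_pvm_bounded:
  assumes f: "f \<in> borel_measurable borel" and g: "bounded_borel g" and fg: "bounded_borel (\<lambda>t. f t * g t)"
  shows "pvm_bounded E g x \<in> pvm_dom E f" "pvm_fun E f (pvm_bounded E g x) = pvm_bounded E (\<lambda>t. f t * g t) x"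
proof -
  show dom: "pvm_bounded E g x \<in> pvm_dom E f"
    using f g pvm_dom_bounded[OF fg] by (rule pvm_dom_pvm_bounded)
  obtain C where C: "\<And>t. \<bar>f t * g t\<bar> \<le> C" using fg unfolding bounded_borel_def by blast
  note bf = bounded_borel_trunc[OF f]
  have "(\<lambda>n. pvm_bounded E (\<lambda>t. trunc f n t * g t) x) \<longlonglongrightarrow> pvm_bounded E (\<lambda>t. f t * g t) x"
  proof (rule pvm_bounded_lim[OF E _ fg, where C=C])
    show "\<bar>trunc f n t * g t\<bar> \<le> C" for n t
      using C[of t] order_trans[OF abs_ge_zero C[of t]] by (auto simp: trunc_def)
    show "(\<lambda>n. trunc f n t * g t) \<longlonglongrightarrow> f t * g t" for t by (intro tendsto_intros trunc_LIMSEQ)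
  qed (use bf g in auto)
  then have "(\<lambda>n. pvm_bounded E (trunc f n) (pvm_bounded E g x)) \<longlonglongrightarrow> pvm_bounded E (\<lambda>t. f t * g t) x"
    using bf g by (simp add: pvm_bounded_mult[OF E])
  with pvm_fun_LIMSEQ[OF f dom] show "pvm_fun E f (pvm_bounded E g x) = pvm_bounded E (\<lambda>t. f t * g t) x"
    by (rule LIMSEQ_unique)
qed

lemma pvm_bounded_pvm_fun:
  assumes f: "f \<in> borel_measurable borel" and g: "bounded_borel g" and x: "x \<in> pvm_dom E f"
  shows "pvm_bounded E g x \<in> pvm_dom E f" "pvm_fun E f (pvm_bounded E g x) = pvm_bounded E g (pvm_fun E f x)"
proof -
  obtain C where C: "\<And>t. \<bar>g t\<bar> \<le> C" using g unfolding bounded_borel_def by blast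
  note bf = bounded_borel_trunc[OF f]
  have "integrable (pvm_measure E x) (\<lambda>t. (g t)\<^sup>2 * (f t)\<^sup>2)"
  proof (rule integrable_bounded_mult[where C="C\<^sup>2"])
    show "AE t in pvm_measure E x. \<bar>(g t)\<^sup>2\<bar> \<le> C\<^sup>2"
      using order_trans[OF C abs_ge_self] by (intro AE_I2) (simp add: abs_le_square_iff[symmetric])
  qed (use x g in \<open>auto simp: pvm_dom_def intro!: borel_measurable_if_sets_borel[of _ "pvm_measure E x"] borel_measurable_power bounded_borel_measurable\<close>)
  then have "x \<in> pvm_dom E (\<lambda>t. f t * g t)" by (simp add: pvm_dom_def power_mult_distrib mult.commute)
  with f g show dom: "pvm_bounded E g x \<in> pvm_dom E f" by (rule pvm_dom_pvm_bounded)
  have "(\<lambda>n. pvm_bounded E g (pvm_bounded E (trunc f n) x)) \<longlonglongrightarrow> pvm_bounded E g (pvm_fun E f x)"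
    by (intro bounded_linear.tendsto[OF pvm_bounded_bounded_linear[OF E g]] pvm_fun_LIMSEQ f x)
  then have "(\<lambda>n. pvm_bounded E (trunc f n) (pvm_bounded E g x)) \<longlonglongrightarrow> pvm_bounded E g (pvm_fun E f x)"
    using bf g by (simp add: pvm_bounded_mult[OF E] mult.commute)
  with pvm_fun_LIMSEQ[OF f dom] show "pvm_fun E f (pvm_bounded E g x) = pvm_bounded E g (pvm_fun E f x)"
    by (rule LIMSEQ_unique)
qed

end

section \<open>The spectral measure of a nonnegative self-adjoint operator\<close>

locale nonneg_self_adjoint =
  fixes D :: "'a::{real_inner, complete_space} set" and A :: "'a \<Rightarrow> 'a"
  assumes sa: "self_adjoint_operator D A" and nonneg: "nonneg_operator D A"
begin

lemma D_subspace: "subspace D"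
  and A_add: "x \<in> D \<Longrightarrow> y \<in> D \<Longrightarrow> A (x + y) = A x + A y"
  and A_scale: "x \<in> D \<Longrightarrow> A (c *\<^sub>R x) = c *\<^sub>R A x"
  and A_adjointI: "(\<And>x. x \<in> D \<Longrightarrow> A x \<bullet> y = x \<bullet> z) \<Longrightarrow> y \<in> D \<and> z = A y"
  and A_sym: "x \<in> D \<Longrightarrow> y \<in> D \<Longrightarrow> A x \<bullet> y = x \<bullet> A y"
  and A_nonneg: "x \<in> D \<Longrightarrow> 0 \<le> x \<bullet> A x"
  using sa nonneg unfolding self_adjoint_operator_def linear_operator_on_def nonneg_operator_def by blast+

lemma A_diff: "x \<in> D \<Longrightarrow> y \<in> D \<Longrightarrow> A (x - y) = A x - A y"
  using A_add[of x "-1 *\<^sub>R y"] A_scale[of y "-1"] D_subspace by (simp add: subspace_neg)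

lemma norm_le_one_plus_A: "x \<in> D \<Longrightarrow> norm x \<le> norm (x + A x)"
proof -
  assume x: "x \<in> D"
  have "(norm x)\<^sup>2 \<le> x \<bullet> (x + A x)" using A_nonneg[OF x] by (simp add: inner_simps power2_norm_eq_inner)
  also have "\<dots> \<le> norm x * norm (x + A x)" by (rule norm_cauchy_schwarz)
  finally show ?thesis by (cases "x = 0") (simp_all add: power2_eq_square)
qed

text \<open>The range is closed because 1 + A is bounded below and a self-adjoint A has a closed
  graph. A vector v orthogonal to the range lies in D with A v = - v, and nonnegativity of A then
  forces v = 0.\<close>

lemma one_plus_A_surj: "\<exists>x\<in>D. x + A x = y"
proof -
  define M where "M = (\<lambda>x. x + A x) ` D"
  have sub: "subspace M"
  proof (rule subspaceI)
    have "A 0 = 0" using A_scale[of 0 0] D_subspace by (simp add: subspace_0)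
    then show "0 \<in> M" unfolding M_def using D_subspace subspace_0 by force
    show "x + y \<in> M" if xy: "x \<in> M" "y \<in> M" for x y
    proof -
      obtain u v where "u \<in> D" "x = u + A u" "v \<in> D" "y = v + A v" using xy unfolding M_def by blast
      then show ?thesis unfolding M_def using A_add[of u v] D_subspace
        by (intro image_eqI[of _ _ "u + v"]) (auto simp: subspace_add)
    qed
    show "c *\<^sub>R x \<in> M" if x: "x \<in> M" for c x
    proof -
      obtain u where "u \<in> D" "x = u + A u" using x unfolding M_def by blast
      then show ?thesis unfolding M_def using A_scale[of u c] D_subspace
        by (intro image_eqI[of _ _ "c *\<^sub>R u"]) (auto simp: subspace_scale scaleR_add_right)
    qed
  qed
  have closed: "closed M"
    unfolding closed_sequential_limits
  proof (intro allI impI, elim conjE)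
    fix f :: "nat \<Rightarrow> 'a" and l assume f: "\<forall>n. f n \<in> M" and lim: "f \<longlonglongrightarrow> l"
    have "\<exists>x\<in>D. f n = x + A x" for n using f unfolding M_def by blast
    then obtain x where x: "\<And>n. x n \<in> D" "\<And>n. f n = x n + A (x n)" by metis
    have diff: "norm (x m - x n) \<le> norm (f m - f n)" for m n
      using norm_le_one_plus_A[of "x m - x n"] x A_diff[of "x m" "x n"] D_subspace
      by (simp add: subspace_diff algebra_simps)
    have "Cauchy f" using lim LIMSEQ_imp_Cauchy by blast
    then have "Cauchy x" unfolding Cauchy_def dist_norm using diff by (meson le_less_trans)
    then obtain u where u: "x \<longlonglongrightarrow> u" using Cauchy_convergent_iff convergentD by blast
    have Ax: "(\<lambda>n. A (x n)) \<longlonglongrightarrow> l - u"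
      using tendsto_diff[OF lim u] x(2) by simp
    have "u \<in> D \<and> l - u = A u"
    proof (rule A_adjointI)
      fix w assume w: "w \<in> D"
      have "(\<lambda>n. A w \<bullet> x n) \<longlonglongrightarrow> A w \<bullet> u" by (intro tendsto_intros u)
      moreover have "(\<lambda>n. A w \<bullet> x n) \<longlonglongrightarrow> w \<bullet> (l - u)"
        unfolding A_sym[OF w x(1)] by (intro tendsto_inner tendsto_const Ax)
      ultimately show "A w \<bullet> u = w \<bullet> (l - u)" by (rule LIMSEQ_unique)
    qed
    then show "l \<in> M" unfolding M_def by (intro image_eqI[of _ _ u]) (auto simp: algebra_simps)
  qed
  obtain u where u: "u \<in> M" "\<And>w. w \<in> M \<Longrightarrow> w \<bullet> y = w \<bullet> u"
    using riesz_on_closed_subspace[OF sub closed, of "\<lambda>w. w \<bullet> y" "norm y"]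
    by (auto simp: inner_simps mult.commute Cauchy_Schwarz_ineq2)
  define v where "v = y - u"
  have "v \<in> D \<and> - v = A v"
  proof (rule A_adjointI)
    fix w assume "w \<in> D"
    then have "w + A w \<in> M" unfolding M_def by blast
    from u(2)[OF this] show "A w \<bullet> v = w \<bullet> - v" unfolding v_def by (simp add: inner_simps)
  qed
  then have "v \<bullet> v = 0" using A_nonneg[of v] by (metis inner_ge_zero inner_minus_right neg_0_le_iff_le order_antisym)
  then show ?thesis using u(1) unfolding M_def v_def by auto
qed

definition resolvent :: "'a \<Rightarrow> 'a" where
  "resolvent y = (SOME x. x \<in> D \<and> x + A x = y)"

lemma resolvent: "resolvent y \<in> D" "resolvent y + A (resolvent y) = y"
  using someI_ex[of "\<lambda>x. x \<in> D \<and> x + A x = y"] one_plus_A_surj[of y] unfolding resolvent_def by blast+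

lemma resolvent_unique:
  assumes "x \<in> D" "x + A x = y"
  shows "resolvent y = x"
proof -
  have "norm (resolvent y - x) \<le> norm ((resolvent y - x) + A (resolvent y - x))"
    using resolvent(1) assms(1) D_subspace by (intro norm_le_one_plus_A subspace_diff)
  also have "(resolvent y - x) + A (resolvent y - x) = 0"
    using resolvent[of y] assms by (simp add: A_diff algebra_simps)
  finally show ?thesis by simp
qed

lemma positive_contraction_resolvent: "positive_contraction resolvent"
proof (rule positive_contraction.intro)
  show "bounded_linear resolvent"
  proof (rule bounded_linear_intro[of _ 1])
    show "resolvent (x + y) = resolvent x + resolvent y" for x y
    proof (rule resolvent_unique)
      show "resolvent x + resolvent y + A (resolvent x + resolvent y) = x + y"
        using resolvent[of x] resolvent[of y] by (simp add: A_add algebra_simps)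
    qed (simp add: resolvent D_subspace subspace_add)
    show "resolvent (c *\<^sub>R x) = c *\<^sub>R resolvent x" for c x
    proof (rule resolvent_unique)
      show "c *\<^sub>R resolvent x + A (c *\<^sub>R resolvent x) = c *\<^sub>R x"
        using resolvent[of x] by (simp add: A_scale flip: scaleR_add_right)
    qed (simp add: resolvent D_subspace subspace_scale)
    show "norm (resolvent x) \<le> norm x * 1" for x
      using norm_le_one_plus_A[OF resolvent(1)[of x]] resolvent(2)[of x] by simp
  qed
  fix x y
  have "resolvent x \<bullet> (resolvent y + A (resolvent y)) = (resolvent x + A (resolvent x)) \<bullet> resolvent y"
    using A_sym[OF resolvent(1)[of x] resolvent(1)[of y]] by (simp add: inner_simps)
  then show "resolvent x \<bullet> y = x \<bullet> resolvent y" by (simp only: resolvent(2))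
  have *: "resolvent x \<bullet> x = (norm (resolvent x))\<^sup>2 + resolvent x \<bullet> A (resolvent x)"
    using arg_cong[OF resolvent(2)[of x], of "\<lambda>v. resolvent x \<bullet> v"] by (simp add: inner_simps power2_norm_eq_inner)
  then show "0 \<le> resolvent x \<bullet> x" using A_nonneg[OF resolvent(1)[of x]] by simp
  have "resolvent x \<bullet> x \<le> norm (resolvent x) * norm x" by (rule norm_cauchy_schwarz)
  also have "\<dots> \<le> norm x * norm x"
    using norm_le_one_plus_A[OF resolvent(1)[of x]] resolvent(2)[of x] by (simp add: mult_right_mono)
  finally show "resolvent x \<bullet> x \<le> x \<bullet> x" by (simp add: power2_norm_eq_inner[symmetric] power2_eq_square)
qed

lemma symmetric_eqI:
  fixes S T :: "'a \<Rightarrow> 'a"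
  assumes "linear S" "linear T" "\<And>x y. S x \<bullet> y = x \<bullet> S y" "\<And>x y. T x \<bullet> y = x \<bullet> T y"
    and quad: "\<And>x. S x \<bullet> x = T x \<bullet> x"
  shows "S x = T x"
proof -
  have "S x \<bullet> y = T x \<bullet> y" for y
    using quad[of "x + y"] quad[of x] quad[of y] assms(3)[of x y] assms(4)[of x y]
    by (simp add: linear_add[OF assms(1)] linear_add[OF assms(2)] inner_simps inner_commute)
  then show ?thesis by (metis vector_eq_rdot)
qed

text \<open>
  The map \<open>t \<mapsto> 1/t - 1\<close> carries the spectrum of the resolvent \<open>(1 + A)\<^sup>-\<^sup>1\<close> to that of \<open>A\<close>;
  with \<open>1/0 = 0\<close> it sends the null set \<open>{0}\<close> to the negative number \<open>-1\<close>.
\<close>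

theorem is_spectral_measure_exists: "\<exists>E. is_spectral_measure D A E"
proof -
  obtain F where F: "projection_valued_measure F"
    and F_AE: "\<And>x. AE t in pvm_measure F x. t \<in> {0..1}"
    and F_int: "\<And>x. (\<integral>t. t \<partial>pvm_measure F x) = resolvent x \<bullet> x"
    using spectral_theorem_positive_contraction[OF positive_contraction_resolvent] by blast
  note [simp, measurable_cong] = sets_pvm_measure[OF F]
  note [simp] = space_pvm_measure[OF F]
  define \<phi> :: "real \<Rightarrow> real" where "\<phi> t = 1 / t - 1" for t
  have \<phi>_meas [measurable]: "\<phi> \<in> borel_measurable borel" unfolding \<phi>_def by measurable
  have pre: "\<phi> -` S \<in> sets borel" if "S \<in> sets borel" for S
    using measurable_sets[OF \<phi>_meas that] by simp
  define E where "E S = F (\<phi> -` S)" for S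
  have E: "projection_valued_measure E"
    unfolding projection_valued_measure_def E_def
  proof (intro conjI ballI allI impI)
    fix G :: "nat \<Rightarrow> real set" and x assume G: "range G \<subseteq> sets borel" "disjoint_family G"
    have "(\<lambda>i. F (\<phi> -` G i) x) sums F (\<Union>i. \<phi> -` G i) x"
      using G pre by (intro pvm_sums[OF F]) (auto simp: disjoint_family_on_def)
    then show "(\<lambda>i. F (\<phi> -` G i) x) sums F (\<phi> -` (\<Union>i. G i)) x" by (simp add: vimage_UN)
  qed (use pre in \<open>simp_all add: pvm_bounded_linear[OF F] pvm_symmetric[OF F] pvm_UNIV[OF F] pvm_mult[OF F]\<close>)
  note [simp, measurable_cong] = sets_pvm_measure[OF E]
  note [simp] = space_pvm_measure[OF E]
  have distr: "pvm_measure E x = distr (pvm_measure F x) borel \<phi>" for x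
  proof (rule measure_eqI)
    fix S assume "S \<in> sets (pvm_measure E x)"
    then have S: "S \<in> sets borel" by simp
    show "emeasure (pvm_measure E x) S = emeasure (distr (pvm_measure F x) borel \<phi>) S"
      using S pre[OF S] borel_measurable_if_sets_borel[OF \<phi>_meas, of "pvm_measure F x"]
      by (simp add: emeasure_distr emeasure_pvm_measure[OF E] emeasure_pvm_measure[OF F] E_def)
  qed simp
  \<comment> \<open>The resolvent is injective, so 0 carries no mass: on the range of
    \<open>F {0}\<close> its quadratic form vanishes, which makes \<open>resolvent y\<close> and
    then \<open>y\<close> zero.\<close>
  have F0: "F {0} x = 0" for x
  proof -
    define y where "y = F {0} x"
    have "F (UNIV - {0}) y \<bullet> y = F {} x \<bullet> y"
      unfolding y_def by (simp add: pvm_mult[OF F])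
    moreover have "F {} x = 0"
      using pvm_inner_self[OF F, of "{}" x] measure_pvm_measure[OF F, of "{}" x] by simp
    ultimately have "emeasure (pvm_measure F y) (UNIV - {0}) = 0"
      by (simp add: emeasure_pvm_measure[OF F])
    then have "AE t in pvm_measure F y. t = 0"
      by (intro AE_I[where N = "UNIV - {0}"]) auto
    then have "(\<integral>t. t \<partial>pvm_measure F y) = (\<integral>t. 0 \<partial>pvm_measure F y)"
      by (intro integral_cong_AE) (auto intro: borel_measurable_if_sets_borel)
    then have "resolvent y \<bullet> (resolvent y + A (resolvent y)) = 0" using F_int[of y] resolvent(2)[of y] by simp
    then have "resolvent y \<bullet> resolvent y \<le> 0"
      using A_nonneg[OF resolvent(1)[of y]] by (simp add: inner_simps)
    then have "resolvent y = 0" by (metis inner_ge_zero inner_eq_zero_iff order_antisym)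
    then have "y = 0" using resolvent(2)[of y] A_scale[of 0 0] D_subspace by (simp add: subspace_0)
    then show ?thesis by (simp add: y_def)
  qed
  have F_pos: "AE t in pvm_measure F x. 0 < t \<and> t \<le> 1" for x
  proof -
    have "AE t in pvm_measure F x. t \<noteq> 0"
      by (rule AE_I[where N = "{0}"]) (auto simp: emeasure_pvm_measure[OF F] F0)
    with F_AE[of x] show ?thesis by eventually_elim auto
  qed
  have E_nonneg: "AE l in pvm_measure E x. 0 \<le> l" for x
  proof -
    have "AE t in pvm_measure F x. 0 \<le> \<phi> t"
      using F_pos[of x] by eventually_elim (simp add: \<phi>_def)
    then show ?thesis
      unfolding distr using borel_measurable_if_sets_borel[OF \<phi>_meas, of "pvm_measure F x"]
      by (subst AE_distr_iff) auto
  qed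
  \<comment> \<open>The resolvent function 1/(1 + l), set to 0 on the negative half-line, a null
    set, to keep it bounded.\<close>
  define g :: "real \<Rightarrow> real" where "g l = (if 0 \<le> l then 1 / (1 + l) else 0)" for l
  have g: "bounded_borel g"
    by (rule bounded_borelI[where C=1]) (auto simp: g_def[abs_def])
  have lg_eq: "(\<lambda>l. l * g l) = (\<lambda>l. indicator {0..} l - g l)"
  proof
    show "l * g l = indicator {0..} l - g l" for l
      using add_nonneg_eq_0_iff[of 1 l] by (cases "0 \<le> l") (simp_all add: g_def field_simps)
  qed
  have ind: "bounded_borel (indicator {0..})" by (rule bounded_borel_indicator) simp
  have lg: "bounded_borel (\<lambda>l. l * g l)" unfolding lg_eq using ind g by (rule bounded_borel_diff)
  have ind_id: "pvm_bounded E (indicator {0..}) x = x" for x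
  proof -
    have "pvm_bounded E (indicator {0..}) x = pvm_bounded E (indicator UNIV) x"
      using E_nonneg[of x] by (intro pvm_bounded_cong_AE[OF E]) (auto elim!: eventually_mono)
    also have "\<dots> = x" using pvm_bounded_indicator[OF E borel_open[OF open_UNIV], of x] by (simp only: pvm_UNIV[OF E])
    finally show ?thesis .
  qed
  have lg_op: "pvm_bounded E (\<lambda>l. l * g l) x = x - pvm_bounded E g x" for x
    unfolding lg_eq using ind g by (simp add: pvm_bounded_diff[OF E] ind_id)
  have res: "pvm_bounded E g x = resolvent x" for x
  proof (rule symmetric_eqI[of "pvm_bounded E g" resolvent])
    note R = positive_contraction_resolvent
    show "linear (pvm_bounded E g)" by (rule pvm_bounded_linear_in_vector[OF E g])
    show "linear resolvent" using positive_contraction.lin[OF R] by (rule bounded_linear.linear)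
    show "resolvent x \<bullet> y = x \<bullet> resolvent y" for x y by (rule positive_contraction.sym[OF R])
    show "pvm_bounded E g x \<bullet> y = x \<bullet> pvm_bounded E g y" for x y by (rule pvm_bounded_sym[OF E g])
    show "pvm_bounded E g x \<bullet> x = resolvent x \<bullet> x" for x
    proof -
      have gm: "g \<in> borel_measurable borel" using g by (rule bounded_borel_measurable)
      have "pvm_bounded E g x \<bullet> x = (\<integral>l. g l \<partial>pvm_measure E x)"
        by (simp add: pvm_bounded_inner[OF E g] pvm_form_bilinear(4)[OF E g])
      also have "\<dots> = (\<integral>t. g (\<phi> t) \<partial>pvm_measure F x)"
        unfolding distr by (rule integral_distr) (auto intro: borel_measurable_if_sets_borel gm)
      also have "\<dots> = (\<integral>t. t \<partial>pvm_measure F x)"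
      proof (rule integral_cong_AE)
        show "(\<lambda>t. g (\<phi> t)) \<in> borel_measurable (pvm_measure F x)"
          using measurable_compose[OF \<phi>_meas gm] by (rule borel_measurable_if_sets_borel) simp
        show "AE t in pvm_measure F x. g (\<phi> t) = t"
          using F_pos[of x] by eventually_elim (auto simp: g_def \<phi>_def)
      qed (auto intro: borel_measurable_if_sets_borel)
      finally show ?thesis using F_int by simp
    qed
  qed
  have id: "(\<lambda>l::real. l) \<in> borel_measurable borel" by simp
  \<comment> \<open>Both domains are the range of the resolvent: l g(l) = 1 - g(l) on the spectrum
    says A (1 + A)^-1 = 1 - (1 + A)^-1, and each inclusion rests on this.\<close>
  have "x \<in> pvm_dom E (\<lambda>l. l) \<and> A x = pvm_fun E (\<lambda>l. l) x" if x: "x \<in> D" for x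
  proof -
    define y where "y = x + A x"
    have "pvm_bounded E g y = x" unfolding res by (rule resolvent_unique[OF x]) (simp add: y_def)
    then show ?thesis using pvm_fun_pvm_bounded[OF E id g lg, of y] lg_op[of y] by (simp add: y_def)
  qed
  moreover have "x \<in> D" if x: "x \<in> pvm_dom E (\<lambda>l. l)" for x
  proof -
    have "pvm_bounded E g (pvm_fun E (\<lambda>l. l) x) = x - pvm_bounded E g x"
      using pvm_bounded_pvm_fun(2)[OF E id g x] pvm_fun_pvm_bounded(2)[OF E id g lg, of x] lg_op[of x] by simp
    then have "pvm_bounded E g (x + pvm_fun E (\<lambda>l. l) x) = x"
      by (simp add: linear_add[OF pvm_bounded_linear_in_vector[OF E g]])
    then show ?thesis unfolding res using resolvent(1) by metis
  qed
  ultimately show ?thesis unfolding is_spectral_measure_def using E by blast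
qed

section \<open>The chosen spectral measure of A\<close>

definition E where "E = spectral_measure D A"

lemma is_spectral_measure_E: "is_spectral_measure D A E"
  unfolding E_def spectral_measure_def using is_spectral_measure_exists by (rule someI_ex)

lemma pvm_E: "projection_valued_measure E"
  and D_iff: "x \<in> D \<longleftrightarrow> x \<in> pvm_dom E (\<lambda>l. l)"
  and A_eq: "x \<in> D \<Longrightarrow> A x = pvm_fun E (\<lambda>l. l) x"
  using is_spectral_measure_E unfolding is_spectral_measure_def by blast+

text \<open>\<open>E\<close> is a chosen spectral measure, not necessarily the one built above, so
  its support is derived from A alone: y = E([-n, 0)) x lies in D, and <y, A y> is nonnegative while
  it is the integral of a nonpositive function.\<close>

lemma AE_nonneg: "AE l in pvm_measure E x. 0 \<le> l"
proof -
  note [simp, measurable_cong] = sets_pvm_measure[OF pvm_E]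
  note [simp] = space_pvm_measure[OF pvm_E]
  have id: "(\<lambda>l::real. l) \<in> borel_measurable borel" by simp
  have "AE l in pvm_measure E x. l \<notin> {- real n..<0}" for n
  proof -
    let ?S = "{- real n..<0}"
    have S: "bounded_borel (indicator ?S)" by (rule bounded_borel_indicator) simp
    have lS: "bounded_borel (\<lambda>l. l * indicator ?S l)"
      by (rule bounded_borelI[where C="real n"]) (auto simp: indicator_def)
    have nonpos: "l * indicator ?S l \<le> 0" for l by (auto simp: indicator_def)
    let ?y = "pvm_bounded E (indicator ?S) x"
    have y: "?y \<in> D" "A ?y = pvm_bounded E (\<lambda>l. l * indicator ?S l) x"
      using pvm_fun_pvm_bounded[OF pvm_E id S lS, of x] A_eq[of ?y] by (simp_all add: D_iff)
    have "0 \<le> ?y \<bullet> A ?y" by (rule A_nonneg[OF y(1)])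
    also have "\<dots> = (\<integral>l. indicator ?S l * (l * indicator ?S l) \<partial>pvm_measure E x)"
      unfolding y(2) by (rule pvm_bounded_inner_integral[OF pvm_E S lS])
    also have "\<dots> = (\<integral>l. l * indicator ?S l \<partial>pvm_measure E x)"
      by (intro Bochner_Integration.integral_cong refl) (auto simp: indicator_def)
    finally have "0 \<le> (\<integral>l. l * indicator ?S l \<partial>pvm_measure E x)" .
    moreover have "(\<integral>l. l * indicator ?S l \<partial>pvm_measure E x) \<le> (\<integral>l. 0 \<partial>pvm_measure E x)"
      using nonpos pvm_integrable[OF pvm_E lS] by (intro integral_mono) auto
    ultimately have "(\<integral>l. - (l * indicator ?S l) \<partial>pvm_measure E x) = 0" by simp
    then have "AE l in pvm_measure E x. - (l * indicator ?S l) = 0"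
      using nonpos pvm_integrable[OF pvm_E lS]
      by (subst (asm) integral_nonneg_eq_0_iff_AE) auto
    then show ?thesis by eventually_elim (auto simp: indicator_def)
  qed
  then have "AE l in pvm_measure E x. \<forall>n. l \<notin> {- real n..<0}" unfolding AE_all_countable by (rule allI)
  then show ?thesis
  proof eventually_elim
    fix l assume *: "\<forall>n. l \<notin> {- real n..<0}"
    obtain n where "- l \<le> real n" using real_arch_simple by blast
    then show "0 \<le> l" using *[rule_format, of n] by auto
  qed
qed

end

section \<open>Sobolev norms and solutions in terms of the spectral measure\<close>

text \<open>Matches the usual derivative with the difference quotient in
  \<open>hs_C1_deriv_on\<close>.\<close>

lemma has_vector_derivative_iff_quotient:
  fixes f :: "real \<Rightarrow> 'a::real_normed_vector"
  shows "(f has_vector_derivative f') (at t within I) \<longleftrightarrow>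
    ((\<lambda>\<tau>. norm ((f \<tau> - f t) /\<^sub>R (\<tau> - t) - f')) \<longlongrightarrow> 0) (at t within I)"
proof -
  have eq: "norm (f \<tau> - f t - (\<tau> - t) *\<^sub>R f') / norm (\<tau> - t) = norm ((f \<tau> - f t) /\<^sub>R (\<tau> - t) - f')"
    if "\<tau> \<noteq> t" for \<tau>
  proof -
    have "(f \<tau> - f t) /\<^sub>R (\<tau> - t) - f' = (f \<tau> - f t - (\<tau> - t) *\<^sub>R f') /\<^sub>R (\<tau> - t)"
      using that by (simp add: scaleR_diff_right)
    then show ?thesis by (simp add: divide_inverse mult.commute)
  qed
  have "(f has_vector_derivative f') (at t within I) \<longleftrightarrow>
    ((\<lambda>\<tau>. norm (f \<tau> - f t - (\<tau> - t) *\<^sub>R f') / norm (\<tau> - t)) \<longlongrightarrow> 0) (at t within I)"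
    by (simp add: has_vector_derivative_def has_derivative_iff_norm bounded_linear_scaleR_left)
  also have "\<dots> \<longleftrightarrow> ((\<lambda>\<tau>. norm ((f \<tau> - f t) /\<^sub>R (\<tau> - t) - f')) \<longlongrightarrow> 0) (at t within I)"
  proof (intro filterlim_cong refl)
    show "\<forall>\<^sub>F \<tau> in at t within I. norm (f \<tau> - f t - (\<tau> - t) *\<^sub>R f') / norm (\<tau> - t) = norm ((f \<tau> - f t) /\<^sub>R (\<tau> - t) - f')"
      unfolding eventually_at_filter using eq by (intro always_eventually) blast
  qed
  finally show ?thesis .
qed

context nonneg_self_adjoint
begin

lemmas [simp, measurable_cong] = sets_pvm_measure[OF pvm_E]
lemmas [simp] = space_pvm_measure[OF pvm_E]

lemma fun_dom_eq: "fun_dom D A f = pvm_dom E f"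
  and fun_op_eq: "fun_op D A f = pvm_fun E f"
  by (simp_all add: fun_dom_def fun_op_def E_def)

text \<open>Extended nonnegative values allow weights to be compared and summed without
  integrability side conditions; finiteness for the weight f^2 is membership in the domain of f(A).
  Negative values of h count as 0.\<close>

definition J :: "(real \<Rightarrow> real) \<Rightarrow> 'a \<Rightarrow> ennreal" where
  "J h x = (\<integral>\<^sup>+l. ennreal (h l) \<partial>pvm_measure E x)"

text \<open>The negative half-line is a null set, so weights such as (1 + l) powr s are compared
  only where they have their intended meaning.\<close>

lemma J_mono: "(\<And>l. 0 \<le> l \<Longrightarrow> h l \<le> k l) \<Longrightarrow> J h x \<le> J k x"
  unfolding J_def using AE_nonneg[of x]
  by (intro nn_integral_mono_AE) (auto elim!: eventually_mono intro: ennreal_leI)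

lemma J_cong: "(\<And>l. 0 \<le> l \<Longrightarrow> h l = k l) \<Longrightarrow> J h x = J k x"
  by (intro antisym J_mono) simp_all

lemma J_add:
  assumes [measurable]: "h \<in> borel_measurable borel" "k \<in> borel_measurable borel"
    and "\<And>l. 0 \<le> h l" "\<And>l. 0 \<le> k l"
  shows "J (\<lambda>l. h l + k l) x = J h x + J k x"
  unfolding J_def using assms(3,4) by (simp add: nn_integral_add)

lemma J_cmult:
  assumes [measurable]: "h \<in> borel_measurable borel" and "0 \<le> c"
  shows "J (\<lambda>l. c * h l) x = ennreal c * J h x"
  unfolding J_def using assms(2) by (simp add: ennreal_mult' nn_integral_cmult)

lemma J_one: "J (\<lambda>_. 1) x = ennreal ((norm x)\<^sup>2)"
  using finite_measure.emeasure_eq_measure[OF finite_measure_pvm[OF pvm_E], of x UNIV]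
  by (simp add: J_def pvm_measure_total[OF pvm_E])

lemma J_pvm_fun:
  assumes "f \<in> borel_measurable borel" "x \<in> pvm_dom E f" "h \<in> borel_measurable borel"
  shows "J h (pvm_fun E f x) = J (\<lambda>l. (f l)\<^sup>2 * h l) x"
  unfolding J_def using assms by (subst nn_integral_pvm_fun[OF pvm_E]) (simp_all add: ennreal_mult')

lemma pvm_dom_iff_J: "f \<in> borel_measurable borel \<Longrightarrow> x \<in> pvm_dom E f \<longleftrightarrow> J (\<lambda>l. (f l)\<^sup>2) x < \<infinity>"
  unfolding J_def by (rule pvm_dom_iff[OF pvm_E])

lemma norm_pvm_fun_J:
  "f \<in> borel_measurable borel \<Longrightarrow> x \<in> pvm_dom E f \<Longrightarrow> ennreal ((norm (pvm_fun E f x))\<^sup>2) = J (\<lambda>l. (f l)\<^sup>2) x"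
  unfolding J_def by (rule pvm_fun_norm[OF pvm_E])

lemma J_bounded_integral:
  assumes "bounded_borel g" "\<And>l. 0 \<le> g l"
  shows "J g x = ennreal (integral\<^sup>L (pvm_measure E x) g)"
  unfolding J_def using assms by (intro nn_integral_eq_integral pvm_integrable[OF pvm_E]) auto

lemma sob_weight_measurable [measurable]: "(\<lambda>l. (1 + l) powr s) \<in> borel_measurable (borel :: real measure)"
  by measurable

lemma powr_half_square: "((x powr (s / 2))\<^sup>2 :: real) = x powr s"
  by (simp add: power2_eq_square powr_add[symmetric])

lemma sob_dom_iff: "x \<in> sob_dom D A s \<longleftrightarrow> J (\<lambda>l. (1 + l) powr s) x < \<infinity>"
  unfolding sob_dom_def fun_dom_eq by (subst pvm_dom_iff_J) (simp_all add: powr_half_square)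

lemma sob_norm_J: "x \<in> sob_dom D A s \<Longrightarrow> ennreal ((sob_norm D A s x)\<^sup>2) = J (\<lambda>l. (1 + l) powr s) x"
  unfolding sob_dom_def fun_dom_eq sob_norm_def fun_op_eq
  by (subst norm_pvm_fun_J) (simp_all add: powr_half_square)

lemma sob_norm_nonneg: "0 \<le> sob_norm D A s x"
  by (simp add: sob_norm_def)

lemma J_sob_zero: "J (\<lambda>l. (1 + l) powr 0) x = ennreal ((norm x)\<^sup>2)"
  unfolding J_one[symmetric] by (rule J_cong) simp

lemma sob_norm_zero: "sob_norm D A 0 x = norm x"
proof -
  have "ennreal ((sob_norm D A 0 x)\<^sup>2) = ennreal ((norm x)\<^sup>2)"
    using sob_norm_J[of x 0] by (simp only: sob_dom_iff J_sob_zero infinity_ennreal_def ennreal_less_top)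
  then show ?thesis using sob_norm_nonneg[of 0 x] by simp
qed

lemma sqrt_measurable [measurable]: "sqrt \<in> borel_measurable borel"
  by (simp add: borel_measurable_continuous_onI continuous_on_real_sqrt continuous_on_id)

lemma J_sqrt_op:
  assumes "q \<in> sqrt_dom D A" "h \<in> borel_measurable borel"
  shows "J h (sqrt_op D A q) = J (\<lambda>l. l * h l) q"
proof -
  have "J h (sqrt_op D A q) = J (\<lambda>l. (sqrt l)\<^sup>2 * h l) q"
    using assms unfolding fun_dom_eq fun_op_eq by (intro J_pvm_fun) auto
  also have "\<dots> = J (\<lambda>l. l * h l) q" by (rule J_cong) simp
  finally show ?thesis .
qed

lemma sqrt_op_diff:
  "q \<in> sqrt_dom D A \<Longrightarrow> q' \<in> sqrt_dom D A \<Longrightarrow> q - q' \<in> sqrt_dom D A"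
  "q \<in> sqrt_dom D A \<Longrightarrow> q' \<in> sqrt_dom D A \<Longrightarrow> sqrt_op D A (q - q') = sqrt_op D A q - sqrt_op D A q'"
  unfolding fun_dom_eq fun_op_eq using pvm_dom_diff[OF pvm_E, of sqrt] by simp_all

lemma sob_dom_diff: "x \<in> sob_dom D A s \<Longrightarrow> y \<in> sob_dom D A s \<Longrightarrow> x - y \<in> sob_dom D A s"
  unfolding sob_dom_def fun_dom_eq by (rule pvm_dom_diff[OF pvm_E]) measurable

lemma proj_ge_eq: "proj_ge D A \<kappa> x = pvm_bounded E (indicator {\<kappa>\<^sup>2..}) x"
  unfolding proj_ge_def fun_op_eq by (rule pvm_fun_bounded[OF pvm_E]) auto

lemma J_proj_ge:
  assumes "h \<in> borel_measurable borel"
  shows "J h (proj_ge D A \<kappa> x) = J (\<lambda>l. indicator {\<kappa>\<^sup>2..} l * h l) x"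
proof -
  have b: "bounded_borel (indicator {\<kappa>\<^sup>2..})" by (rule bounded_borel_indicator) simp
  have sq: "(\<lambda>l. (indicator {\<kappa>\<^sup>2..} l)\<^sup>2 * h l) = (\<lambda>l. indicator {\<kappa>\<^sup>2..} l * h l)"
    by (auto simp: indicator_def)
  show ?thesis
    using J_pvm_fun[OF bounded_borel_measurable[OF b] pvm_dom_bounded[OF pvm_E b] assms, of x]
    unfolding proj_ge_eq pvm_fun_bounded[OF pvm_E b] sq .
qed

lemma sqrt_op_proj_ge:
  assumes "q \<in> sqrt_dom D A"
  shows "proj_ge D A \<kappa> q \<in> sqrt_dom D A" "sqrt_op D A (proj_ge D A \<kappa> q) = proj_ge D A \<kappa> (sqrt_op D A q)"
  using pvm_bounded_pvm_fun[OF pvm_E sqrt_measurable bounded_borel_indicator, of "{\<kappa>\<^sup>2..}" q] assms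
  unfolding fun_dom_eq fun_op_eq proj_ge_eq by auto

lemma cal_h_norm_J:
  assumes "(q, p) \<in> cal_h D A s"
  shows "ennreal ((cal_h_norm D A s (q, p))\<^sup>2)
    = J (\<lambda>l. (1 + l) powr (s - 1)) (sqrt_op D A q) + J (\<lambda>l. (1 + l) powr (s - 1)) p"
  using assms by (simp add: cal_h_def cal_h_norm_def sob_norm_J[symmetric] ennreal_plus)

lemma cal_h_norm_nonneg: "0 \<le> cal_h_norm D A s w"
  by (simp add: cal_h_norm_def split: prod.split)

lemma cal_h_proj_ge:
  assumes "(q, p) \<in> cal_h D A s"
  shows "(proj_ge D A \<kappa> q, proj_ge D A \<kappa> p) \<in> cal_h D A s"
    and "ennreal ((cal_h_norm D A s (proj_ge D A \<kappa> q, proj_ge D A \<kappa> p))\<^sup>2)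
      = J (\<lambda>l. indicator {\<kappa>\<^sup>2..} l * (1 + l) powr (s - 1)) (sqrt_op D A q)
        + J (\<lambda>l. indicator {\<kappa>\<^sup>2..} l * (1 + l) powr (s - 1)) p"
proof -
  have le: "J (\<lambda>l. indicator {\<kappa>\<^sup>2..} l * (1 + l) powr (s - 1)) x \<le> J (\<lambda>l. (1 + l) powr (s - 1)) x" for x
    by (rule J_mono) (simp add: indicator_def)
  show mem: "(proj_ge D A \<kappa> q, proj_ge D A \<kappa> p) \<in> cal_h D A s"
    using assms sqrt_op_proj_ge[of q \<kappa>] le_less_trans[OF le]
    by (auto simp: cal_h_def sob_dom_iff J_proj_ge)
  show "ennreal ((cal_h_norm D A s (proj_ge D A \<kappa> q, proj_ge D A \<kappa> p))\<^sup>2)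
      = J (\<lambda>l. indicator {\<kappa>\<^sup>2..} l * (1 + l) powr (s - 1)) (sqrt_op D A q)
        + J (\<lambda>l. indicator {\<kappa>\<^sup>2..} l * (1 + l) powr (s - 1)) p"
    using assms by (simp add: cal_h_norm_J[OF mem] cal_h_def sqrt_op_proj_ge J_proj_ge)
qed

lemma D_iff_J: "q \<in> D \<longleftrightarrow> J (\<lambda>l. l\<^sup>2) q < \<infinity>"
  by (simp add: D_iff pvm_dom_iff_J)

lemma norm_A_J: "q \<in> D \<Longrightarrow> ennreal ((norm (A q))\<^sup>2) = J (\<lambda>l. l\<^sup>2) q"
  using norm_pvm_fun_J[of "\<lambda>l. l" q] by (simp add: D_iff A_eq)

text \<open>In spectral terms, l^2 \<le> l (1 + l). It makes A q a continuous X-valued function of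
  time for solutions with s = 2.\<close>

lemma norm_A_le_sob_norm:
  assumes q: "q \<in> sqrt_dom D A" "sqrt_op D A q \<in> sob_dom D A 1"
  shows "q \<in> D" "norm (A q) \<le> sob_norm D A 1 (sqrt_op D A q)"
proof -
  have le: "J (\<lambda>l. l\<^sup>2) q \<le> J (\<lambda>l. (1 + l) powr 1) (sqrt_op D A q)"
    using q by (subst J_sqrt_op) (auto intro!: J_mono mult_left_mono simp: power2_eq_square)
  then show qD: "q \<in> D" using q(2) by (auto simp: D_iff_J sob_dom_iff intro: le_less_trans)
  have "ennreal ((norm (A q))\<^sup>2) \<le> ennreal ((sob_norm D A 1 (sqrt_op D A q))\<^sup>2)"
    using le by (simp only: norm_A_J[OF qD] sob_norm_J[OF q(2)])
  then show "norm (A q) \<le> sob_norm D A 1 (sqrt_op D A q)"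
    using sob_norm_nonneg[of 1 "sqrt_op D A q"] power2_le_imp_le by (simp only: ennreal_le_iff zero_le_power2)
qed

lemma hs_norm_const: "hs_norm D A s (\<lambda>n. x) = sob_norm D A s x"
  by (simp add: hs_norm_def)

text \<open>A commutes with spectral truncation. For s = 2 the completed norm is a limit of X-norms,
  so this replaces the representing sequence by the vector A q.\<close>

lemma hs_A_LIMSEQ:
  assumes q: "q \<in> D"
  shows "hs_A D A q \<longlonglongrightarrow> A q"
proof -
  have id: "(\<lambda>l::real. l) \<in> borel_measurable borel" by simp
  have b: "bounded_borel (indicator {..real n})" for n by (rule bounded_borel_indicator) simp
  have "hs_A D A q = (\<lambda>n. pvm_bounded E (indicator {..real n}) (A q))"
  proof
    fix n
    let ?y = "pvm_bounded E (indicator {..real n}) q"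
    have "?y \<in> D" "A ?y = pvm_bounded E (indicator {..real n}) (A q)"
      using pvm_bounded_pvm_fun[OF pvm_E id b, of q n] q A_eq[of ?y] A_eq[of q] by (simp_all add: D_iff)
    then show "hs_A D A q n = pvm_bounded E (indicator {..real n}) (A q)"
      by (simp add: hs_A_def fun_op_eq pvm_fun_bounded[OF pvm_E b])
  qed
  also have "\<dots> \<longlonglongrightarrow> pvm_bounded E (\<lambda>_. 1) (A q)"
  proof (rule pvm_bounded_lim[OF pvm_E b _, where C=1])
    fix t :: real
    obtain N where "t \<le> real N" using real_arch_simple by blast
    then show "(\<lambda>n. indicator {..real n} t :: real) \<longlonglongrightarrow> 1"
      by (intro tendsto_eventually eventually_sequentiallyI[of N]) (auto simp: indicator_def)
  qed (auto simp: indicator_def)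
  also have "pvm_bounded E (\<lambda>_. 1) (A q) = A q"
    using pvm_bounded_indicator[OF pvm_E borel_open[OF open_UNIV], of "A q"] pvm_UNIV[OF pvm_E]
    by simp
  finally show ?thesis .
qed

text \<open>For s = 2 the space H^(s-2) is X, so the equation becomes an ordinary differential
  equation in X with A q continuous. The a priori estimates are all run on this form.\<close>

lemma solution_regular:
  assumes sol: "cal_h_solution D A 2 I q p"
  shows "\<And>t. t \<in> I \<Longrightarrow> q t \<in> sqrt_dom D A"
    and "\<And>t. t \<in> I \<Longrightarrow> q t \<in> D"
    and "\<And>t. t \<in> I \<Longrightarrow> ((\<lambda>\<tau>. A (q \<tau>)) \<longlongrightarrow> A (q t)) (at t within I)"
    and "\<And>t. t \<in> I \<Longrightarrow> (q has_vector_derivative p t) (at t within I)"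
    and "\<And>t. t \<in> I \<Longrightarrow> (p has_vector_derivative - (kcoef D A (q t))\<^sup>2 *\<^sub>R A (q t)) (at t within I)"
proof -
  have mem: "q t \<in> sqrt_dom D A" "sqrt_op D A (q t) \<in> sob_dom D A 1" if "t \<in> I" for t
    using sol that unfolding cal_h_solution_def cal_h_def by auto
  show sq: "q t \<in> sqrt_dom D A" if "t \<in> I" for t using mem that by blast
  show qD: "q t \<in> D" if "t \<in> I" for t using norm_A_le_sob_norm(1)[OF mem[OF that]] .
  show "((\<lambda>\<tau>. A (q \<tau>)) \<longlongrightarrow> A (q t)) (at t within I)" if t: "t \<in> I" for t
  proof (rule LIM_zero_cancel, rule Lim_null_comparison)
    have "hs_continuous_on D A 1 I (\<lambda>t. hs_of (sqrt_op D A (q t)))"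
      using sol unfolding cal_h_solution_def by simp
    then show "((\<lambda>\<tau>. sob_norm D A 1 (sqrt_op D A (q \<tau>) - sqrt_op D A (q t))) \<longlongrightarrow> 0) (at t within I)"
      using t unfolding hs_continuous_on_def by (simp add: hs_of_def hs_norm_const)
    have "norm (A (q \<tau>) - A (q t)) \<le> sob_norm D A 1 (sqrt_op D A (q \<tau>) - sqrt_op D A (q t))"
      if \<tau>: "\<tau> \<in> I" for \<tau>
      using norm_A_le_sob_norm(2)[of "q \<tau> - q t"] sqrt_op_diff[OF sq[OF \<tau>] sq[OF t]]
        sob_dom_diff[OF mem(2)[OF \<tau>] mem(2)[OF t]] A_diff[OF qD[OF \<tau>] qD[OF t]] by simp
    then show "\<forall>\<^sub>F \<tau> in at t within I. norm (A (q \<tau>) - A (q t)) \<le> sob_norm D A 1 (sqrt_op D A (q \<tau>) - sqrt_op D A (q t))"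
      by (simp add: eventually_at_filter)
  qed
  show "(q has_vector_derivative p t) (at t within I)" if "t \<in> I" for t
    using sol that unfolding cal_h_solution_def by blast
  show "(p has_vector_derivative - (kcoef D A (q t))\<^sup>2 *\<^sub>R A (q t)) (at t within I)" if t: "t \<in> I" for t
  proof -
    let ?c = "- (kcoef D A (q t))\<^sup>2"
    have "hs_norm D A 0 (\<lambda>n. x - ?c *\<^sub>R hs_A D A (q t) n) = norm (x - ?c *\<^sub>R A (q t))" for x
      unfolding hs_norm_def sob_norm_zero by (intro limI tendsto_intros hs_A_LIMSEQ qD t)
    moreover have "((\<lambda>\<tau>. hs_norm D A 0 (\<lambda>n. (p \<tau> - p t) /\<^sub>R (\<tau> - t) - ?c *\<^sub>R hs_A D A (q t) n)) \<longlongrightarrow> 0) (at t within I)"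
      using sol t unfolding cal_h_solution_def hs_C1_deriv_on_def by (simp add: hs_of_def)
    ultimately show ?thesis unfolding has_vector_derivative_iff_quotient by (simp only:)
  qed
qed

end

section \<open>The conserved quantity\<close>

text \<open>Reversing a to N - 1 - a identifies the mixed sums; what remains is the difference of
  two sums related by an index shift, so only boundary terms survive.\<close>

lemma telescoped_bracket:
  fixes U V :: "nat \<Rightarrow> real"
  shows "(\<Sum>a<N. - (2 * U (Suc a) * (V (N - Suc a) - V (N - a))) + V (Suc a) * (U (N - Suc a) - U (N - a))
      + (U a - U (Suc a)) * V (N - a)) = 2 * (U 0 * V N - U N * V 0)"
proof -
  have swap: "(\<Sum>a<N. f a) = (\<Sum>a<N. f (N - Suc a))" for f :: "nat \<Rightarrow> real"
    by (rule sum.nat_diff_reindex[symmetric])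
  have Suc_diff: "Suc (N - Suc a) = N - a" "N - (N - Suc a) = Suc a" if "a < N" for a using that by auto
  have 1: "(\<Sum>a<N. V (Suc a) * U (N - a)) = (\<Sum>a<N. U (Suc a) * V (N - a))"
    by (subst swap) (auto intro!: sum.cong simp: Suc_diff)
  have 2: "(\<Sum>a<N. V (Suc a) * U (N - Suc a)) = (\<Sum>a<N. U a * V (N - a))"
    by (subst swap) (auto intro!: sum.cong simp: Suc_diff)
  have 3: "(\<Sum>a<N. U a * V (N - a)) + U N * V 0 = (\<Sum>a<N. U (Suc a) * V (N - Suc a)) + U 0 * V N"
    using sum.lessThan_Suc[of "\<lambda>a. U a * V (N - a)" N] sum.lessThan_Suc_shift[of "\<lambda>a. U a * V (N - a)" N] by simp
  have "(\<Sum>a<N. - (2 * U (Suc a) * (V (N - Suc a) - V (N - a))) + V (Suc a) * (U (N - Suc a) - U (N - a))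
      + (U a - U (Suc a)) * V (N - a))
    = - 2 * (\<Sum>a<N. U (Suc a) * V (N - Suc a)) + 2 * (\<Sum>a<N. U (Suc a) * V (N - a))
      + (\<Sum>a<N. V (Suc a) * U (N - Suc a)) - (\<Sum>a<N. V (Suc a) * U (N - a))
      + (\<Sum>a<N. U a * V (N - a)) - (\<Sum>a<N. U (Suc a) * V (N - a))"
    by (simp add: sum_distrib_left sum.distrib[symmetric] sum_subtractf[symmetric] algebra_simps)
  then show ?thesis using 1 2 3 by simp
qed

text \<open>
  With \<open>B = A(A + z)\<^sup>-\<^sup>1\<close>, the functions below stand for \<open>P\<^sub>a = \<langle>p, B\<^sup>ap\<rangle>\<close>, \<open>Q\<^sub>a = \<langle>q, B\<^sup>aq\<rangle>\<close>,
  \<open>S\<^sub>a = \<langle>p, B\<^sup>aq\<rangle>\<close>, \<open>V\<^sub>a = \<langle>Aq, B\<^sup>aq\<rangle>\<close> and \<open>U\<^sub>a = \<langle>Aq, B\<^sup>ap\<rangle>\<close>. For discrete spectrum the conserved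
  quantity is the combination \<open>\<Sum>\<^sub>k (\<lambda>\<^sub>k/(\<lambda>\<^sub>k + z))\<^sup>N F\<^sub>k\<close> of the Uhlenbeck integrals
  \<open>F\<^sub>k = p\<^sub>k\<^sup>2 + c \<lambda>\<^sub>k q\<^sub>k\<^sup>2 + \<Sum>\<^sub>j\<^sub>\<noteq>\<^sub>k \<lambda>\<^sub>j \<lambda>\<^sub>k (p\<^sub>jq\<^sub>k - q\<^sub>jp\<^sub>k)\<^sup>2 / (\<lambda>\<^sub>k - \<lambda>\<^sub>j)\<close>.
\<close>

definition kirchhoff_integral ::
    "real \<Rightarrow> nat \<Rightarrow> real \<Rightarrow> (nat \<Rightarrow> real) \<Rightarrow> (nat \<Rightarrow> real) \<Rightarrow> (nat \<Rightarrow> real) \<Rightarrow> (nat \<Rightarrow> real) \<Rightarrow> real" where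
  "kirchhoff_integral z N c P Q S V =
     P N + c * V N + z * (\<Sum>a<N. P (Suc a) * Q (N - a) - S (Suc a) * S (N - a))"

text \<open>The relations for z Q and z S express z B^(a+1) = A B^a - A B^(a+1). They remove z from
  the terms with c^2 in the derivative of the sum, which telescope to 2 c^2 (U_0 V_N - U_N V_0). The
  part with U_0 V_N cancels the derivative of c, and the rest is 2 U_N (c - c^2 (1 + V_0)) = 0: here
  the special form of c enters.\<close>

lemma kirchhoff_integral_deriv:
  fixes P Q S V U :: "nat \<Rightarrow> real \<Rightarrow> real"
  assumes dP: "\<And>a. (P a has_real_derivative - 2 * (c t)\<^sup>2 * U a t) (at t within I)"
    and dQ: "\<And>a. (Q a has_real_derivative 2 * S a t) (at t within I)"
    and dS: "\<And>a. (S a has_real_derivative P a t - (c t)\<^sup>2 * V a t) (at t within I)"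
    and dV: "\<And>a. (V a has_real_derivative 2 * U a t) (at t within I)"
    and c: "\<And>t. c t = 1 / (1 + V 0 t)" and V0: "0 \<le> V 0 t"
    and zQ: "\<And>a. z * Q (Suc a) t = V a t - V (Suc a) t"
    and zS: "\<And>a. z * S (Suc a) t = U a t - U (Suc a) t"
  shows "((\<lambda>t. kirchhoff_integral z N (c t) (\<lambda>a. P a t) (\<lambda>a. Q a t) (\<lambda>a. S a t) (\<lambda>a. V a t))
    has_real_derivative 0) (at t within I)"
proof -
  have dc: "(c has_real_derivative - (c t)\<^sup>2 * (2 * U 0 t)) (at t within I)"
    unfolding c[abs_def] using V0
    by (auto intro!: derivative_eq_intros dV simp: power2_eq_square divide_simps)
  let ?p = "\<lambda>a. P a t" and ?q = "\<lambda>a. Q a t" and ?s = "\<lambda>a. S a t" and ?v = "\<lambda>a. V a t" and ?u = "\<lambda>a. U a t"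
  let ?dterm = "\<lambda>a. (- 2 * (c t)\<^sup>2 * ?u (Suc a)) * ?q (N - a) + (2 * ?s (N - a)) * ?p (Suc a)
    - ((?p (Suc a) - (c t)\<^sup>2 * ?v (Suc a)) * ?s (N - a) + (?p (N - a) - (c t)\<^sup>2 * ?v (N - a)) * ?s (Suc a))"
  have "((\<lambda>t. kirchhoff_integral z N (c t) (\<lambda>a. P a t) (\<lambda>a. Q a t) (\<lambda>a. S a t) (\<lambda>a. V a t))
    has_real_derivative - 2 * (c t)\<^sup>2 * ?u N + ((- (c t)\<^sup>2 * (2 * ?u 0)) * ?v N + (2 * ?u N) * c t)
      + z * (\<Sum>a<N. ?dterm a)) (at t within I)"
    unfolding kirchhoff_integral_def
    by (intro DERIV_add DERIV_mult DERIV_cmult DERIV_sum DERIV_diff dP dQ dS dV dc)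
  moreover have "z * (\<Sum>a<N. ?dterm a) = (c t)\<^sup>2 * (2 * (?u 0 * ?v N - ?u N * ?v 0))"
  proof -
    have "z * (\<Sum>a<N. ?dterm a)
        = (\<Sum>a<N. (c t)\<^sup>2 * (- (2 * ?u (Suc a) * (?v (N - Suc a) - ?v (N - a))) + ?v (Suc a) * (?u (N - Suc a) - ?u (N - a))
          + (?u a - ?u (Suc a)) * ?v (N - a)) + z * (?s (N - a) * ?p (Suc a) - ?p (N - a) * ?s (Suc a)))"
      unfolding sum_distrib_left
    proof (rule sum.cong[OF refl])
      fix a assume "a \<in> {..<N}"
      then have Na: "N - a = Suc (N - Suc a)" by simp
      have q: "z * ?q (N - a) = ?v (N - Suc a) - ?v (N - a)" unfolding Na using zQ[of "N - Suc a"] .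
      have s: "z * ?s (N - a) = ?u (N - Suc a) - ?u (N - a)" unfolding Na using zS[of "N - Suc a"] .
      have "z * ?dterm a = (c t)\<^sup>2 * (- (2 * ?u (Suc a) * (z * ?q (N - a))) + ?v (Suc a) * (z * ?s (N - a))
          + (z * ?s (Suc a)) * ?v (N - a)) + z * (?s (N - a) * ?p (Suc a) - ?p (N - a) * ?s (Suc a))"
        by (simp add: algebra_simps)
      then show "z * ?dterm a = (c t)\<^sup>2 * (- (2 * ?u (Suc a) * (?v (N - Suc a) - ?v (N - a))) + ?v (Suc a) * (?u (N - Suc a) - ?u (N - a))
          + (?u a - ?u (Suc a)) * ?v (N - a)) + z * (?s (N - a) * ?p (Suc a) - ?p (N - a) * ?s (Suc a))"
        unfolding q s zS .
    qed
    also have "\<dots> = (c t)\<^sup>2 * (2 * (?u 0 * ?v N - ?u N * ?v 0))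
        + z * ((\<Sum>a<N. ?s (N - a) * ?p (Suc a)) - (\<Sum>a<N. ?p (N - a) * ?s (Suc a)))"
      unfolding telescoped_bracket[of "\<lambda>a. U a t" "\<lambda>a. V a t" N, symmetric]
      by (simp only: sum.distrib sum_distrib_left[symmetric] sum_subtractf)
    \<comment> \<open>The terms without c^2 cancel under the same reversal.\<close>
    also have "(\<Sum>a<N. ?s (N - a) * ?p (Suc a)) = (\<Sum>a<N. ?p (N - a) * ?s (Suc a))"
      by (subst sum.nat_diff_reindex[symmetric]) (auto intro!: sum.cong simp: Suc_diff_Suc)
    finally show ?thesis by simp
  qed
  moreover have "- 2 * (c t)\<^sup>2 * ?u N + ((- (c t)\<^sup>2 * (2 * ?u 0)) * ?v N + (2 * ?u N) * c t)
      + (c t)\<^sup>2 * (2 * (?u 0 * ?v N - ?u N * ?v 0)) = 0"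
  proof -
    have "c t * (1 + ?v 0) = 1" using c[of t] V0 by simp
    then have "(c t)\<^sup>2 * (1 + ?v 0) = c t" by (simp add: power2_eq_square)
    then have "2 * ?u N * ((c t)\<^sup>2 * (1 + ?v 0)) = 2 * ?u N * c t" by simp
    then show ?thesis by (simp add: algebra_simps)
  qed
  ultimately show ?thesis by simp
qed

lemma mult_le_of_square_le:
  fixes s s' :: real
  assumes "s\<^sup>2 \<le> p * q" "s'\<^sup>2 \<le> p' * q'" "0 \<le> p" "0 \<le> q" "0 \<le> p'" "0 \<le> q'"
  shows "2 * \<bar>s * s'\<bar> \<le> p * q' + p' * q"
proof -
  have "(2 * \<bar>s * s'\<bar>)\<^sup>2 = 4 * (s\<^sup>2 * s'\<^sup>2)" by (simp add: power_mult_distrib)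
  also have "\<dots> \<le> 4 * ((p * q) * (p' * q'))" using assms by (simp add: mult_mono)
  also have "\<dots> = 4 * ((p * q') * (p' * q))" by simp
  also have "\<dots> \<le> (p * q' + p' * q)\<^sup>2"
    using zero_le_power2[of "p * q' - p' * q"] by (simp add: power2_eq_square algebra_simps)
  finally show ?thesis by (rule power2_le_imp_le) (use assms in simp)
qed

text \<open>Cauchy-Schwarz for each index, with a paired with N - 1 - a, bounds the sum of |S S| by
  the sum of P Q. This replaces the squares (p_j q_k - q_j p_k)^2 where no eigenbasis is at
  hand.\<close>

lemma kirchhoff_integral_bounds:
  fixes P Q S V :: "nat \<Rightarrow> real"
  assumes nonneg: "\<And>a. 0 \<le> P a" "\<And>a. 0 \<le> Q a" and CS: "\<And>a. (S a)\<^sup>2 \<le> P a * Q a" and z: "0 \<le> z"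
  shows "P N + c * V N \<le> kirchhoff_integral z N c P Q S V"
    and "kirchhoff_integral z N c P Q S V \<le> P N + c * V N + 2 * (\<Sum>a<N. P (Suc a) * (z * Q (N - a)))"
proof -
  have sw: "(\<Sum>a<N. P (N - a) * Q (Suc a)) = (\<Sum>a<N. P (Suc a) * Q (N - a))"
    by (subst sum.nat_diff_reindex[symmetric]) (auto intro!: sum.cong simp: Suc_diff_Suc)
  have "(\<Sum>a<N. 2 * \<bar>S (Suc a) * S (N - a)\<bar>) \<le> (\<Sum>a<N. P (Suc a) * Q (N - a) + P (N - a) * Q (Suc a))"
    by (intro sum_mono mult_le_of_square_le CS nonneg)
  then have abs: "(\<Sum>a<N. \<bar>S (Suc a) * S (N - a)\<bar>) \<le> (\<Sum>a<N. P (Suc a) * Q (N - a))"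
    by (simp add: sum.distrib sw sum_distrib_left[symmetric])
  moreover have "\<bar>\<Sum>a<N. S (Suc a) * S (N - a)\<bar> \<le> (\<Sum>a<N. \<bar>S (Suc a) * S (N - a)\<bar>)" by (rule sum_abs)
  ultimately have le: "\<bar>\<Sum>a<N. S (Suc a) * S (N - a)\<bar> \<le> (\<Sum>a<N. P (Suc a) * Q (N - a))"
    by (meson order_trans)
  then show "P N + c * V N \<le> kirchhoff_integral z N c P Q S V"
    using z unfolding kirchhoff_integral_def sum_subtractf by simp
  have "z * ((\<Sum>a<N. P (Suc a) * Q (N - a)) - (\<Sum>a<N. S (Suc a) * S (N - a)))
      \<le> z * (2 * (\<Sum>a<N. P (Suc a) * Q (N - a)))"
    using le z by (intro mult_left_mono) auto
  also have "\<dots> = 2 * (\<Sum>a<N. P (Suc a) * (z * Q (N - a)))"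
    by (simp add: sum_distrib_left mult_ac)
  finally show "kirchhoff_integral z N c P Q S V \<le> P N + c * V N + 2 * (\<Sum>a<N. P (Suc a) * (z * Q (N - a)))"
    unfolding kirchhoff_integral_def sum_subtractf by simp
qed

text \<open>The symbol of A (A + z)^-1, which suppresses frequencies below z; extended by 0 to
  negative l, where l + z could vanish, so that it stays in [0, 1].\<close>

definition low_cut :: "real \<Rightarrow> real \<Rightarrow> real" where
  "low_cut z l = (if 0 \<le> l then l / (l + z) else 0)"

lemma low_cut_bounds: "0 < z \<Longrightarrow> 0 \<le> low_cut z l" "0 < z \<Longrightarrow> low_cut z l \<le> 1"
  by (simp_all add: low_cut_def)

lemma low_cut_measurable [measurable]: "low_cut z \<in> borel_measurable borel"
  unfolding low_cut_def by measurable

text \<open>The smaller of x and y may be replaced by the larger.\<close>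

lemma power_prod_le: 
  fixes x y :: real
  assumes "0 \<le> x" "x \<le> 1" "0 \<le> y" "y \<le> 1"
  shows "x ^ i * y ^ j \<le> x ^ (i + j) + y ^ (i + j)"
proof (cases "x \<le> y")
  case True
  then have "x ^ i * y ^ j \<le> y ^ i * y ^ j" using assms by (intro mult_right_mono power_mono) auto
  then show ?thesis
    unfolding power_add using assms by (intro add_increasing mult_nonneg_nonneg zero_le_power) auto
next
  case False
  then have "x ^ i * y ^ j \<le> x ^ i * x ^ j" using assms by (intro mult_left_mono power_mono) auto
  then show ?thesis
    unfolding power_add using assms by (intro add_increasing2 mult_nonneg_nonneg zero_le_power) auto
qed

section \<open>Quadratic forms of the powers of A (A + z)^-1\<close>

context nonneg_self_adjoint
begin

definition B :: "real \<Rightarrow> nat \<Rightarrow> 'a \<Rightarrow> 'a" where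
  "B z a = pvm_bounded E (\<lambda>l. low_cut z l ^ a)"

context
  fixes z :: real
  assumes z: "0 < z"
begin

lemma low_cut_power_bounded: "bounded_borel (\<lambda>l. low_cut z l ^ a)"
  using low_cut_bounds[OF z] by (intro bounded_borel_power bounded_borelI[where C=1]) auto

lemma B_bounded_linear: "bounded_linear (B z a)"
  unfolding B_def by (rule pvm_bounded_bounded_linear[OF pvm_E low_cut_power_bounded])

lemma B_sym: "B z a x \<bullet> y = x \<bullet> B z a y"
  unfolding B_def by (rule pvm_bounded_sym[OF pvm_E low_cut_power_bounded])

lemma B_0: "B z 0 x = x"
  using pvm_bounded_indicator[OF pvm_E borel_open[OF open_UNIV], of x] pvm_UNIV[OF pvm_E]
  by (simp add: B_def)

lemma B_A:
  assumes "x \<in> D"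
  shows "B z a x \<in> D" "A (B z a x) = B z a (A x)"
  using pvm_bounded_pvm_fun[OF pvm_E _ low_cut_power_bounded, of "\<lambda>l. l" x a] assms
    A_eq[of x] A_eq[of "B z a x"]
  unfolding B_def by (simp_all add: D_iff)

lemma A_B_swap: "x \<in> D \<Longrightarrow> y \<in> D \<Longrightarrow> A x \<bullet> B z a y = A y \<bullet> B z a x"
  using A_sym[of x "B z a y"] B_A[of y a] B_sym[of a x "A y"] by (simp add: inner_commute)

text \<open>With b = l/(l + z) one has l (1 - b) = z b. The proof uses the function b^a - b^(a+1),
  which stays bounded after multiplication by l.\<close>

lemma B_Suc:
  assumes x: "x \<in> D"
  shows "z *\<^sub>R B z (Suc a) x = B z a (A x) - B z (Suc a) (A x)"
proof -
  let ?g = "\<lambda>l. indicator {0..} l * (low_cut z l ^ a - low_cut z l ^ Suc a)"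
  have id: "(\<lambda>l::real. l) \<in> borel_measurable borel" by simp
  have g: "bounded_borel ?g"
    by (intro bounded_borel_mult bounded_borel_diff low_cut_power_bounded bounded_borel_indicator) simp
  have lg: "(\<lambda>l. l * ?g l) = (\<lambda>l. z * low_cut z l ^ Suc a)"
  proof
    fix l
    show "l * ?g l = z * low_cut z l ^ Suc a"
    proof (cases "0 \<le> l")
      case True
      then have "l * (1 - low_cut z l) = z * low_cut z l" using z by (simp add: low_cut_def field_simps)
      then have "l * (1 - low_cut z l) * low_cut z l ^ a = z * low_cut z l * low_cut z l ^ a" by simp
      then show ?thesis using True by (simp add: algebra_simps)
    qed (simp add: low_cut_def)
  qed
  have lgb: "bounded_borel (\<lambda>l. l * ?g l)" unfolding lg by (intro bounded_borel_scale low_cut_power_bounded)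
  have "pvm_bounded E ?g x = pvm_bounded E (\<lambda>l. low_cut z l ^ a - low_cut z l ^ Suc a) x"
    using AE_nonneg[of x]
    by (intro pvm_bounded_cong_AE[OF pvm_E g bounded_borel_diff[OF low_cut_power_bounded low_cut_power_bounded]])
      (auto elim!: eventually_mono)
  also have "\<dots> = B z a x - B z (Suc a) x"
    unfolding B_def by (rule pvm_bounded_diff[OF pvm_E low_cut_power_bounded low_cut_power_bounded])
  finally have gx: "pvm_bounded E ?g x = B z a x - B z (Suc a) x" .
  have "A (pvm_bounded E ?g x) = pvm_bounded E (\<lambda>l. l * ?g l) x"
    using pvm_fun_pvm_bounded[OF pvm_E id g lgb, of x] A_eq[of "pvm_bounded E ?g x"] by (simp add: D_iff)
  also have "\<dots> = z *\<^sub>R B z (Suc a) x"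
    unfolding lg B_def by (rule pvm_bounded_scale[OF pvm_E low_cut_power_bounded])
  finally show ?thesis unfolding gx using A_diff[OF B_A(1)[OF x] B_A(1)[OF x]] B_A(2)[OF x] by simp
qed

text \<open>B^a is the square of a bounded symmetric operator, so its form is an inner product;
  positivity and Cauchy-Schwarz follow.\<close>

lemma B_form_eq: "x \<bullet> B z a y = pvm_bounded E (\<lambda>l. sqrt (low_cut z l) ^ a) x \<bullet> pvm_bounded E (\<lambda>l. sqrt (low_cut z l) ^ a) y"
proof -
  have s: "bounded_borel (\<lambda>l. sqrt (low_cut z l) ^ a)"
    using low_cut_bounds[OF z] by (intro bounded_borel_power bounded_borelI[where C=1]) auto
  have "pvm_bounded E (\<lambda>l. sqrt (low_cut z l) ^ a) (pvm_bounded E (\<lambda>l. sqrt (low_cut z l) ^ a) y) = B z a y"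
    using low_cut_bounds[OF z] by (simp add: pvm_bounded_mult[OF pvm_E s s] B_def power_mult_distrib[symmetric])
  then show ?thesis using pvm_bounded_sym[OF pvm_E s] by metis
qed

lemma B_nonneg: "0 \<le> x \<bullet> B z a x"
  and B_Cauchy_Schwarz: "(x \<bullet> B z a y)\<^sup>2 \<le> (x \<bullet> B z a x) * (y \<bullet> B z a y)"
  unfolding B_form_eq by (rule inner_ge_zero, rule Cauchy_Schwarz_ineq)

lemma B_integral: "x \<bullet> B z a x = (\<integral>l. low_cut z l ^ a \<partial>pvm_measure E x)"
  unfolding B_def using pvm_bounded_inner[OF pvm_E low_cut_power_bounded, of a x x]
  by (simp add: inner_commute pvm_form_bilinear(4)[OF pvm_E low_cut_power_bounded])

lemma J_B: "J (\<lambda>l. low_cut z l ^ a) x = ennreal (x \<bullet> B z a x)"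
  unfolding B_integral using low_cut_bounds[OF z] by (intro J_bounded_integral low_cut_power_bounded) simp

lemma A_B_integral:
  assumes "x \<in> D"
  shows "integrable (pvm_measure E x) (\<lambda>l. l * low_cut z l ^ a)"
    and "A x \<bullet> B z a x = (\<integral>l. l * low_cut z l ^ a \<partial>pvm_measure E x)"
  using pvm_fun_inner[OF pvm_E _ _ low_cut_power_bounded, of "\<lambda>l. l" x a] assms A_eq[OF assms]
  unfolding B_def by (simp_all add: D_iff)

lemma J_sqrt_B:
  assumes "x \<in> D" "x \<in> sqrt_dom D A"
  shows "J (\<lambda>l. low_cut z l ^ a) (sqrt_op D A x) = ennreal (A x \<bullet> B z a x)"
proof -
  have "J (\<lambda>l. low_cut z l ^ a) (sqrt_op D A x) = J (\<lambda>l. l * low_cut z l ^ a) x"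
    using assms(2) by (rule J_sqrt_op) measurable
  also have "\<dots> = ennreal (A x \<bullet> B z a x)"
    unfolding J_def A_B_integral(2)[OF assms(1)] using AE_nonneg[of x] low_cut_bounds[OF z]
    by (intro nn_integral_eq_integral A_B_integral[OF assms(1)]) (auto elim!: eventually_mono)
  finally show ?thesis .
qed

lemma A_B_nonneg: "x \<in> D \<Longrightarrow> 0 \<le> A x \<bullet> B z a x"
  unfolding A_B_integral(2) using AE_nonneg[of x] low_cut_bounds[OF z]
  by (intro integral_nonneg_AE) (auto elim!: eventually_mono)

lemma sqrt_op_norm:
  assumes "x \<in> D" "x \<in> sqrt_dom D A"
  shows "(norm (sqrt_op D A x))\<^sup>2 = A x \<bullet> x"
  using J_sqrt_B[OF assms, of 0] A_nonneg[OF assms(1)] by (simp add: J_one B_0 inner_commute)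

text \<open>This is \<open>x\<^sup>i y\<^sup>j \<le> x\<^sup>N + y\<^sup>N\<close>, \<open>i + j = N\<close>, integrated against two spectral measures.\<close>

lemma B_interpolation:
  assumes "y \<in> D" "i + j = N"
  shows "(x \<bullet> B z i x) * (A y \<bullet> B z j y) \<le> (x \<bullet> B z N x) * (A y \<bullet> y) + (x \<bullet> x) * (A y \<bullet> B z N y)"
proof -
  note lc = low_cut_bounds[OF z]
  \<comment> \<open>The first integration, over the spectral measure of x with l fixed; the second
    weights the result by l, which produces the forms of A y.\<close>
  have inner: "(x \<bullet> B z i x) * low_cut z l ^ j \<le> (x \<bullet> B z N x) + low_cut z l ^ N * (x \<bullet> x)" for l
  proof -
    have int: "integrable (pvm_measure E x) (\<lambda>m. low_cut z m ^ a)" for a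
      by (rule pvm_integrable[OF pvm_E low_cut_power_bounded])
    have "(x \<bullet> B z i x) * low_cut z l ^ j = (\<integral>m. low_cut z m ^ i * low_cut z l ^ j \<partial>pvm_measure E x)"
      by (simp add: B_integral)
    also have "\<dots> \<le> (\<integral>m. low_cut z m ^ N + low_cut z l ^ N \<partial>pvm_measure E x)"
    proof (rule integral_mono)
      show "integrable (pvm_measure E x) (\<lambda>m. low_cut z m ^ i * low_cut z l ^ j)"
        by (intro integrable_mult_left int)
      show "integrable (pvm_measure E x) (\<lambda>m. low_cut z m ^ N + low_cut z l ^ N)"
        by (intro Bochner_Integration.integrable_add int finite_measure.integrable_const[OF finite_measure_pvm[OF pvm_E]])
      show "low_cut z m ^ i * low_cut z l ^ j \<le> low_cut z m ^ N + low_cut z l ^ N" for m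
        unfolding assms(2)[symmetric] by (rule power_prod_le[OF lc lc])
    qed
    also have "\<dots> = (x \<bullet> B z N x) + low_cut z l ^ N * (x \<bullet> x)"
      using Bochner_Integration.integral_add[OF int[of N]
          finite_measure.integrable_const[OF finite_measure_pvm[OF pvm_E], of x "low_cut z l ^ N"]]
        pvm_measure_total[OF pvm_E, of x]
      by (simp add: B_integral power2_norm_eq_inner mult.commute)
    finally show ?thesis .
  qed
  have int: "integrable (pvm_measure E y) (\<lambda>l. l * low_cut z l ^ a)" for a
    by (rule A_B_integral(1)[OF assms(1)])
  then have int0: "integrable (pvm_measure E y) (\<lambda>l. l)" using int[of 0] by simp
  have "(x \<bullet> B z i x) * (A y \<bullet> B z j y) = (\<integral>l. l * ((x \<bullet> B z i x) * low_cut z l ^ j) \<partial>pvm_measure E y)"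
    unfolding A_B_integral(2)[OF assms(1)] Bochner_Integration.integral_mult_right_zero[symmetric]
    by (simp only: mult.left_commute)
  also have "\<dots> \<le> (\<integral>l. (x \<bullet> B z N x) * l + (x \<bullet> x) * (l * low_cut z l ^ N) \<partial>pvm_measure E y)"
  proof (rule integral_mono_AE)
    show "integrable (pvm_measure E y) (\<lambda>l. l * ((x \<bullet> B z i x) * low_cut z l ^ j))"
      using integrable_mult_right[OF int[of j], of "x \<bullet> B z i x"] by (simp only: mult.left_commute)
    show "AE l in pvm_measure E y. l * ((x \<bullet> B z i x) * low_cut z l ^ j) \<le> (x \<bullet> B z N x) * l + (x \<bullet> x) * (l * low_cut z l ^ N)"
      using AE_nonneg[of y]
    proof eventually_elim
      fix l :: real assume "0 \<le> l"
      from mult_left_mono[OF inner[of l] this]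
      show "l * ((x \<bullet> B z i x) * low_cut z l ^ j) \<le> (x \<bullet> B z N x) * l + (x \<bullet> x) * (l * low_cut z l ^ N)"
        by (simp add: algebra_simps)
    qed
  qed (use int0 int[of N] in simp)
  also have "\<dots> = (x \<bullet> B z N x) * (A y \<bullet> y) + (x \<bullet> x) * (A y \<bullet> B z N y)"
    using int0 int[of N] A_B_integral(2)[OF assms(1), of 0] A_B_integral(2)[OF assms(1), of N] by (simp add: B_0)
  finally show ?thesis .
qed

end

end

section \<open>Dyadic summation and the a priori estimate\<close>

text \<open>The 4 comes from squaring (l + z)^\<beta> \<ge> (l^\<beta> + z^\<beta>)/2, and
  2^\<beta>/(2^\<beta> - 1) from writing each scale as a telescoping difference.\<close>

definition dyadic_const :: "real \<Rightarrow> real" where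
  "dyadic_const \<beta> = 4 * 2 powr \<beta> / (2 powr \<beta> - 1)"

lemma dyadic_const_nonneg: "0 < \<beta> \<Longrightarrow> 0 \<le> dyadic_const \<beta>"
  unfolding dyadic_const_def using powr_mono[of 0 \<beta> "2::real"] by (intro divide_nonneg_nonneg) auto

text \<open>With h(z) = l^(2\<beta>)/(l^\<beta> + z^\<beta>) the term at scale z is at most a
  constant times h(z) - h(2z), so dyadic sums telescope. The condition on N supplies the decay
  z^\<beta> (l/z)^(2\<beta>) for z above l.\<close>

lemma dyadic_weight_upper:
  fixes l \<beta> z :: real
  assumes l: "0 \<le> l" and \<beta>: "0 < \<beta>" and z: "0 < z" and N: "2 * \<beta> \<le> real N"
  shows "z powr \<beta> * low_cut z l ^ N \<le> dyadic_const \<beta> *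
    (l powr \<beta> * (l powr \<beta> / (l powr \<beta> + z powr \<beta>)) - l powr \<beta> * (l powr \<beta> / (l powr \<beta> + (2 * z) powr \<beta>)))"
proof (cases "l = 0")
  case True
  have "0 < N" using \<beta> N by (cases N) auto
  then show ?thesis using True by (simp add: low_cut_def power_0_left)
next
  case False
  then have l: "0 < l" using l by simp
  define u v d where "u = l powr \<beta>" and "v = z powr \<beta>" and "d = (2::real) powr \<beta>"
  have u: "0 < u" and v: "0 < v" using l z by (simp_all add: u_def v_def)
  have d: "1 < d" unfolding d_def using \<beta> powr_less_mono[of 0 \<beta> 2] by simp
  have dv: "(2 * z) powr \<beta> = d * v" using z by (simp add: powr_mult d_def v_def)
  define b where "b = l / (l + z)"
  have b: "0 < b" "b \<le> 1" using l z by (simp_all add: b_def)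
  have "low_cut z l ^ N = b powr real N" using l b by (simp add: low_cut_def b_def powr_realpow)
  also have "\<dots> \<le> b powr (2 * \<beta>)" using b N by (intro powr_mono') auto
  also have "\<dots> = (b powr \<beta>)\<^sup>2" using b by (simp add: power2_eq_square powr_add[symmetric])
  also have "\<dots> \<le> (2 * (u / (u + v)))\<^sup>2"
  proof (rule power_mono)
    have "u \<le> (l + z) powr \<beta>" "v \<le> (l + z) powr \<beta>"
      unfolding u_def v_def using l z \<beta> by (auto intro!: powr_mono2)
    then have "(u + v) / 2 \<le> (l + z) powr \<beta>" by simp
    then have "u / (l + z) powr \<beta> \<le> u / ((u + v) / 2)" using u v by (intro divide_left_mono mult_pos_pos) auto
    moreover have "b powr \<beta> = u / (l + z) powr \<beta>" using l z by (simp add: b_def u_def powr_divide)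
    ultimately show "b powr \<beta> \<le> 2 * (u / (u + v))" by (simp add: mult.commute)
  qed simp
  also have "\<dots> = 4 * u\<^sup>2 / ((u + v) * (u + v))" by (simp add: power2_eq_square)
  finally have "v * low_cut z l ^ N \<le> v * (4 * u\<^sup>2 / ((u + v) * (u + v)))" using v by (intro mult_left_mono) auto
  also have "\<dots> = 4 * u\<^sup>2 * v / (u + v) * (d / (d * (u + v)))" using d by simp
  \<comment> \<open>As d > 1, u + d v is at most d (u + v).\<close>
  also have "\<dots> \<le> 4 * u\<^sup>2 * v / (u + v) * (d / (u + d * v))"
    using u v d by (intro mult_left_mono divide_left_mono) (auto simp: algebra_simps intro!: mult_pos_pos add_pos_pos divide_nonneg_pos)
  also have "\<dots> = 4 * d / (d - 1) * (u * (u / (u + v)) - u * (u / (u + d * v)))"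
  proof -
    have nz: "u + v \<noteq> 0" "u + d * v \<noteq> 0" "d - 1 \<noteq> 0" using u v d by (auto simp: add_pos_pos intro!: less_imp_neq[symmetric])
    have "u * (u / (u + v)) - u * (u / (u + d * v)) = u\<^sup>2 * (v * (d - 1)) / ((u + v) * (u + d * v))"
      using nz(1,2) by (simp add: field_simps power2_eq_square)
    moreover have "4 * u\<^sup>2 * v / x * (d / y) = 4 * d / e * (u\<^sup>2 * (v * e) / (x * y))" if "e \<noteq> 0" for x y e
      using that by (simp add: divide_inverse)
    ultimately show ?thesis using nz(3) by metis
  qed
  finally show ?thesis unfolding dv dyadic_const_def by (simp add: u_def v_def d_def)
qed

definition dyadic_weight :: "real \<Rightarrow> nat \<Rightarrow> nat \<Rightarrow> real \<Rightarrow> ennreal" where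
  "dyadic_weight \<beta> N K l = (\<Sum>k. ennreal ((2 ^ (K + k)) powr \<beta> * low_cut (2 ^ (K + k)) l ^ N))"

lemma dyadic_weight_le:
  assumes l: "0 \<le> l" and \<beta>: "0 < \<beta>" and N: "2 * \<beta> \<le> real N"
  shows "dyadic_weight \<beta> N K l \<le>
    ennreal (dyadic_const \<beta> * (l powr \<beta> * (l powr \<beta> / (l powr \<beta> + (2 ^ K) powr \<beta>))))"
  unfolding dyadic_weight_def
proof (rule suminf_le_const)
  define h where "h k = l powr \<beta> * (l powr \<beta> / (l powr \<beta> + (2 ^ (K + k)) powr \<beta>))" for k
  note C = dyadic_const_nonneg[OF \<beta>]
  show "(\<Sum>k<n. ennreal ((2 ^ (K + k)) powr \<beta> * low_cut (2 ^ (K + k)) l ^ N))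
      \<le> ennreal (dyadic_const \<beta> * (l powr \<beta> * (l powr \<beta> / (l powr \<beta> + (2 ^ K) powr \<beta>))))" for n
  proof -
    have "(\<Sum>k<n. (2 ^ (K + k)) powr \<beta> * low_cut (2 ^ (K + k)) l ^ N)
        \<le> (\<Sum>k<n. dyadic_const \<beta> * (h k - h (Suc k)))"
      using dyadic_weight_upper[OF l \<beta> _ N] by (intro sum_mono) (simp add: h_def)
    also have "\<dots> = dyadic_const \<beta> * (h 0 - h n)"
      by (simp only: sum_distrib_left[symmetric] sum_lessThan_telescope')
    also have "\<dots> \<le> dyadic_const \<beta> * h 0"
      using C by (intro mult_left_mono) (auto simp: h_def)
    finally have "(\<Sum>k<n. (2 ^ (K + k)) powr \<beta> * low_cut (2 ^ (K + k)) l ^ N) \<le> dyadic_const \<beta> * h 0" .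
    then show ?thesis
      using low_cut_bounds(1)[of "2 ^ (K + _)" l] by (subst sum_ennreal) (auto simp: h_def intro: ennreal_leI)
  qed
qed simp

text \<open>One term is enough: the scale z with z \<le> l < 2z, where \<open>low_cut z l\<close> is
  at least 1/2. It occurs in the sum because l is at least 2^K.\<close>

lemma dyadic_weight_ge:
  assumes l: "2 ^ K \<le> l" and \<beta>: "0 < \<beta>"
  shows "ennreal (l powr \<beta>) \<le> ennreal (2 powr \<beta> * 2 ^ N) * dyadic_weight \<beta> N K l"
proof -
  obtain j where j: "l < 2 ^ j" using real_arch_pow[of 2 l] by auto
  define m where "m = (LEAST j. l < 2 ^ j)"
  have m: "l < 2 ^ m" unfolding m_def using j by (rule LeastI)
  have least: "\<not> l < 2 ^ i" if "i < m" for i using not_less_Least[OF that[unfolded m_def]] .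
  have "(2::real) ^ K < 2 ^ m" using l m by (rule le_less_trans)
  then have "K < m" by (rule power_less_imp_less_exp[rotated]) simp
  then obtain k where k: "m = Suc (K + k)" using less_iff_Suc_add by blast
  define z where "z = (2::real) ^ (K + k)"
  have z: "0 < z" "z \<le> l" "l < 2 * z" using m least[of "K + k"] by (simp_all add: k z_def not_less)
  have half: "1 / 2 \<le> low_cut z l" using z by (simp add: low_cut_def field_simps)
  have "l powr \<beta> \<le> (2 * z) powr \<beta>" using z \<beta> by (intro powr_mono2) auto
  also have "\<dots> = 2 powr \<beta> * 2 ^ N * (z powr \<beta> * (1 / 2) ^ N)" using z by (simp add: powr_mult power_divide)
  also have "\<dots> \<le> 2 powr \<beta> * 2 ^ N * (z powr \<beta> * low_cut z l ^ N)"
    using half by (intro mult_left_mono power_mono) auto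
  finally have "ennreal (l powr \<beta>) \<le> ennreal (2 powr \<beta> * 2 ^ N) * ennreal (z powr \<beta> * low_cut z l ^ N)"
    using low_cut_bounds(1)[OF z(1), of l] by (simp add: ennreal_mult'[symmetric] ennreal_leI)
  also have "ennreal (z powr \<beta> * low_cut z l ^ N) \<le> dyadic_weight \<beta> N K l"
    unfolding dyadic_weight_def z_def
    using sum_le_suminf[of "\<lambda>k. ennreal ((2 ^ (K + k)) powr \<beta> * low_cut (2 ^ (K + k)) l ^ N)" "{k}"] by simp
  finally show ?thesis by (simp add: mult_left_mono)
qed

section \<open>Conservation along solutions\<close>

context nonneg_self_adjoint
begin

lemma inner_B_deriv:
  assumes z: "0 < z" and "(f has_vector_derivative f') (at t within I)" "(g has_vector_derivative g') (at t within I)"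
  shows "((\<lambda>t. f t \<bullet> B z a (g t)) has_real_derivative f t \<bullet> B z a g' + f' \<bullet> B z a (g t)) (at t within I)"
  unfolding has_real_derivative_iff_has_vector_derivative
  using bounded_bilinear.has_vector_derivative[OF bounded_bilinear_inner assms(2)
      bounded_linear.has_vector_derivative[OF B_bounded_linear[OF z] assms(3)]] .

text \<open>A q is only known to be continuous in X, so the product rule does not apply. By symmetry
  of A B^a the difference of the form at two times is <A q(\<tau>) + A q(t), B^a (q(\<tau>) -
  q(t))>, and its quotient converges.\<close>

lemma A_B_deriv:
  assumes z: "0 < z" and sol: "cal_h_solution D A 2 I q p" and t: "t \<in> I"
  shows "((\<lambda>t. A (q t) \<bullet> B z a (q t)) has_real_derivative 2 * (A (q t) \<bullet> B z a (p t))) (at t within I)"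
proof -
  note reg = solution_regular[OF sol]
  have quot: "((\<lambda>\<tau>. (q \<tau> - q t) /\<^sub>R (\<tau> - t)) \<longlongrightarrow> p t) (at t within I)"
    using reg(4)[OF t] unfolding has_vector_derivative_iff_quotient
    by (rule LIM_zero_cancel[OF tendsto_norm_zero_cancel])
  have "((\<lambda>\<tau>. (A (q \<tau>) + A (q t)) \<bullet> B z a ((q \<tau> - q t) /\<^sub>R (\<tau> - t))) \<longlongrightarrow> (A (q t) + A (q t)) \<bullet> B z a (p t)) (at t within I)"
    by (intro tendsto_intros reg(3) t bounded_linear.tendsto[OF B_bounded_linear[OF z]] quot)
  moreover have "(A (q \<tau>) + A (q t)) \<bullet> B z a ((q \<tau> - q t) /\<^sub>R (\<tau> - t))
      = (A (q \<tau>) \<bullet> B z a (q \<tau>) - A (q t) \<bullet> B z a (q t)) / (\<tau> - t)" if \<tau>: "\<tau> \<in> I" for \<tau>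
  proof -
    interpret B: bounded_linear "B z a" by (rule B_bounded_linear[OF z])
    have "A (q \<tau>) \<bullet> B z a (q t) = A (q t) \<bullet> B z a (q \<tau>)"
      by (rule A_B_swap[OF z reg(2)[OF \<tau>] reg(2)[OF t]])
    then show ?thesis by (simp add: B.scaleR B.diff inner_simps divide_inverse algebra_simps)
  qed
  ultimately have "((\<lambda>\<tau>. (A (q \<tau>) \<bullet> B z a (q \<tau>) - A (q t) \<bullet> B z a (q t)) / (\<tau> - t))
      \<longlongrightarrow> (A (q t) + A (q t)) \<bullet> B z a (p t)) (at t within I)"
    by (subst (asm) tendsto_cong) (auto simp: eventually_at_filter)
  then show ?thesis by (simp add: has_field_derivative_iff inner_simps)
qed

text \<open>The conserved quantity is bounded below at time t and above at time 0. At time 0, z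
  Q_(N-a) \<le> V_(N-1-a) absorbs the factor z, and interpolation bounds each of the N products
  P_(a+1) V_(N-1-a) by P_N V_0 + P_0 V_N; these enter twice, whence 2 N + 1.\<close>

lemma a_priori:
  assumes z: "0 < z" and sol: "cal_h_solution D A 2 I q p" and I: "is_interval I" "0 \<in> I" and t: "t \<in> I"
  shows "p t \<bullet> B z N (p t) + kcoef D A (q t) * (A (q t) \<bullet> B z N (q t))
    \<le> (2 * real N + 1) * ((1 + A (q 0) \<bullet> q 0) * (p 0 \<bullet> B z N (p 0)) + (1 + p 0 \<bullet> p 0) * (A (q 0) \<bullet> B z N (q 0)))"
proof -
  note reg = solution_regular[OF sol]
  define P Q S V U where "P a t = p t \<bullet> B z a (p t)" and "Q a t = q t \<bullet> B z a (q t)"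
    and "S a t = p t \<bullet> B z a (q t)" and "V a t = A (q t) \<bullet> B z a (q t)" and "U a t = A (q t) \<bullet> B z a (p t)" for a t
  define c where "c t = 1 / (1 + V 0 t)" for t
  have swap: "x \<bullet> B z a y = y \<bullet> B z a x" for x y a
    using B_sym[OF z, of a x y] by (simp add: inner_commute)
  have kc: "kcoef D A (q t) = c t" if "t \<in> I" for t
    using sqrt_op_norm[OF z reg(2,1)[OF that]] by (simp add: kcoef_def c_def V_def B_0[OF z])
  have V_nonneg: "0 \<le> V a t" if "t \<in> I" for a t unfolding V_def by (rule A_B_nonneg[OF z reg(2)[OF that]])
  have P_nonneg: "0 \<le> P a t" and Q_nonneg: "0 \<le> Q a t" for a t unfolding P_def Q_def by (rule B_nonneg[OF z])+
  have zQ: "z * Q (Suc a) t = V a t - V (Suc a) t" and zS: "z * S (Suc a) t = U a t - U (Suc a) t" if "t \<in> I" for a t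
  proof -
    have "z * (x \<bullet> B z (Suc a) (q t)) = x \<bullet> (B z a (A (q t)) - B z (Suc a) (A (q t)))" for x
      unfolding B_Suc[OF z reg(2)[OF that], symmetric] by simp
    then have "z * (x \<bullet> B z (Suc a) (q t)) = A (q t) \<bullet> B z a x - A (q t) \<bullet> B z (Suc a) x" for x
      by (simp only: inner_diff_right swap[where x = x and y = "A (q t)"])
    then show "z * Q (Suc a) t = V a t - V (Suc a) t" "z * S (Suc a) t = U a t - U (Suc a) t"
      unfolding Q_def S_def V_def U_def by this+
  qed
  define W where "W t = kirchhoff_integral z N (c t) (\<lambda>a. P a t) (\<lambda>a. Q a t) (\<lambda>a. S a t) (\<lambda>a. V a t)" for t
  have "(W has_real_derivative 0) (at t within I)" if t: "t \<in> I" for t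
    unfolding W_def
  proof (rule kirchhoff_integral_deriv[where P=P and Q=Q and S=S and V=V and U=U and c=c and t=t])
    note dq = reg(4)[OF t] and dp = reg(5)[OF t, unfolded kc[OF t]]
    show "(P a has_real_derivative - 2 * (c t)\<^sup>2 * U a t) (at t within I)" for a
      using inner_B_deriv[OF z dp dp, of a] unfolding P_def U_def swap[where x = "p t" and y = "- (c t)\<^sup>2 *\<^sub>R A (q t)"]
      by (simp add: mult.assoc)
    show "(Q a has_real_derivative 2 * S a t) (at t within I)" for a
      using inner_B_deriv[OF z dq dq, of a] unfolding Q_def S_def swap[where x = "q t" and y = "p t"] by simp
    show "(S a has_real_derivative P a t - (c t)\<^sup>2 * V a t) (at t within I)" for a
      using inner_B_deriv[OF z dp dq, of a] unfolding S_def P_def V_def by simp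
    show "(V a has_real_derivative 2 * U a t) (at t within I)" for a
      unfolding V_def U_def by (rule A_B_deriv[OF z sol t])
  qed (use t V_nonneg zQ zS c_def in auto)
  then obtain w where "\<And>t. t \<in> I \<Longrightarrow> W t = w"
    using has_field_derivative_zero_constant[of I W] I(1) is_interval_convex by blast
  then have W: "W t = W 0" using t I(2) by simp
  have c01: "c 0 \<le> 1" "0 \<le> c 0" using V_nonneg[OF I(2), of 0] by (simp_all add: c_def divide_simps)
  have CS: "(S a t)\<^sup>2 \<le> P a t * Q a t" for a t
    unfolding S_def P_def Q_def by (rule B_Cauchy_Schwarz[OF z])
  have "P N t + c t * V N t \<le> W t"
    unfolding W_def using z by (intro kirchhoff_integral_bounds(1) P_nonneg Q_nonneg CS) auto
  also have "W t = W 0" by (rule W)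
  also have "W 0 \<le> P N 0 + c 0 * V N 0 + 2 * (\<Sum>a<N. P (Suc a) 0 * (z * Q (N - a) 0))"
    unfolding W_def using z by (intro kirchhoff_integral_bounds(2) P_nonneg Q_nonneg CS) auto
  also have "\<dots> \<le> P N 0 + c 0 * V N 0 + 2 * (\<Sum>a<N. P N 0 * V 0 0 + (p 0 \<bullet> p 0) * V N 0)"
  proof -
    have "P (Suc a) 0 * (z * Q (N - a) 0) \<le> P N 0 * V 0 0 + (p 0 \<bullet> p 0) * V N 0" if "a < N" for a
    proof -
      have Na: "N - a = Suc (N - Suc a)" using that by simp
      have "z * Q (N - a) 0 \<le> V (N - Suc a) 0"
        unfolding Na zQ[OF I(2)] using V_nonneg[OF I(2)] by simp
      then have "P (Suc a) 0 * (z * Q (N - a) 0) \<le> P (Suc a) 0 * V (N - Suc a) 0"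
        using P_nonneg by (rule mult_left_mono)
      also have "\<dots> \<le> P N 0 * V 0 0 + (p 0 \<bullet> p 0) * V N 0"
        using B_interpolation[OF z reg(2)[OF I(2)], of "Suc a" "N - Suc a" N "p 0"] that
        unfolding P_def V_def by (simp add: B_0[OF z])
      finally show ?thesis .
    qed
    then show ?thesis by (intro add_left_mono mult_left_mono sum_mono) auto
  qed
  also have "\<dots> = P N 0 + c 0 * V N 0 + 2 * real N * (V 0 0 * P N 0 + (p 0 \<bullet> p 0) * V N 0)"
    by (simp add: mult.commute)
  also have "\<dots> \<le> ((1 + V 0 0) * P N 0 + (1 + p 0 \<bullet> p 0) * V N 0)
      + 2 * real N * ((1 + V 0 0) * P N 0 + (1 + p 0 \<bullet> p 0) * V N 0)"
  proof (rule add_mono)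
    have "c 0 * V N 0 \<le> 1 * V N 0" using c01 V_nonneg[OF I(2)] by (intro mult_right_mono)
    then show "P N 0 + c 0 * V N 0 \<le> (1 + V 0 0) * P N 0 + (1 + p 0 \<bullet> p 0) * V N 0"
      using mult_nonneg_nonneg[OF V_nonneg[OF I(2), of 0] P_nonneg[of N 0]]
        mult_nonneg_nonneg[OF inner_ge_zero[of "p 0"] V_nonneg[OF I(2), of N]]
      unfolding distrib_right by linarith
    show "2 * real N * (V 0 0 * P N 0 + (p 0 \<bullet> p 0) * V N 0)
        \<le> 2 * real N * ((1 + V 0 0) * P N 0 + (1 + p 0 \<bullet> p 0) * V N 0)"
      using V_nonneg[OF I(2)] P_nonneg by (intro mult_left_mono add_mono mult_right_mono) auto
  qed
  also have "\<dots> = (2 * real N + 1) * ((1 + V 0 0) * P N 0 + (1 + p 0 \<bullet> p 0) * V N 0)"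
    by (simp add: algebra_simps)
  finally show ?thesis unfolding kc[OF t] P_def V_def B_0[OF z] .
qed

end

section \<open>Bounds for solutions\<close>

text \<open>The product of the losses in three passages: from a tail to a dyadic sum, along the
  flow, and from a dyadic sum to a soft tail.\<close>

definition tail_const :: "real \<Rightarrow> real \<Rightarrow> nat \<Rightarrow> real" where
  "tail_const R \<beta> N = 2 powr \<beta> * 2 ^ N * ((2 * real N + 1) * (1 + R)) * (dyadic_const \<beta>)"

context nonneg_self_adjoint
begin

definition tail :: "real \<Rightarrow> nat \<Rightarrow> 'a \<Rightarrow> ennreal" where
  "tail \<beta> K = J (\<lambda>l. indicator {2 ^ K..} l * l powr \<beta>)"

text \<open>The weight left by the telescoped dyadic sum: comparable to l^\<beta> above 2^K, with a
  remnant below because \<open>low_cut\<close> is not a sharp cut-off.\<close>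

definition soft_tail :: "real \<Rightarrow> nat \<Rightarrow> 'a \<Rightarrow> ennreal" where
  "soft_tail \<beta> K = J (\<lambda>l. l powr \<beta> * (l powr \<beta> / (l powr \<beta> + (2 ^ K) powr \<beta>)))"

definition dyadic_form :: "real \<Rightarrow> nat \<Rightarrow> nat \<Rightarrow> 'a \<Rightarrow> ennreal" where
  "dyadic_form \<beta> N K x = (\<Sum>k. ennreal ((2 ^ (K + k)) powr \<beta>) * J (\<lambda>l. low_cut (2 ^ (K + k)) l ^ N) x)"

lemma dyadic_form_eq: "dyadic_form \<beta> N K x = (\<integral>\<^sup>+l. dyadic_weight \<beta> N K l \<partial>pvm_measure E x)"
proof -
  have "(\<integral>\<^sup>+l. dyadic_weight \<beta> N K l \<partial>pvm_measure E x)
      = (\<Sum>k. \<integral>\<^sup>+l. ennreal ((2 ^ (K + k)) powr \<beta> * low_cut (2 ^ (K + k)) l ^ N) \<partial>pvm_measure E x)"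
    unfolding dyadic_weight_def by (rule nn_integral_suminf) measurable
  also have "\<dots> = dyadic_form \<beta> N K x"
    unfolding dyadic_form_def J_def[symmetric] by (intro suminf_cong J_cmult) auto
  finally show ?thesis ..
qed

lemma dyadic_weight_measurable [measurable]: "dyadic_weight \<beta> N K \<in> borel_measurable borel"
  unfolding dyadic_weight_def by measurable

lemma tail_le_dyadic_form:
  assumes "0 < \<beta>"
  shows "tail \<beta> K x \<le> ennreal (2 powr \<beta> * 2 ^ N) * dyadic_form \<beta> N K x"
proof -
  have "tail \<beta> K x \<le> (\<integral>\<^sup>+l. ennreal (2 powr \<beta> * 2 ^ N) * dyadic_weight \<beta> N K l \<partial>pvm_measure E x)"
    unfolding tail_def J_def
  proof (rule nn_integral_mono)
    fix l
    show "ennreal (indicator {2 ^ K..} l * l powr \<beta>) \<le> ennreal (2 powr \<beta> * 2 ^ N) * dyadic_weight \<beta> N K l"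
      using dyadic_weight_ge[of K l \<beta> N] assms by (simp add: indicator_def)
  qed
  also have "\<dots> = ennreal (2 powr \<beta> * 2 ^ N) * dyadic_form \<beta> N K x"
    unfolding dyadic_form_eq by (rule nn_integral_cmult) measurable
  finally show ?thesis .
qed

lemma dyadic_form_le_soft_tail:
  assumes "0 < \<beta>" "2 * \<beta> \<le> real N"
  shows "dyadic_form \<beta> N K x \<le> ennreal (dyadic_const \<beta>) * soft_tail \<beta> K x"
proof -
  note C = dyadic_const_nonneg[OF assms(1)]
  have "dyadic_form \<beta> N K x \<le> J (\<lambda>l. dyadic_const \<beta> * (l powr \<beta> * (l powr \<beta> / (l powr \<beta> + (2 ^ K) powr \<beta>)))) x"
    unfolding dyadic_form_eq J_def using AE_nonneg[of x] dyadic_weight_le[OF _ assms]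
    by (intro nn_integral_mono_AE) (auto elim!: eventually_mono)
  also have "\<dots> = ennreal (dyadic_const \<beta>) * soft_tail \<beta> K x"
    unfolding soft_tail_def by (rule J_cmult[OF _ C]) measurable
  finally show ?thesis .
qed

lemma kcoef_pos: "0 < kcoef D A x"
  by (simp add: kcoef_def add_pos_nonneg)

context
  fixes I q p and R :: real
  assumes sol: "cal_h_solution D A 2 I q p" and I: "is_interval I" "0 \<in> I"
    and R: "(norm (p 0))\<^sup>2 \<le> R" "(norm (sqrt_op D A (q 0)))\<^sup>2 \<le> R"
begin

lemma a_priori_real:
  assumes z: "0 < z" and t: "t \<in> I"
  shows "p t \<bullet> B z N (p t) + kcoef D A (q t) * (A (q t) \<bullet> B z N (q t))
    \<le> (2 * real N + 1) * (1 + R) * (p 0 \<bullet> B z N (p 0) + A (q 0) \<bullet> B z N (q 0))"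
proof -
  note reg = solution_regular[OF sol]
  have R': "p 0 \<bullet> p 0 \<le> R" "A (q 0) \<bullet> q 0 \<le> R"
    using R sqrt_op_norm[OF z reg(2,1)[OF I(2)]] by (simp_all add: power2_norm_eq_inner)
  have "(1 + A (q 0) \<bullet> q 0) * (p 0 \<bullet> B z N (p 0)) + (1 + p 0 \<bullet> p 0) * (A (q 0) \<bullet> B z N (q 0))
      \<le> (1 + R) * (p 0 \<bullet> B z N (p 0)) + (1 + R) * (A (q 0) \<bullet> B z N (q 0))"
    using R' B_nonneg[OF z, of "p 0" N] A_B_nonneg[OF z reg(2)[OF I(2)], of N]
    by (intro add_mono mult_right_mono) auto
  then have "(2 * real N + 1) * ((1 + A (q 0) \<bullet> q 0) * (p 0 \<bullet> B z N (p 0)) + (1 + p 0 \<bullet> p 0) * (A (q 0) \<bullet> B z N (q 0)))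
      \<le> (2 * real N + 1) * ((1 + R) * (p 0 \<bullet> B z N (p 0)) + (1 + R) * (A (q 0) \<bullet> B z N (q 0)))"
    by (intro mult_left_mono) auto
  with a_priori[OF z sol I t, of N] show ?thesis by (simp add: algebra_simps)
qed

lemma R_nonneg: "0 \<le> R"
  using R(1) zero_le_power2[of "norm (p 0)"] by linarith

lemma a_priori_J:
  assumes z: "0 < z" and t: "t \<in> I"
  shows "J (\<lambda>l. low_cut z l ^ N) (p t) + ennreal (kcoef D A (q t)) * J (\<lambda>l. low_cut z l ^ N) (sqrt_op D A (q t))
    \<le> ennreal ((2 * real N + 1) * (1 + R)) *
      (J (\<lambda>l. low_cut z l ^ N) (p 0) + J (\<lambda>l. low_cut z l ^ N) (sqrt_op D A (q 0)))"
proof -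
  note reg = solution_regular[OF sol]
  have nn: "0 \<le> A (q \<tau>) \<bullet> B z N (q \<tau>)" if "\<tau> \<in> I" for \<tau> by (rule A_B_nonneg[OF z reg(2)[OF that]])
  have "ennreal (p t \<bullet> B z N (p t) + kcoef D A (q t) * (A (q t) \<bullet> B z N (q t)))
      \<le> ennreal ((2 * real N + 1) * (1 + R) * (p 0 \<bullet> B z N (p 0) + A (q 0) \<bullet> B z N (q 0)))"
    by (rule ennreal_leI[OF a_priori_real[OF z t]])
  then show ?thesis
    unfolding J_sqrt_B[OF z reg(2,1)[OF t]] J_sqrt_B[OF z reg(2,1)[OF I(2)]]
    using nn[OF t] nn[OF I(2)] B_nonneg[OF z] R_nonneg less_imp_le[OF kcoef_pos]
    by (simp add: J_B[OF z] ennreal_mult)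
qed

lemma a_priori_dyadic:
  assumes t: "t \<in> I"
  shows "dyadic_form \<beta> N K (p t) + ennreal (kcoef D A (q t)) * dyadic_form \<beta> N K (sqrt_op D A (q t))
    \<le> ennreal ((2 * real N + 1) * (1 + R)) * (dyadic_form \<beta> N K (p 0) + dyadic_form \<beta> N K (sqrt_op D A (q 0)))"
proof -
  let ?w = "\<lambda>k. ennreal ((2 ^ (K + k)) powr \<beta>)" and ?j = "\<lambda>k x. J (\<lambda>l. low_cut (2 ^ (K + k)) l ^ N) x"
  let ?c = "ennreal (kcoef D A (q t))" and ?C = "ennreal ((2 * real N + 1) * (1 + R))"
  have lin: "dyadic_form \<beta> N K x + c * dyadic_form \<beta> N K y = (\<Sum>k. ?w k * (?j k x + c * ?j k y))" for x y c
    unfolding dyadic_form_def ennreal_suminf_cmult[symmetric]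
    by (subst suminf_add[OF summableI summableI]) (simp add: distrib_left mult.left_commute)
  have "dyadic_form \<beta> N K (p t) + ?c * dyadic_form \<beta> N K (sqrt_op D A (q t))
      \<le> (\<Sum>k. ?C * (?w k * (?j k (p 0) + 1 * ?j k (sqrt_op D A (q 0)))))"
    unfolding lin
  proof (intro suminf_le allI summableI)
    fix k
    show "?w k * (?j k (p t) + ?c * ?j k (sqrt_op D A (q t))) \<le> ?C * (?w k * (?j k (p 0) + 1 * ?j k (sqrt_op D A (q 0))))"
      using mult_left_mono[OF a_priori_J[OF _ t, of "2 ^ (K + k)" N], of "?w k"] by (simp add: mult.left_commute)
  qed
  also have "\<dots> = ?C * (dyadic_form \<beta> N K (p 0) + 1 * dyadic_form \<beta> N K (sqrt_op D A (q 0)))"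
    unfolding lin by (rule ennreal_suminf_cmult)
  finally show ?thesis by simp
qed

text \<open>The a priori estimates are summed over z = 2^(K+k) with weights z^\<beta>. The
  coefficient c(q(t)) does not depend on the scale, so it passes through the sum.\<close>

lemma a_priori_tail:
  assumes t: "t \<in> I" and \<beta>: "0 < \<beta>" "2 * \<beta> \<le> real N"
  shows "tail \<beta> K (p t) + ennreal (kcoef D A (q t)) * tail \<beta> K (sqrt_op D A (q t))
    \<le> ennreal (tail_const R \<beta> N) * (soft_tail \<beta> K (p 0) + soft_tail \<beta> K (sqrt_op D A (q 0)))"
proof -
  let ?d = "dyadic_form \<beta> N K" and ?c = "ennreal (kcoef D A (q t))"
  let ?C1 = "2 powr \<beta> * 2 ^ N" and ?C2 = "(2 * real N + 1) * (1 + R)" and ?C3 = "dyadic_const \<beta>"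
  note C3 = dyadic_const_nonneg[OF \<beta>(1)]
  have C2: "0 \<le> ?C2" using R_nonneg by simp
  have "tail \<beta> K (p t) + ?c * tail \<beta> K (sqrt_op D A (q t))
      \<le> ennreal ?C1 * ?d (p t) + ?c * (ennreal ?C1 * ?d (sqrt_op D A (q t)))"
    by (intro add_mono mult_left_mono tail_le_dyadic_form \<beta>) auto
  also have "\<dots> = ennreal ?C1 * (?d (p t) + ?c * ?d (sqrt_op D A (q t)))"
    by (simp add: distrib_left mult.left_commute)
  also have "\<dots> \<le> ennreal ?C1 * (ennreal ?C2 * (?d (p 0) + ?d (sqrt_op D A (q 0))))"
    by (intro mult_left_mono a_priori_dyadic t) auto
  also have "\<dots> \<le> ennreal ?C1 * (ennreal ?C2 * (ennreal ?C3 * soft_tail \<beta> K (p 0) + ennreal ?C3 * soft_tail \<beta> K (sqrt_op D A (q 0))))"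
    by (intro mult_left_mono add_mono dyadic_form_le_soft_tail \<beta>) auto
  also have "\<dots> = ennreal (tail_const R \<beta> N) * (soft_tail \<beta> K (p 0) + soft_tail \<beta> K (sqrt_op D A (q 0)))"
  proof -
    have "ennreal a * (ennreal b * (ennreal c * u + ennreal c * v)) = ennreal (a * b * c) * (u + v)"
      if "0 \<le> a" "0 \<le> b" "0 \<le> c" for a b c :: real and u v
      using that by (simp add: ennreal_mult distrib_left mult.assoc)
    from this[OF _ C2 C3] show ?thesis unfolding tail_const_def by simp
  qed
  finally show ?thesis .
qed

text \<open>The case N = 0 of the a priori estimate: \<open>B z 0\<close> is the identity, and z = 1
  is an arbitrary choice.\<close>

lemma energy_bound:
  assumes t: "t \<in> I"
  shows "(norm (p t))\<^sup>2 + kcoef D A (q t) * (norm (sqrt_op D A (q t)))\<^sup>2 \<le> (1 + R) * (2 * R)"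
proof -
  note reg = solution_regular[OF sol]
  have z: "0 < (1::real)" by simp
  have eq: "(norm (p \<tau>))\<^sup>2 = p \<tau> \<bullet> B 1 0 (p \<tau>)" "\<tau> \<in> I \<Longrightarrow> (norm (sqrt_op D A (q \<tau>)))\<^sup>2 = A (q \<tau>) \<bullet> B 1 0 (q \<tau>)" for \<tau>
    by (simp_all add: B_0[OF z] power2_norm_eq_inner) (simp add: sqrt_op_norm[OF z reg(2,1), unfolded power2_norm_eq_inner])
  have "p t \<bullet> B 1 0 (p t) + kcoef D A (q t) * (A (q t) \<bullet> B 1 0 (q t))
      \<le> (1 + R) * (p 0 \<bullet> B 1 0 (p 0) + A (q 0) \<bullet> B 1 0 (q 0))"
    using a_priori_real[OF z t, of 0] by simp
  also have "\<dots> \<le> (1 + R) * (2 * R)"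
    using R R_nonneg eq[of 0] I(2) by (intro mult_left_mono) auto
  finally show ?thesis using eq[of t] t by simp
qed

text \<open>Mean value inequality with the speed bound from \<open>energy_bound\<close>.\<close>

lemma displacement_bound:
  assumes t: "t \<in> I"
  shows "(norm (q t - q 0))\<^sup>2 \<le> (1 + R) * (2 * R) * t\<^sup>2"
proof -
  let ?e = "sqrt ((1 + R) * (2 * R))"
  have e: "0 \<le> (1 + R) * (2 * R)" using R_nonneg by simp
  have "norm (q t - q 0) \<le> ?e * norm (t - 0)"
  proof (rule differentiable_bound[of I])
    show "convex I" using I(1) by (rule is_interval_convex)
    fix \<tau> assume \<tau>: "\<tau> \<in> I"
    show "(q has_derivative (\<lambda>h. h *\<^sub>R p \<tau>)) (at \<tau> within I)"
      using solution_regular(4)[OF sol \<tau>] by (simp add: has_vector_derivative_def)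
    have "0 \<le> kcoef D A (q \<tau>) * (norm (sqrt_op D A (q \<tau>)))\<^sup>2" using kcoef_pos by (simp add: less_imp_le)
    then have "norm (p \<tau>) \<le> ?e" using energy_bound[OF \<tau>] by (intro real_le_rsqrt) simp
    then show "onorm (\<lambda>h. h *\<^sub>R p \<tau>) \<le> ?e"
      by (intro onorm_le) (simp add: mult.commute mult_left_mono)
  qed (use t I in auto)
  then have "(norm (q t - q 0))\<^sup>2 \<le> (?e * \<bar>t\<bar>)\<^sup>2" by (intro power_mono) auto
  then show ?thesis using e by (simp add: power_mult_distrib)
qed

end

text \<open>Since b = \<open>low_cut z l\<close> is at most 1, b \<le> b^\<theta> \<le>
  (l/z)^\<theta>. The gain z^-\<theta> makes the high part of data bounded with weight (1 +
  l)^\<beta> small for large z; it needs \<beta> > 0, that is s > 1.\<close>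

lemma low_cut_le_powr:
  assumes "0 \<le> l" "0 < z" "0 < \<theta>" "\<theta> \<le> 1" "\<theta> \<le> \<beta>"
  shows "low_cut z l \<le> z powr - \<theta> * (1 + l) powr \<beta>"
proof -
  have b: "0 \<le> low_cut z l" "low_cut z l \<le> 1" using low_cut_bounds[OF assms(2)] .
  have "low_cut z l \<le> low_cut z l powr \<theta>"
  proof (cases "low_cut z l = 0")
    case False
    then have "low_cut z l powr 1 \<le> low_cut z l powr \<theta>" using b assms by (intro powr_mono') auto
    then show ?thesis using b by simp
  qed simp
  also have "\<dots> \<le> (l / z) powr \<theta>"
    using assms by (intro powr_mono2) (auto simp: low_cut_def intro!: divide_left_mono divide_nonneg_nonneg)
  also have "\<dots> = z powr - \<theta> * l powr \<theta>" using assms by (simp add: powr_divide powr_minus_divide)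
  also have "\<dots> \<le> z powr - \<theta> * (1 + l) powr \<beta>"
  proof (rule mult_left_mono)
    have "l powr \<theta> \<le> (1 + l) powr \<theta>" using assms by (intro powr_mono2) auto
    also have "\<dots> \<le> (1 + l) powr \<beta>" using assms by (intro powr_mono) auto
    finally show "l powr \<theta> \<le> (1 + l) powr \<beta>" .
  qed simp
  finally show ?thesis .
qed

lemma B_one_small:
  assumes "0 < z" "0 < \<theta>" "\<theta> \<le> 1" "\<theta> \<le> \<beta>" and R: "J (\<lambda>l. (1 + l) powr \<beta>) x \<le> ennreal R"
  shows "J (\<lambda>l. low_cut z l ^ 1) x \<le> ennreal (z powr - \<theta> * R)"
proof -
  have "J (\<lambda>l. low_cut z l ^ 1) x \<le> J (\<lambda>l. z powr - \<theta> * (1 + l) powr \<beta>) x"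
    using low_cut_le_powr[OF _ assms(1-4)] by (intro J_mono) simp
  also have "\<dots> = ennreal (z powr - \<theta>) * J (\<lambda>l. (1 + l) powr \<beta>) x"
    by (rule J_cmult) auto
  also have "\<dots> \<le> ennreal (z powr - \<theta>) * ennreal R" by (intro mult_left_mono R) auto
  finally show ?thesis by (simp add: ennreal_mult')
qed

lemma norm_le_J:
  assumes "0 < \<beta>" "J (\<lambda>l. (1 + l) powr \<beta>) x \<le> ennreal R" "0 \<le> R"
  shows "(norm x)\<^sup>2 \<le> R"
proof -
  have "ennreal ((norm x)\<^sup>2) \<le> J (\<lambda>l. (1 + l) powr \<beta>) x"
    unfolding J_one[symmetric] using assms(1) by (intro J_mono) (simp add: ge_one_powr_ge_zero)
  also note assms(2)
  finally show ?thesis using assms(3) by simp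
qed

text \<open>
  The part of \<open>A\<^bsup>1/2\<^esup>q\<close> at frequencies above \<open>z\<close> is a small fraction of the whole by the a priori
  estimate, while the part below \<open>z\<close> grows at most linearly because \<open>p\<close> is bounded in \<open>X\<close>.
\<close>

lemma growth:
  assumes \<beta>: "0 < \<beta>" and R: "0 \<le> R"
  shows "\<exists>C\<ge>0. \<forall>I q p. cal_h_solution D A 2 I q p \<longrightarrow> is_interval I \<longrightarrow> 0 \<in> I \<longrightarrow>
    J (\<lambda>l. (1 + l) powr \<beta>) (p 0) \<le> ennreal R \<longrightarrow> J (\<lambda>l. (1 + l) powr \<beta>) (sqrt_op D A (q 0)) \<le> ennreal R \<longrightarrow>
    (\<forall>t\<in>I. 1 + (norm (sqrt_op D A (q t)))\<^sup>2 \<le> C * (1 + t\<^sup>2))"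
proof -
  define \<theta> where "\<theta> = min 1 \<beta>"
  have \<theta>: "0 < \<theta>" "\<theta> \<le> 1" "\<theta> \<le> \<beta>" using \<beta> by (simp_all add: \<theta>_def)
  \<comment> \<open>Chosen so that 6 (1 + R) R / m, the a priori bound for N = 1 once z^-\<theta> =
    1/m, is at most 1/4.\<close>
  define m where "m = 24 * (1 + R) * R + 1"
  have m: "0 < m" using R by (simp add: m_def add_nonneg_pos)
  define z where "z = m powr (1 / \<theta>)"
  have z: "0 < z" using m by (simp add: z_def)
  have z\<theta>: "z powr - \<theta> = 1 / m" using m \<theta> by (simp add: z_def powr_powr powr_minus divide_inverse)
  define e where "e = (1 + R) * (2 * R)"
  have e: "0 \<le> e" using R by (simp add: e_def)
  define C where "C = 4 / 3 * (1 + 2 * R + 2 * z * e)"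
  have C: "0 \<le> C" using R z e by (simp add: C_def)
  have "1 + (norm (sqrt_op D A (q t)))\<^sup>2 \<le> C * (1 + t\<^sup>2)"
    if sol: "cal_h_solution D A 2 I q p" and I: "is_interval I" "0 \<in> I" and t: "t \<in> I"
      and Rp: "J (\<lambda>l. (1 + l) powr \<beta>) (p 0) \<le> ennreal R"
      and Rq: "J (\<lambda>l. (1 + l) powr \<beta>) (sqrt_op D A (q 0)) \<le> ennreal R" for I q p t
  proof -
    note reg = solution_regular[OF sol]
    note R2 = norm_le_J[OF \<beta> Rp R] norm_le_J[OF \<beta> Rq R]
    define \<sigma> where "\<sigma> = A (q t) \<bullet> q t"
    have \<sigma>: "(norm (sqrt_op D A (q t)))\<^sup>2 = \<sigma>" unfolding \<sigma>_def by (rule sqrt_op_norm[OF z reg(2,1)[OF t]])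
    then have \<sigma>0: "0 \<le> \<sigma>" using zero_le_power2[of "norm (sqrt_op D A (q t))"] by simp
    have k: "kcoef D A (q t) = 1 / (1 + \<sigma>)" by (simp add: kcoef_def \<sigma>)
    have small: "p 0 \<bullet> B z 1 (p 0) \<le> 1 / m * R" "A (q 0) \<bullet> B z 1 (q 0) \<le> 1 / m * R"
      using B_one_small[OF z \<theta> Rp, unfolded z\<theta> J_B[OF z]]
        B_one_small[OF z \<theta> Rq, unfolded z\<theta> J_sqrt_B[OF z reg(2,1)[OF I(2)]]] R m
      by (simp_all add: ennreal_le_iff)
    have "kcoef D A (q t) * (A (q t) \<bullet> B z 1 (q t)) \<le> (2 * real 1 + 1) * (1 + R) * (p 0 \<bullet> B z 1 (p 0) + A (q 0) \<bullet> B z 1 (q 0))"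
      using a_priori_real[OF sol I R2 z t, of 1] B_nonneg[OF z, of "p t" 1] by linarith
    also have "\<dots> \<le> (2 * real 1 + 1) * (1 + R) * (1 / m * R + 1 / m * R)"
      using small R by (intro mult_left_mono add_mono) auto
    also have "\<dots> = (6 * (1 + R) * R) / m" using m by (simp add: field_simps)
    also have "\<dots> \<le> 1 / 4" unfolding pos_divide_le_eq[OF m] by (simp add: m_def algebra_simps)
    finally have high: "A (q t) \<bullet> B z 1 (q t) \<le> (1 + \<sigma>) / 4" using \<sigma>0 by (simp add: k field_simps)
    have swap: "x \<bullet> B z a y = y \<bullet> B z a x" for x y a
      using B_sym[OF z, of a x y] by (simp add: inner_commute)
    \<comment> \<open>The low-frequency part of <A q, q> is z <q, B q>, a form in q rather than in A
      q.\<close>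
    have split: "z * (q \<tau> \<bullet> B z 1 (q \<tau>)) = A (q \<tau>) \<bullet> q \<tau> - A (q \<tau>) \<bullet> B z 1 (q \<tau>)" if "\<tau> \<in> I" for \<tau>
      using arg_cong[OF B_Suc[OF z reg(2)[OF that], of 0], of "\<lambda>v. q \<tau> \<bullet> v"]
      by (simp add: B_0[OF z] inner_diff_right swap[where x = "q \<tau>" and y = "A (q \<tau>)"] inner_commute[of "q \<tau>" "A (q \<tau>)"])
    let ?d = "q t - q 0"
    \<comment> \<open>With q(t) = q(0) + d, the cross term is removed by positivity of the form of B
      at q(0) - d.\<close>
    have "q t \<bullet> B z 1 (q t) \<le> 2 * (q 0 \<bullet> B z 1 (q 0)) + 2 * (?d \<bullet> B z 1 ?d)"
    proof -
      interpret B: bounded_linear "B z a" for a by (rule B_bounded_linear[OF z])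
      have "0 \<le> (q 0 - ?d) \<bullet> B z 1 (q 0 - ?d)" by (rule B_nonneg[OF z])
      then show ?thesis
        by (simp add: B.diff inner_diff_left inner_diff_right swap[where x = "q 0" and y = "q t"])
    qed
    moreover have "?d \<bullet> B z 1 ?d \<le> e * t\<^sup>2"
    proof -
      have "ennreal (?d \<bullet> B z 1 ?d) \<le> ennreal ((norm ?d)\<^sup>2)"
        unfolding J_B[OF z, symmetric] J_one[symmetric] using low_cut_bounds[OF z] by (intro J_mono) simp
      then have "?d \<bullet> B z 1 ?d \<le> (norm ?d)\<^sup>2" by simp
      also have "\<dots> \<le> e * t\<^sup>2" unfolding e_def by (rule displacement_bound[OF sol I R2 t])
      finally show ?thesis .
    qed
    ultimately have "q t \<bullet> B z 1 (q t) \<le> 2 * (q 0 \<bullet> B z 1 (q 0)) + 2 * (e * t\<^sup>2)" by linarith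
    then have "z * (q t \<bullet> B z 1 (q t)) \<le> z * (2 * (q 0 \<bullet> B z 1 (q 0)) + 2 * (e * t\<^sup>2))"
      using z by (intro mult_left_mono) auto
    then have low: "z * (q t \<bullet> B z 1 (q t)) \<le> 2 * (z * (q 0 \<bullet> B z 1 (q 0))) + 2 * z * e * t\<^sup>2"
      by (simp add: algebra_simps)
    have init: "z * (q 0 \<bullet> B z 1 (q 0)) \<le> R"
      using split[OF I(2)] A_B_nonneg[OF z reg(2)[OF I(2)], of 1] sqrt_op_norm[OF z reg(2,1)[OF I(2)]] R2(2) by linarith
    \<comment> \<open>The quarter of 1 + \<sigma> is absorbed on the left, which is the origin of
      4/3 in \<open>C\<close>.\<close>
    have "\<sigma> \<le> (1 + \<sigma>) / 4 + (2 * R + 2 * z * e * t\<^sup>2)"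
      using split[OF t] high low init unfolding \<sigma>_def by linarith
    then have "1 + \<sigma> \<le> 4 / 3 * (1 + 2 * R + 2 * z * e * t\<^sup>2)" by (simp add: field_simps)
    also have "\<dots> \<le> 4 / 3 * ((1 + 2 * R + 2 * z * e) * (1 + t\<^sup>2))"
    proof -
      have "0 \<le> (1 + 2 * R) * t\<^sup>2" "0 \<le> 2 * z * e" using R z e by simp_all
      then show ?thesis by (simp add: algebra_simps)
    qed
    also have "\<dots> = C * (1 + t\<^sup>2)" by (simp add: C_def)
    finally show ?thesis unfolding \<sigma> .
  qed
  then show ?thesis using C by blast
qed

text \<open>Below 1 the weight is at most 2^\<beta>; above 1 one has 1 + l \<le> 2 l.\<close>

lemma sob_le_tail:
  assumes "0 < \<beta>"
  shows "J (\<lambda>l. (1 + l) powr \<beta>) x \<le> ennreal (2 powr \<beta>) * (ennreal ((norm x)\<^sup>2) + tail \<beta> 0 x)"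
proof -
  have "J (\<lambda>l. (1 + l) powr \<beta>) x \<le> J (\<lambda>l. 2 powr \<beta> * (1 + indicator {2 ^ 0..} l * l powr \<beta>)) x"
  proof (rule J_mono)
    fix l :: real assume l: "0 \<le> l"
    show "(1 + l) powr \<beta> \<le> 2 powr \<beta> * (1 + indicator {2 ^ 0..} l * l powr \<beta>)"
    proof (cases "1 \<le> l")
      case True
      have "(1 + l) powr \<beta> \<le> (2 * l) powr \<beta>" using True assms by (intro powr_mono2) auto
      also have "\<dots> \<le> 2 powr \<beta> * (1 + l powr \<beta>)" using l by (simp add: powr_mult)
      finally show ?thesis using True by simp
    next
      case False
      then show ?thesis using l assms by (simp add: powr_mono2)
    qed
  qed
  also have "\<dots> = ennreal (2 powr \<beta>) * (ennreal ((norm x)\<^sup>2) + tail \<beta> 0 x)"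
    unfolding tail_def J_one[symmetric] by (subst J_cmult, measurable, simp, subst J_add) auto
  finally show ?thesis .
qed

lemma sob_tail_le_tail:
  assumes "0 < \<beta>"
  shows "J (\<lambda>l. indicator {2 ^ K..} l * (1 + l) powr \<beta>) x \<le> ennreal (2 powr \<beta>) * tail \<beta> K x"
proof -
  have "J (\<lambda>l. indicator {2 ^ K..} l * (1 + l) powr \<beta>) x \<le> J (\<lambda>l. 2 powr \<beta> * (indicator {2 ^ K..} l * l powr \<beta>)) x"
  proof (rule J_mono)
    fix l :: real assume l: "0 \<le> l"
    show "indicator {2 ^ K..} l * (1 + l) powr \<beta> \<le> 2 powr \<beta> * (indicator {2 ^ K..} l * l powr \<beta>)"
    proof (cases "2 ^ K \<le> l")
      case True
      then have "1 \<le> l" using order_trans[OF one_le_power[of "2::real" K]] by simp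
      then have "(1 + l) powr \<beta> \<le> (2 * l) powr \<beta>" using assms by (intro powr_mono2) auto
      then show ?thesis using True l by (simp add: powr_mult)
    qed simp
  qed
  also have "\<dots> = ennreal (2 powr \<beta>) * tail \<beta> K x"
    unfolding tail_def by (rule J_cmult) auto
  finally show ?thesis .
qed

lemma soft_tail_le_sob:
  assumes "0 < \<beta>"
  shows "soft_tail \<beta> K x \<le> J (\<lambda>l. (1 + l) powr \<beta>) x"
  unfolding soft_tail_def
proof (rule J_mono)
  fix l :: real assume l: "0 \<le> l"
  have "l powr \<beta> * (l powr \<beta> / (l powr \<beta> + (2 ^ K) powr \<beta>)) \<le> l powr \<beta> * 1"
    by (intro mult_left_mono) (auto simp: divide_le_eq_1 add_nonneg_pos)
  also have "\<dots> \<le> (1 + l) powr \<beta>" using l assms by (simp add: powr_mono2)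
  finally show "l powr \<beta> * (l powr \<beta> / (l powr \<beta> + (2 ^ K) powr \<beta>)) \<le> (1 + l) powr \<beta>" .
qed

text \<open>Below \<Lambda> the fraction in the soft weight is at most (\<Lambda>/2^K)^\<beta>,
  above it at most 1. Equicontinuity of the data fixes \<Lambda>; K is then taken large.\<close>

lemma soft_tail_split:
  assumes "0 < \<beta>" "0 < \<Lambda>"
  shows "soft_tail \<beta> K x \<le> ennreal ((\<Lambda> / 2 ^ K) powr \<beta>) * J (\<lambda>l. (1 + l) powr \<beta>) x
    + J (\<lambda>l. indicator {\<Lambda>..} l * (1 + l) powr \<beta>) x"
proof -
  have "soft_tail \<beta> K x \<le> J (\<lambda>l. (\<Lambda> / 2 ^ K) powr \<beta> * (1 + l) powr \<beta> + indicator {\<Lambda>..} l * (1 + l) powr \<beta>) x"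
    unfolding soft_tail_def
  proof (rule J_mono)
    fix l :: real assume l: "0 \<le> l"
    have le: "l powr \<beta> \<le> (1 + l) powr \<beta>" using l assms by (simp add: powr_mono2)
    have frac: "0 \<le> l powr \<beta> / (l powr \<beta> + (2 ^ K) powr \<beta>)" "l powr \<beta> / (l powr \<beta> + (2 ^ K) powr \<beta>) \<le> 1"
      by (auto simp: divide_le_eq_1 add_nonneg_pos)
    show "l powr \<beta> * (l powr \<beta> / (l powr \<beta> + (2 ^ K) powr \<beta>))
        \<le> (\<Lambda> / 2 ^ K) powr \<beta> * (1 + l) powr \<beta> + indicator {\<Lambda>..} l * (1 + l) powr \<beta>"
    proof (cases "\<Lambda> \<le> l")
      case True
      have "l powr \<beta> * (l powr \<beta> / (l powr \<beta> + (2 ^ K) powr \<beta>)) \<le> (1 + l) powr \<beta> * 1"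
        using le frac by (intro mult_mono) auto
      then show ?thesis using True by (simp add: add_increasing)
    next
      case False
      have "l powr \<beta> / (l powr \<beta> + (2 ^ K) powr \<beta>) \<le> \<Lambda> powr \<beta> / (2 ^ K) powr \<beta>"
        using False l assms by (intro frac_le powr_mono2) auto
      also have "\<dots> = (\<Lambda> / 2 ^ K) powr \<beta>" using assms by (simp add: powr_divide)
      finally have "l powr \<beta> * (l powr \<beta> / (l powr \<beta> + (2 ^ K) powr \<beta>)) \<le> (1 + l) powr \<beta> * (\<Lambda> / 2 ^ K) powr \<beta>"
        using le frac by (intro mult_mono) auto
      then show ?thesis using False by (simp add: mult.commute)
    qed
  qed
  also have "\<dots> = J (\<lambda>l. (\<Lambda> / 2 ^ K) powr \<beta> * (1 + l) powr \<beta>) x + J (\<lambda>l. indicator {\<Lambda>..} l * (1 + l) powr \<beta>) x"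
    by (rule J_add) auto
  also have "J (\<lambda>l. (\<Lambda> / 2 ^ K) powr \<beta> * (1 + l) powr \<beta>) x = ennreal ((\<Lambda> / 2 ^ K) powr \<beta>) * J (\<lambda>l. (1 + l) powr \<beta>) x"
    by (rule J_cmult) auto
  finally show ?thesis .
qed

lemma cal_h_norm_components:
  assumes "(q, p) \<in> cal_h D A s" "cal_h_norm D A s (q, p) \<le> r"
  shows "J (\<lambda>l. (1 + l) powr (s - 1)) p \<le> ennreal (r\<^sup>2)" "J (\<lambda>l. (1 + l) powr (s - 1)) (sqrt_op D A q) \<le> ennreal (r\<^sup>2)"
proof -
  have "(cal_h_norm D A s (q, p))\<^sup>2 \<le> r\<^sup>2" using assms(2) cal_h_norm_nonneg by (rule power_mono)
  then have "J (\<lambda>l. (1 + l) powr (s - 1)) (sqrt_op D A q) + J (\<lambda>l. (1 + l) powr (s - 1)) p \<le> ennreal (r\<^sup>2)"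
    unfolding cal_h_norm_J[OF assms(1), symmetric] by (rule ennreal_leI)
  then show "J (\<lambda>l. (1 + l) powr (s - 1)) p \<le> ennreal (r\<^sup>2)" "J (\<lambda>l. (1 + l) powr (s - 1)) (sqrt_op D A q) \<le> ennreal (r\<^sup>2)"
    by (auto elim: order_trans[rotated] simp: add_increasing add_increasing2)
qed

section \<open>Bounds and equicontinuity in the given Sobolev scale\<close>

context
  fixes s :: real
  assumes s: "1 < s"
begin

text \<open>Division by c(q) = 1/(1 + |A^(1/2) q|^2). With m of order 1 + t^2 this is the source of
  the factor <t> for A^(1/2) q, absent for p.\<close>

lemma kcoef_weight:
  assumes "ennreal (kcoef D A q) * a \<le> ennreal c" "1 + (norm (sqrt_op D A q))\<^sup>2 \<le> m" "0 \<le> c"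
  shows "a \<le> ennreal (m * c)"
proof -
  define k where "k = 1 + (norm (sqrt_op D A q))\<^sup>2"
  have k: "0 < k" "kcoef D A q = 1 / k" by (simp_all add: k_def kcoef_def add_pos_nonneg)
  have "a = ennreal k * (ennreal (1 / k) * a)"
    using k(1) by (simp add: mult.assoc[symmetric] ennreal_mult'[symmetric])
  also have "\<dots> \<le> ennreal k * ennreal c" using assms(1) unfolding k by (rule mult_left_mono) simp
  also have "\<dots> \<le> ennreal m * ennreal c" using assms(2) unfolding k_def by (intro mult_right_mono ennreal_leI) auto
  also have "\<dots> = ennreal (m * c)" using assms(3) by (simp add: ennreal_mult'')
  finally show ?thesis .
qed

text \<open>The X-norms from the energy bound account for frequencies below 1, the tail at K = 0 for
  those above. The third bound is kept for the equicontinuity proof, where c(q(t)) has to be divided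
  out again.\<close>

lemma solution_bounds:
  assumes r: "0 \<le> r"
  shows "\<exists>C\<ge>0. \<forall>I q p. open_interval I \<longrightarrow> 0 \<in> I \<longrightarrow> cal_h_inf_solution D A I q p \<longrightarrow>
    cal_h_norm D A s (q 0, p 0) \<le> r \<longrightarrow>
    (\<forall>t\<in>I. sob_norm D A (s - 1) (p t) \<le> C \<and>
      sob_norm D A (s - 1) (sqrt_op D A (q t)) \<le> C * sqrt (1 + t\<^sup>2) \<and>
      1 + (norm (sqrt_op D A (q t)))\<^sup>2 \<le> C * (1 + t\<^sup>2))"
proof -
  define \<beta> where "\<beta> = s - 1"
  have \<beta>: "0 < \<beta>" using s by (simp add: \<beta>_def)
  obtain N :: nat where N: "2 * \<beta> \<le> real N" using real_arch_simple by blast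
  define R where "R = r\<^sup>2"
  have R: "0 \<le> R" by (simp add: R_def)
  obtain G where G: "0 \<le> G" and growth: "\<And>I q p t. cal_h_solution D A 2 I q p \<Longrightarrow> is_interval I \<Longrightarrow> 0 \<in> I \<Longrightarrow>
      J (\<lambda>l. (1 + l) powr \<beta>) (p 0) \<le> ennreal R \<Longrightarrow> J (\<lambda>l. (1 + l) powr \<beta>) (sqrt_op D A (q 0)) \<le> ennreal R \<Longrightarrow>
      t \<in> I \<Longrightarrow> 1 + (norm (sqrt_op D A (q t)))\<^sup>2 \<le> G * (1 + t\<^sup>2)"
    using growth[OF \<beta> R] by blast
  \<comment> \<open>The factor 2^\<beta> is the loss in \<open>sob_le_tail\<close>; the absolute
    value spares a discussion of the sign of \<open>tail_const\<close>.\<close>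
  define M where "M = 2 powr \<beta> * ((1 + R) * (2 * R) + \<bar>tail_const R \<beta> N\<bar> * (2 * R))"
  have M: "0 \<le> M" using R by (simp add: M_def)
  define C where "C = sqrt M + sqrt (G * M) + G"
  have C: "0 \<le> C" using M G by (simp add: C_def)
  have "sob_norm D A \<beta> (p t) \<le> C \<and> sob_norm D A \<beta> (sqrt_op D A (q t)) \<le> C * sqrt (1 + t\<^sup>2) \<and>
      1 + (norm (sqrt_op D A (q t)))\<^sup>2 \<le> C * (1 + t\<^sup>2)"
    if I: "open_interval I" "0 \<in> I" and sol: "cal_h_inf_solution D A I q p"
      and norm: "cal_h_norm D A s (q 0, p 0) \<le> r" and t: "t \<in> I" for I q p t
  proof -
    have sol2: "cal_h_solution D A 2 I q p" and sols: "cal_h_solution D A s I q p"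
      using sol s unfolding cal_h_inf_solution_def by auto
    have int: "is_interval I" using I(1) by (simp add: open_interval_def)
    have mem: "(q \<tau>, p \<tau>) \<in> cal_h D A s" if "\<tau> \<in> I" for \<tau> using sols that unfolding cal_h_solution_def by blast
    note init = cal_h_norm_components[OF mem[OF I(2)] norm, folded \<beta>_def R_def]
    note R2 = norm_le_J[OF \<beta> init(1) R] norm_le_J[OF \<beta> init(2) R]
    let ?c = "ennreal (kcoef D A (q t))" and ?r = "sqrt_op D A (q t)"
    have mt: "1 + (norm ?r)\<^sup>2 \<le> G * (1 + t\<^sup>2)" by (rule growth[OF sol2 int I(2) init t])
    have "ennreal ((norm (p t))\<^sup>2) + ?c * ennreal ((norm ?r)\<^sup>2) = ennreal ((norm (p t))\<^sup>2 + kcoef D A (q t) * (norm ?r)\<^sup>2)"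
      by (simp add: ennreal_mult less_imp_le[OF kcoef_pos])
    also have "\<dots> \<le> ennreal ((1 + R) * (2 * R))"
      by (rule ennreal_leI[OF energy_bound[OF sol2 int I(2) R2 t]])
    finally have low: "ennreal ((norm (p t))\<^sup>2) + ?c * ennreal ((norm ?r)\<^sup>2) \<le> ennreal ((1 + R) * (2 * R))" .
    have "tail \<beta> 0 (p t) + ?c * tail \<beta> 0 ?r
        \<le> ennreal (tail_const R \<beta> N) * (soft_tail \<beta> 0 (p 0) + soft_tail \<beta> 0 (sqrt_op D A (q 0)))"
      by (rule a_priori_tail[OF sol2 int I(2) R2 t \<beta> N])
    also have "\<dots> \<le> ennreal \<bar>tail_const R \<beta> N\<bar> * (ennreal R + ennreal R)"
      using order_trans[OF soft_tail_le_sob[OF \<beta>] init(1)] order_trans[OF soft_tail_le_sob[OF \<beta>] init(2)]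
      by (intro mult_mono add_mono ennreal_leI) auto
    also have "\<dots> = ennreal (\<bar>tail_const R \<beta> N\<bar> * (2 * R))"
      using R by (simp add: ennreal_mult ennreal_plus[symmetric] del: ennreal_plus)
    finally have high: "tail \<beta> 0 (p t) + ?c * tail \<beta> 0 ?r \<le> ennreal (\<bar>tail_const R \<beta> N\<bar> * (2 * R))" .
    have "J (\<lambda>l. (1 + l) powr \<beta>) (p t) + ?c * J (\<lambda>l. (1 + l) powr \<beta>) ?r
        \<le> ennreal (2 powr \<beta>) * (ennreal ((norm (p t))\<^sup>2) + tail \<beta> 0 (p t))
          + ?c * (ennreal (2 powr \<beta>) * (ennreal ((norm ?r)\<^sup>2) + tail \<beta> 0 ?r))"
      by (intro add_mono mult_left_mono sob_le_tail \<beta>) auto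
    also have "\<dots> = ennreal (2 powr \<beta>) * ((ennreal ((norm (p t))\<^sup>2) + ?c * ennreal ((norm ?r)\<^sup>2))
        + (tail \<beta> 0 (p t) + ?c * tail \<beta> 0 ?r))"
      by (simp add: distrib_left mult.left_commute add_ac)
    also have "\<dots> \<le> ennreal (2 powr \<beta>) * (ennreal ((1 + R) * (2 * R)) + ennreal (\<bar>tail_const R \<beta> N\<bar> * (2 * R)))"
      by (intro mult_left_mono add_mono low high) auto
    also have "\<dots> = ennreal M"
    proof -
      have "ennreal a * (ennreal b + ennreal c) = ennreal (a * (b + c))" if "0 \<le> a" "0 \<le> b" "0 \<le> c" for a b c :: real
        using that by (simp add: ennreal_mult)
      then show ?thesis using R by (simp only: M_def) simp
    qed
    finally have total: "J (\<lambda>l. (1 + l) powr \<beta>) (p t) + ?c * J (\<lambda>l. (1 + l) powr \<beta>) ?r \<le> ennreal M" .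
    have sob: "p t \<in> sob_dom D A \<beta>" "?r \<in> sob_dom D A \<beta>" using mem[OF t] by (simp_all add: cal_h_def \<beta>_def)
    have "J (\<lambda>l. (1 + l) powr \<beta>) (p t) \<le> ennreal M" by (rule order_trans[OF _ total]) (simp add: add_increasing2)
    then have "(sob_norm D A \<beta> (p t))\<^sup>2 \<le> M" using M by (simp add: sob_norm_J[OF sob(1), symmetric])
    then have 1: "sob_norm D A \<beta> (p t) \<le> sqrt M" by (rule real_le_rsqrt)
    have "?c * J (\<lambda>l. (1 + l) powr \<beta>) ?r \<le> ennreal M" by (rule order_trans[OF _ total]) (simp add: add_increasing)
    from kcoef_weight[OF this mt M] have "(sob_norm D A \<beta> ?r)\<^sup>2 \<le> G * (1 + t\<^sup>2) * M"
      using M G by (simp add: sob_norm_J[OF sob(2), symmetric])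
    then have "sob_norm D A \<beta> ?r \<le> sqrt (G * (1 + t\<^sup>2) * M)" by (rule real_le_rsqrt)
    then have 2: "sob_norm D A \<beta> ?r \<le> sqrt (G * M) * sqrt (1 + t\<^sup>2)"
      by (simp add: real_sqrt_mult[symmetric] mult_ac)
    have "sqrt M \<le> C" "sqrt (G * M) \<le> C" "G \<le> C" using M G by (simp_all add: C_def)
    then have "sqrt M \<le> C" "sqrt (G * M) * sqrt (1 + t\<^sup>2) \<le> C * sqrt (1 + t\<^sup>2)" "G * (1 + t\<^sup>2) \<le> C * (1 + t\<^sup>2)"
      by (auto intro!: mult_right_mono)
    then show ?thesis using 1 2 mt by linarith
  qed
  then show ?thesis unfolding \<beta>_def using C by blast
qed

lemma evolved_bounded:
  assumes \<Omega>: "cal_h_bounded D A s \<Omega>"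
  shows "cal_h_bounded D A s (evolved_set D A \<Omega> T)"
proof -
  obtain M where M: "\<And>w. w \<in> \<Omega> \<Longrightarrow> cal_h_norm D A s w \<le> M" using \<Omega> unfolding cal_h_bounded_def by blast
  obtain C where C: "0 \<le> C" and bd: "\<And>I q p t. open_interval I \<Longrightarrow> 0 \<in> I \<Longrightarrow> cal_h_inf_solution D A I q p \<Longrightarrow>
      cal_h_norm D A s (q 0, p 0) \<le> max 0 M \<Longrightarrow> t \<in> I \<Longrightarrow> sob_norm D A (s - 1) (p t) \<le> C \<and>
      sob_norm D A (s - 1) (sqrt_op D A (q t)) \<le> C * sqrt (1 + t\<^sup>2)"
    using solution_bounds[of "max 0 M"] by auto
  have "w \<in> cal_h D A s \<and> cal_h_norm D A s w \<le> C * sqrt (1 + T\<^sup>2) + C" if w_in: "w \<in> evolved_set D A \<Omega> T" for w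
  proof -
    obtain q p I t where w: "w = (q t, p t)" and I: "open_interval I" "0 \<in> I" and sol: "cal_h_inf_solution D A I q p"
      and \<Omega>0: "(q 0, p 0) \<in> \<Omega>" and t: "t \<in> I" "- T \<le> t" "t \<le> T"
      using w_in unfolding evolved_set_def by auto
    have "cal_h_solution D A s I q p" using sol s unfolding cal_h_inf_solution_def by auto
    then have "w \<in> cal_h D A s" using t(1) unfolding w cal_h_solution_def by blast
    moreover have "cal_h_norm D A s (q 0, p 0) \<le> max 0 M" using M[OF \<Omega>0] by simp
    from bd[OF I sol this t(1)] have b: "sob_norm D A (s - 1) (p t) \<le> C"
      "sob_norm D A (s - 1) (sqrt_op D A (q t)) \<le> C * sqrt (1 + t\<^sup>2)" by blast+
    have "t\<^sup>2 \<le> T\<^sup>2" using t(2,3) by (intro abs_le_square_iff[THEN iffD1]) auto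
    then have "C * sqrt (1 + t\<^sup>2) \<le> C * sqrt (1 + T\<^sup>2)" using C by (intro mult_left_mono) auto
    then have "sqrt ((sob_norm D A (s - 1) (sqrt_op D A (q t)))\<^sup>2 + (sob_norm D A (s - 1) (p t))\<^sup>2) \<le> C * sqrt (1 + T\<^sup>2) + C"
      using b sqrt_sum_squares_le_sum[OF sob_norm_nonneg sob_norm_nonneg, of "s - 1" "sqrt_op D A (q t)" "s - 1" "p t"]
      by linarith
    ultimately show ?thesis unfolding w by (simp add: cal_h_norm_def)
  qed
  then show ?thesis unfolding cal_h_bounded_def by blast
qed

text \<open>At time t the tail beyond 2^K is at most a constant times the soft tail of the data,
  with a constant that is uniform over the set and over [-T, T]. Soft tails become uniformly small
  on fixing first \<Lambda>, from equicontinuity of the data, and then K.\<close>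

lemma evolved_equicontinuous:
  assumes \<Omega>: "cal_h_bounded D A s \<Omega>" "cal_h_equicontinuous D A s \<Omega>" and T: "0 < T"
  shows "cal_h_equicontinuous D A s (evolved_set D A \<Omega> T)"
  unfolding cal_h_equicontinuous_def
proof (intro allI impI)
  fix \<epsilon> :: real assume \<epsilon>: "0 < \<epsilon>"
  define \<beta> where "\<beta> = s - 1"
  have \<beta>: "0 < \<beta>" using s by (simp add: \<beta>_def)
  obtain N :: nat where N: "2 * \<beta> \<le> real N" using real_arch_simple by blast
  obtain M0 where M0: "\<And>w. w \<in> \<Omega> \<Longrightarrow> cal_h_norm D A s w \<le> M0" using \<Omega>(1) unfolding cal_h_bounded_def by blast
  define M where "M = max 0 M0"
  have M: "cal_h_norm D A s w \<le> M" if "w \<in> \<Omega>" for w using M0[OF that] by (simp add: M_def)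
  obtain G where G: "0 \<le> G" and growth: "\<And>I q p t. open_interval I \<Longrightarrow> 0 \<in> I \<Longrightarrow> cal_h_inf_solution D A I q p \<Longrightarrow>
      cal_h_norm D A s (q 0, p 0) \<le> M \<Longrightarrow> t \<in> I \<Longrightarrow> 1 + (norm (sqrt_op D A (q t)))\<^sup>2 \<le> G * (1 + t\<^sup>2)"
    using solution_bounds[of M] by (auto simp: M_def)
  define H where "H = 2 powr \<beta> * ((1 + G * (1 + T\<^sup>2)) * (\<bar>tail_const (M\<^sup>2) \<beta> N\<bar>))"
  have H: "0 \<le> H" using G by (simp add: H_def)
  \<comment> \<open>\<open>H\<close> collects all losses. The two copies of \<delta> below are the
    data above \<Lambda> and the remnant under it; H + 1 avoids division by 0.\<close>
  define \<delta> where "\<delta> = \<epsilon>\<^sup>2 / (H + 1) / 2"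
  have \<delta>: "0 < \<delta>" using \<epsilon> H by (simp add: \<delta>_def)
  have H\<delta>: "H * (\<delta> + \<delta>) \<le> \<epsilon>\<^sup>2"
  proof -
    have "\<delta> + \<delta> = \<epsilon>\<^sup>2 / (H + 1)" unfolding \<delta>_def by (rule field_sum_of_halves)
    then have "H * (\<delta> + \<delta>) = \<epsilon>\<^sup>2 * (H / (H + 1))" by simp
    also have "\<dots> \<le> \<epsilon>\<^sup>2 * 1" using H by (intro mult_left_mono) auto
    finally show ?thesis by simp
  qed
  obtain \<kappa>0 where \<kappa>0: "0 < \<kappa>0" and eq0: "\<And>q p. (q, p) \<in> \<Omega> \<Longrightarrow>
      cal_h_norm D A s (proj_ge D A \<kappa>0 q, proj_ge D A \<kappa>0 p) \<le> sqrt \<delta>"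
    using \<Omega>(2) real_sqrt_gt_zero[OF \<delta>] unfolding cal_h_equicontinuous_def by blast
  define \<Lambda> where "\<Lambda> = \<kappa>0\<^sup>2"
  have \<Lambda>: "0 < \<Lambda>" using \<kappa>0 by (simp add: \<Lambda>_def)
  \<comment> \<open>Makes the remnant 2 \<eta> M^2 of the two components of the data at most
    \<delta>.\<close>
  define \<eta> where "\<eta> = \<delta> / (2 * M\<^sup>2 + 1)"
  have \<eta>: "0 < \<eta>" using \<delta> by (simp add: \<eta>_def add_nonneg_pos)
  obtain K where K: "\<Lambda> / \<eta> powr (1 / \<beta>) < 2 ^ K" using real_arch_pow[of 2 "\<Lambda> / \<eta> powr (1 / \<beta>)"] by auto
  have "\<Lambda> / 2 ^ K \<le> \<eta> powr (1 / \<beta>)" using K \<eta> by (simp add: field_simps)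
  then have "(\<Lambda> / 2 ^ K) powr \<beta> \<le> (\<eta> powr (1 / \<beta>)) powr \<beta>" using \<Lambda> \<beta> by (intro powr_mono2) auto
  also have "\<dots> = \<eta>" using \<eta> \<beta> by (simp add: powr_powr)
  finally have \<Lambda>K: "(\<Lambda> / 2 ^ K) powr \<beta> \<le> \<eta>" .
  \<comment> \<open>\<open>proj_ge\<close> cuts at \<kappa>^2, the tails at 2^K.\<close>
  define \<kappa> where "\<kappa> = sqrt (2 ^ K)"
  have \<kappa>: "0 < \<kappa>" "\<kappa>\<^sup>2 = 2 ^ K" by (simp_all add: \<kappa>_def)
  have "cal_h_norm D A s (proj_ge D A \<kappa> q', proj_ge D A \<kappa> p') \<le> \<epsilon>" if w_in: "(q', p') \<in> evolved_set D A \<Omega> T" for q' p'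
  proof -
    obtain q p I t where q': "q' = q t" "p' = p t" and I: "open_interval I" "0 \<in> I" and sol: "cal_h_inf_solution D A I q p"
      and \<Omega>0: "(q 0, p 0) \<in> \<Omega>" and t: "t \<in> I" "- T \<le> t" "t \<le> T"
      using w_in unfolding evolved_set_def by auto
    have sol2: "cal_h_solution D A 2 I q p" and sols: "cal_h_solution D A s I q p"
      using sol s unfolding cal_h_inf_solution_def by auto
    have int: "is_interval I" using I(1) by (simp add: open_interval_def)
    have mem: "(q \<tau>, p \<tau>) \<in> cal_h D A s" if "\<tau> \<in> I" for \<tau> using sols that unfolding cal_h_solution_def by blast
    note init = cal_h_norm_components[OF mem[OF I(2)] M[OF \<Omega>0], folded \<beta>_def]
    note R2 = norm_le_J[OF \<beta> init(1) zero_le_power2] norm_le_J[OF \<beta> init(2) zero_le_power2]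
    let ?c = "ennreal (kcoef D A (q t))" and ?r = "sqrt_op D A (q t)" and ?init = "sqrt_op D A (q 0)"
    let ?h = "\<lambda>x. J (\<lambda>l. indicator {\<Lambda>..} l * (1 + l) powr \<beta>) x"
    have "?h ?init + ?h (p 0) \<le> ennreal \<delta>"
    proof -
      have "(cal_h_norm D A s (proj_ge D A \<kappa>0 (q 0), proj_ge D A \<kappa>0 (p 0)))\<^sup>2 \<le> (sqrt \<delta>)\<^sup>2"
        using eq0[OF \<Omega>0] cal_h_norm_nonneg by (rule power_mono)
      then have "ennreal ((cal_h_norm D A s (proj_ge D A \<kappa>0 (q 0), proj_ge D A \<kappa>0 (p 0)))\<^sup>2) \<le> ennreal \<delta>"
        using \<delta> by (intro ennreal_leI) simp
      then show ?thesis unfolding cal_h_proj_ge(2)[OF mem[OF I(2)]] \<beta>_def \<Lambda>_def .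
    qed
    moreover have "soft_tail \<beta> K x \<le> ennreal (\<eta> * M\<^sup>2) + ?h x" if "J (\<lambda>l. (1 + l) powr \<beta>) x \<le> ennreal (M\<^sup>2)" for x
    proof -
      have "soft_tail \<beta> K x \<le> ennreal ((\<Lambda> / 2 ^ K) powr \<beta>) * J (\<lambda>l. (1 + l) powr \<beta>) x + ?h x"
        by (rule soft_tail_split[OF \<beta> \<Lambda>])
      also have "\<dots> \<le> ennreal \<eta> * ennreal (M\<^sup>2) + ?h x"
        by (intro add_mono mult_mono ennreal_leI \<Lambda>K that) auto
      finally show ?thesis using \<eta> by (simp add: ennreal_mult)
    qed
    note this[OF init(1)] this[OF init(2)]
    ultimately have "soft_tail \<beta> K (p 0) + soft_tail \<beta> K ?init \<le> ennreal (\<eta> * M\<^sup>2) + ennreal (\<eta> * M\<^sup>2) + ennreal \<delta>"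
      by (rule_tac order_trans[OF add_mono]) (auto simp: add_ac intro: add_left_mono)
    also have "\<dots> = ennreal (\<eta> * (2 * M\<^sup>2) + \<delta>)" using \<eta> \<delta> by (simp add: ennreal_plus[symmetric] del: ennreal_plus)
    also have "\<dots> \<le> ennreal (\<delta> + \<delta>)"
    proof (rule ennreal_leI)
      have "\<eta> * (2 * M\<^sup>2) \<le> \<eta> * (2 * M\<^sup>2 + 1)" using \<eta> by simp
      also have "\<dots> = \<delta>" using add_nonneg_pos[of "2 * M\<^sup>2" 1] by (simp add: \<eta>_def)
      finally show "\<eta> * (2 * M\<^sup>2) + \<delta> \<le> \<delta> + \<delta>" by simp
    qed
    finally have soft: "soft_tail \<beta> K (p 0) + soft_tail \<beta> K ?init \<le> ennreal (\<delta> + \<delta>)" .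
    let ?tc = "\<bar>tail_const (M\<^sup>2) \<beta> N\<bar>"
    have "tail \<beta> K (p t) + ?c * tail \<beta> K ?r \<le> ennreal (tail_const (M\<^sup>2) \<beta> N) * (soft_tail \<beta> K (p 0) + soft_tail \<beta> K ?init)"
      by (rule a_priori_tail[OF sol2 int I(2) R2 t(1) \<beta> N])
    also have "\<dots> \<le> ennreal ?tc * ennreal (\<delta> + \<delta>)" by (intro mult_mono soft ennreal_leI) auto
    also have "\<dots> = ennreal (?tc * (\<delta> + \<delta>))" using \<delta> by (simp add: ennreal_mult)
    finally have total: "tail \<beta> K (p t) + ?c * tail \<beta> K ?r \<le> ennreal (?tc * (\<delta> + \<delta>))" .
    have "t\<^sup>2 \<le> T\<^sup>2" using t(2,3) by (intro abs_le_square_iff[THEN iffD1]) auto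
    then have "G * (1 + t\<^sup>2) \<le> G * (1 + T\<^sup>2)" using G by (intro mult_left_mono) auto
    then have mt: "1 + (norm ?r)\<^sup>2 \<le> G * (1 + T\<^sup>2)" using growth[OF I sol M[OF \<Omega>0] t(1)] by linarith
    have tp: "tail \<beta> K (p t) \<le> ennreal (?tc * (\<delta> + \<delta>))" by (rule order_trans[OF _ total]) (simp add: add_increasing2)
    have "?c * tail \<beta> K ?r \<le> ennreal (?tc * (\<delta> + \<delta>))" by (rule order_trans[OF _ total]) (simp add: add_increasing)
    then have tr: "tail \<beta> K ?r \<le> ennreal (G * (1 + T\<^sup>2) * (?tc * (\<delta> + \<delta>)))"
      by (rule kcoef_weight[OF _ mt]) (use \<delta> in simp)
    have "ennreal ((cal_h_norm D A s (proj_ge D A \<kappa> (q t), proj_ge D A \<kappa> (p t)))\<^sup>2)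
        \<le> ennreal (2 powr \<beta>) * tail \<beta> K ?r + ennreal (2 powr \<beta>) * tail \<beta> K (p t)"
      unfolding cal_h_proj_ge(2)[OF mem[OF t(1)]] \<kappa>(2) \<beta>_def[symmetric] by (intro add_mono sob_tail_le_tail \<beta>)
    also have "\<dots> \<le> ennreal (2 powr \<beta>) * ennreal (G * (1 + T\<^sup>2) * (?tc * (\<delta> + \<delta>))) + ennreal (2 powr \<beta>) * ennreal (?tc * (\<delta> + \<delta>))"
      by (intro add_mono mult_left_mono tp tr) auto
    also have "\<dots> = ennreal (H * (\<delta> + \<delta>))"
      using G \<delta> by (simp add: H_def ennreal_mult[symmetric] ennreal_plus[symmetric] algebra_simps del: ennreal_plus)
    also have "\<dots> \<le> ennreal (\<epsilon>\<^sup>2)" by (rule ennreal_leI[OF H\<delta>])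
    finally have "(cal_h_norm D A s (proj_ge D A \<kappa> (q t), proj_ge D A \<kappa> (p t)))\<^sup>2 \<le> \<epsilon>\<^sup>2" by simp
    then show ?thesis unfolding q' by (rule power2_le_imp_le) (use \<epsilon> in simp)
  qed
  then show "\<exists>\<kappa>>0. \<forall>(q, p)\<in>evolved_set D A \<Omega> T. cal_h_norm D A s (proj_ge D A \<kappa> q, proj_ge D A \<kappa> p) \<le> \<epsilon>"
    using \<kappa>(1) by blast
qed

end

end

theorem theorem4p3:
  fixes D :: "'a::{real_inner, complete_space} set" and A :: "'a \<Rightarrow> 'a" and s :: real
  assumes "self_adjoint_operator D A" and "nonneg_operator D A" and "s > 1"
  shows "(\<exists>C::real \<Rightarrow> real. (\<forall>r\<ge>0. 0 \<le> C r) \<and>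
           (\<forall>I q p. open_interval I \<longrightarrow> 0 \<in> I \<longrightarrow> cal_h_inf_solution D A I q p \<longrightarrow>
              (\<forall>t\<in>I.
                 sob_norm D A (s - 1) (p t) \<le> C (cal_h_norm D A s (q 0, p 0)) \<and>
                 sob_norm D A (s - 1) (sqrt_op D A (q t))
                   \<le> C (cal_h_norm D A s (q 0, p 0)) * sqrt (1 + t\<^sup>2))))
       \<and> (\<forall>\<Omega> T. \<Omega> \<subseteq> cal_h_inf D A \<longrightarrow> cal_h_bounded D A s \<Omega> \<longrightarrow> cal_h_equicontinuous D A s \<Omega> \<longrightarrow>
            T > 0 \<longrightarrow>
            cal_h_bounded D A s (evolved_set D A \<Omega> T) \<and>
            cal_h_equicontinuous D A s (evolved_set D A \<Omega> T))"
proof -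
  interpret nonneg_self_adjoint D A using assms(1,2) by unfold_locales
  \<comment> \<open>The constant is chosen for each radius r and then evaluated at the norm of the
    initial data itself.\<close>
  have "\<forall>r. \<exists>C. 0 \<le> r \<longrightarrow> 0 \<le> C \<and> (\<forall>I q p. open_interval I \<longrightarrow> 0 \<in> I \<longrightarrow> cal_h_inf_solution D A I q p \<longrightarrow>
    cal_h_norm D A s (q 0, p 0) \<le> r \<longrightarrow>
    (\<forall>t\<in>I. sob_norm D A (s - 1) (p t) \<le> C \<and> sob_norm D A (s - 1) (sqrt_op D A (q t)) \<le> C * sqrt (1 + t\<^sup>2)))"
    using solution_bounds[OF assms(3)] by meson
  then obtain C where C: "\<And>r. 0 \<le> r \<Longrightarrow> 0 \<le> C r \<and> (\<forall>I q p. open_interval I \<longrightarrow> 0 \<in> I \<longrightarrow> cal_h_inf_solution D A I q p \<longrightarrow>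
    cal_h_norm D A s (q 0, p 0) \<le> r \<longrightarrow>
    (\<forall>t\<in>I. sob_norm D A (s - 1) (p t) \<le> C r \<and> sob_norm D A (s - 1) (sqrt_op D A (q t)) \<le> C r * sqrt (1 + t\<^sup>2)))"
    by metis
  show ?thesis
  proof (intro conjI allI impI)
    show "\<exists>C::real \<Rightarrow> real. (\<forall>r\<ge>0. 0 \<le> C r) \<and>
           (\<forall>I q p. open_interval I \<longrightarrow> 0 \<in> I \<longrightarrow> cal_h_inf_solution D A I q p \<longrightarrow>
              (\<forall>t\<in>I.
                 sob_norm D A (s - 1) (p t) \<le> C (cal_h_norm D A s (q 0, p 0)) \<and>
                 sob_norm D A (s - 1) (sqrt_op D A (q t))
                   \<le> C (cal_h_norm D A s (q 0, p 0)) * sqrt (1 + t\<^sup>2)))"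
      using C[OF cal_h_norm_nonneg] C by (intro exI[of _ C]) blast
  qed (use evolved_bounded[OF assms(3)] evolved_equicontinuous[OF assms(3)] in blast)+
qed

end
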